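(* Let $p$ be a prime and let $R=\mathbb{Z}_{(p)}[x_1,\ldots,x_n]$ be the graded polynomial ring with the gradings $|x_i|$ positive integers, and let $D=\sum_{i=1}^n|x_i|$. If $M$ is a locally finite graded $R$-module, then there is an isomorphism of graded right $R$-modules $$\operatorname{Ext}_R^{s}(M,R)\approx\begin{cases}\Sigma^DM^\vee & s=n+1,\\ 0 & s\ne n+1.\end{cases}$$
   Context: $\mathbb{Z}_{(p)}$ is the integers localized at $p$, in grading $0$. A graded $R$-module $M$ is locally finite if for each integer $i$, the $R$-submodule of $M$ generated by $M_i$ is finite (as a set). $M^\vee$ denotes the Pontryagin dual, the right $R$-module $\operatorname{Hom}(M,\mathbb{Q}/\mathbb{Z})$ (homomorphisms of abelian groups, with $R$ acting through $M$), formed degreewise, with $\operatorname{Hom}(M_i,\mathbb{Q}/\mathbb{Z})$ placed in grading $i$; localized at $p$, $\mathbb{Q}/\mathbb{Z}$ is written $\mathbb{Z}/p^\infty$. $\Sigma^DN$ denotes the graded module obtained from the graded module $N$ by increasing gradings by $D$. Ext groups are taken in the category of graded $R$-modules: $\operatorname{Ext}_R^s(M,R)$ is the graded module with components $\operatorname{Ext}_R^{s,t}(M,R)$, the second superscript $t$ referring to the grading, where $\operatorname{Ext}_R^{0,t}(M,R)=\operatorname{Hom}_R^t(M,R)$ consists of the $R$-homomorphisms sending $M_i$ to $R_{i-t}$ for all $i$ (so that the dual of a generator in grading $t$ has grading $t$). *)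

theory Defs
  imports
    Complex_Main "HOL-Algebra.Module" "HOL-Algebra.Coset" "HOL-Algebra.Elementary_Groups"
    "HOL-Library.Poly_Mapping" "HOL-Computational_Algebra.Primes"
begin

section \<open>Graded rings and graded modules\<close>

text \<open>A graded ring or module is a HOL-Algebra ring or module together with its family of
  homogeneous components, indexed by all integers.\<close>

record 'r gring = "'r ring" +
  hpart :: "int \<Rightarrow> 'r set"

record ('r, 'm) gmodule = "('r, 'm) module" +
  gpart :: "int \<Rightarrow> 'm set"

locale graded_module = module R M
  for R :: "'r gring" (structure) and M :: "('r, 'm) gmodule" (structure) +
  assumes gpart_subgroup: "subgroup (gpart M i) (add_monoid M)"
    and gpart_smult: "\<lbrakk>r \<in> hpart R d; x \<in> gpart M i\<rbrakk> \<Longrightarrow> r \<odot>\<^bsub>M\<^esub> x \<in> gpart M (d + i)"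
    and gpart_direct_sum: "x \<in> carrier M \<Longrightarrow>
      \<exists>!c. (\<forall>i. c i \<in> gpart M i) \<and> finite {i. c i \<noteq> \<zero>\<^bsub>M\<^esub>} \<and>
           x = (\<Oplus>\<^bsub>M\<^esub>i\<in>{i. c i \<noteq> \<zero>\<^bsub>M\<^esub>}. c i)"

definition regular_gmodule :: "'r gring \<Rightarrow> ('r, 'r) gmodule"
  where "regular_gmodule R =
    \<lparr>carrier = carrier R, monoid.mult = monoid.mult R, one = one R, zero = zero R, add = add R,
     smult = monoid.mult R, gpart = hpart R\<rparr>"

definition submodule_generated :: "'r gring \<Rightarrow> ('r, 'm) gmodule \<Rightarrow> 'm set \<Rightarrow> 'm set"
  where "submodule_generated R M S = \<Inter>{N. submodule N R M \<and> S \<subseteq> N}"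

definition locally_finite :: "'r gring \<Rightarrow> ('r, 'm) gmodule \<Rightarrow> bool"
  where "locally_finite R M \<longleftrightarrow> (\<forall>i. finite (submodule_generated R M (gpart M i)))"


section \<open>Graded modules given degreewise\<close>

text \<open>Duals, Hom and Ext are formed degree by degree. They are represented by the family of
  groups in each degree (written multiplicatively, as usual in HOL-Algebra) together with the
  maps \<^term>\<open>act N d t r\<close> giving the action of a scalar \<^term>\<open>r\<close> of degree \<^term>\<open>d\<close> on the part of
  degree \<^term>\<open>t\<close>. Since \<^term>\<open>R\<close> acts through the contravariant argument, this action
  lowers the degree: it goes from degree \<^term>\<open>t\<close> to degree \<^term>\<open>t - d\<close>.\<close>

record ('r, 'a) degreewise_module =
  part :: "int \<Rightarrow> 'a monoid"
  act :: "int \<Rightarrow> int \<Rightarrow> 'r \<Rightarrow> 'a \<Rightarrow> 'a"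

definition degreewise_iso ::
    "'r gring \<Rightarrow> ('r, 'a) degreewise_module \<Rightarrow> ('r, 'b) degreewise_module \<Rightarrow> bool"
  where "degreewise_iso R A B \<longleftrightarrow>
    (\<exists>\<phi>. (\<forall>t. \<phi> t \<in> iso (part A t) (part B t)) \<and>
         (\<forall>d t. \<forall>r\<in>hpart R d. \<forall>x\<in>carrier (part A t).
            \<phi> (t - d) (act A d t r x) = act B d t r (\<phi> t x)))"

definition degreewise_zero :: "('r, 'a) degreewise_module \<Rightarrow> bool"
  where "degreewise_zero A \<longleftrightarrow> (\<forall>t. trivial_group (part A t))"

definition suspension ::
    "int \<Rightarrow> ('r, 'a) degreewise_module \<Rightarrow> ('r, 'a) degreewise_module"
  where "suspension D N = \<lparr>part = (\<lambda>i. part N (i - D)), act = (\<lambda>d i. act N d (i - D))\<rparr>"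


section \<open>The Pontryagin dual\<close>

definition rat_group :: "rat monoid"
  where "rat_group = \<lparr>carrier = UNIV, monoid.mult = (+), one = 0\<rparr>"

definition Q_mod_Z :: "rat set monoid"
  where "Q_mod_Z = rat_group Mod \<int>"

text \<open>Homomorphisms are made extensional, so that equal maps are equal functions.\<close>

definition pontryagin_dual ::
    "('r, 'm) gmodule \<Rightarrow> ('r, 'm \<Rightarrow> rat set) degreewise_module"
  where "pontryagin_dual M =
    \<lparr>part = (\<lambda>i.
       \<lparr>carrier = hom ((add_monoid M)\<lparr>carrier := gpart M i\<rparr>) Q_mod_Z \<inter> extensional (gpart M i),
        monoid.mult = (\<lambda>\<phi> \<psi>. \<lambda>x\<in>gpart M i. \<phi> x \<otimes>\<^bsub>Q_mod_Z\<^esub> \<psi> x),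
        one = (\<lambda>x\<in>gpart M i. \<one>\<^bsub>Q_mod_Z\<^esub>)\<rparr>),
     act = (\<lambda>d i r \<phi>. \<lambda>x\<in>gpart M (i - d). \<phi> (r \<odot>\<^bsub>M\<^esub> x))\<rparr>"


section \<open>Ext of graded modules\<close>

definition linear_maps :: "'r gring \<Rightarrow> ('r, 'm) gmodule \<Rightarrow> ('r, 'n) gmodule \<Rightarrow> ('m \<Rightarrow> 'n) set"
  where "linear_maps R M N =
    {f \<in> hom (add_monoid M) (add_monoid N).
       \<forall>r\<in>carrier R. \<forall>x\<in>carrier M. f (r \<odot>\<^bsub>M\<^esub> x) = r \<odot>\<^bsub>N\<^esub> f x}"

definition graded_Hom ::
    "'r gring \<Rightarrow> ('r, 'm) gmodule \<Rightarrow> ('r, 'n) gmodule \<Rightarrow> int \<Rightarrow> ('m \<Rightarrow> 'n) monoid"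
  where "graded_Hom R M N t =
    \<lparr>carrier = {f \<in> linear_maps R M N \<inter> extensional (carrier M).
                  \<forall>i. f ` gpart M i \<subseteq> gpart N (i - t)},
     monoid.mult = (\<lambda>f g. \<lambda>x\<in>carrier M. f x \<oplus>\<^bsub>N\<^esub> g x),
     one = (\<lambda>x\<in>carrier M. \<zero>\<^bsub>N\<^esub>)\<rparr>"

definition free_gmodule :: "'r gring \<Rightarrow> 'x set \<Rightarrow> ('x \<Rightarrow> int) \<Rightarrow> ('r, 'x \<Rightarrow> 'r) gmodule"
  where "free_gmodule R X deg =
    (let F = {f. (\<forall>x. f x \<in> carrier R) \<and> finite {x. f x \<noteq> \<zero>\<^bsub>R\<^esub>} \<and> {x. f x \<noteq> \<zero>\<^bsub>R\<^esub>} \<subseteq> X}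
     in \<lparr>carrier = F, monoid.mult = undefined, one = undefined,
         zero = (\<lambda>x. \<zero>\<^bsub>R\<^esub>), add = (\<lambda>f g x. f x \<oplus>\<^bsub>R\<^esub> g x),
         smult = (\<lambda>r f x. r \<otimes>\<^bsub>R\<^esub> f x),
         gpart = (\<lambda>i. {f \<in> F. \<forall>x. f x \<in> hpart R (i - deg x)})\<rparr>)"

definition linear_extension ::
    "'r gring \<Rightarrow> ('r, 'n) gmodule \<Rightarrow> ('x \<Rightarrow> 'n) \<Rightarrow> ('x \<Rightarrow> 'r) \<Rightarrow> 'n"
  where "linear_extension R N b f = (\<Oplus>\<^bsub>N\<^esub>x\<in>{x. f x \<noteq> \<zero>\<^bsub>R\<^esub>}. f x \<odot>\<^bsub>N\<^esub> b x)"

text \<open>The standard free resolution of \<^term>\<open>M\<close> has as basis in stage \<open>0\<close> all homogeneous elements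
  of \<^term>\<open>M\<close>, and as basis in stage \<open>k + 1\<close> all homogeneous cycles of stage \<open>k\<close>, where the
  cycles of stage \<open>0\<close> are those of the augmentation. A basis element \<open>Elt i m\<close> stands for
  \<^term>\<open>m\<close> in degree \<^term>\<open>i\<close>; a basis element \<open>Syz i z\<close> stands for the
  cycle of degree \<^term>\<open>i\<close> which is the formal linear combination \<^term>\<open>z\<close>. A cycle may be written as several
  lists \<^term>\<open>z\<close>; this only repeats it in the basis.\<close>

datatype ('r, 'm) gen = Elt int 'm | Syz int "('r \<times> ('r, 'm) gen) list"

primrec gen_deg :: "('r, 'm) gen \<Rightarrow> int"
  where "gen_deg (Elt i m) = i" | "gen_deg (Syz i z) = i"

primrec gen_elt :: "('r, 'm) gen \<Rightarrow> 'm"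
  where "gen_elt (Elt i m) = m" | "gen_elt (Syz i z) = undefined"

definition combination :: "'r gring \<Rightarrow> ('r \<times> 'x) list \<Rightarrow> 'x \<Rightarrow> 'r"
  where "combination R z =
    foldr (\<lambda>(r, y) f. (\<lambda>x. (if x = y then r else \<zero>\<^bsub>R\<^esub>) \<oplus>\<^bsub>R\<^esub> f x)) z (\<lambda>x. \<zero>\<^bsub>R\<^esub>)"

primrec gen_cycle :: "'r gring \<Rightarrow> ('r, 'm) gen \<Rightarrow> ('r, 'm) gen \<Rightarrow> 'r"
  where "gen_cycle R (Elt i m) = undefined" | "gen_cycle R (Syz i z) = combination R z"

definition std_augmentation ::
    "'r gring \<Rightarrow> ('r, 'm) gmodule \<Rightarrow> (('r, 'm) gen \<Rightarrow> 'r) \<Rightarrow> 'm"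
  where "std_augmentation R M = linear_extension R M gen_elt"

fun std_basis :: "'r gring \<Rightarrow> ('r, 'm) gmodule \<Rightarrow> nat \<Rightarrow> ('r, 'm) gen set"
  where
    "std_basis R M 0 = {Elt i m |i m. m \<in> gpart M i}"
  | "std_basis R M (Suc 0) =
      {Syz i z |i z. combination R z \<in> gpart (free_gmodule R (std_basis R M 0) gen_deg) i \<and>
         std_augmentation R M (combination R z) = \<zero>\<^bsub>M\<^esub>}"
  | "std_basis R M (Suc (Suc k)) =
      (let F = free_gmodule R (std_basis R M k) gen_deg;
           F' = free_gmodule R (std_basis R M (Suc k)) gen_deg
       in {Syz i z |i z. combination R z \<in> gpart F' i \<and>
             linear_extension R F (gen_cycle R) (combination R z) = \<zero>\<^bsub>F\<^esub>})"

definition std_free ::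
    "'r gring \<Rightarrow> ('r, 'm) gmodule \<Rightarrow> nat \<Rightarrow> ('r, ('r, 'm) gen \<Rightarrow> 'r) gmodule"
  where "std_free R M k = free_gmodule R (std_basis R M k) gen_deg"

text \<open>\<^term>\<open>std_boundary R M k\<close> goes from stage \<open>k + 1\<close> to stage \<open>k\<close>.\<close>

definition std_boundary ::
    "'r gring \<Rightarrow> ('r, 'm) gmodule \<Rightarrow> nat \<Rightarrow> (('r, 'm) gen \<Rightarrow> 'r) \<Rightarrow> ('r, 'm) gen \<Rightarrow> 'r"
  where "std_boundary R M k = linear_extension R (std_free R M k) (gen_cycle R)"

text \<open>The cohomology of the cochain complex \<open>Hom(F, N)\<close> of a chain complex
  \<^term>\<open>F\<close> with boundary maps \<^term>\<open>d k\<close> from \<^term>\<open>F (Suc k)\<close> to \<^term>\<open>F k\<close>.\<close>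

definition coboundary_map ::
    "(nat \<Rightarrow> ('r, 'f) gmodule) \<Rightarrow> (nat \<Rightarrow> 'f \<Rightarrow> 'f) \<Rightarrow> nat \<Rightarrow> ('f \<Rightarrow> 'n) \<Rightarrow> 'f \<Rightarrow> 'n"
  where "coboundary_map F d s f = compose (carrier (F (Suc s))) f (d s)"

definition cocycles ::
    "'r gring \<Rightarrow> (nat \<Rightarrow> ('r, 'f) gmodule) \<Rightarrow> (nat \<Rightarrow> 'f \<Rightarrow> 'f) \<Rightarrow> ('r, 'n) gmodule \<Rightarrow>
     nat \<Rightarrow> int \<Rightarrow> ('f \<Rightarrow> 'n) set"
  where "cocycles R F d N s t =
    kernel (graded_Hom R (F s) N t) (graded_Hom R (F (Suc s)) N t) (coboundary_map F d s)"

fun coboundaries ::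
    "'r gring \<Rightarrow> (nat \<Rightarrow> ('r, 'f) gmodule) \<Rightarrow> (nat \<Rightarrow> 'f \<Rightarrow> 'f) \<Rightarrow> ('r, 'n) gmodule \<Rightarrow>
     nat \<Rightarrow> int \<Rightarrow> ('f \<Rightarrow> 'n) set"
  where
    "coboundaries R F d N 0 t = {\<one>\<^bsub>graded_Hom R (F 0) N t\<^esub>}"
  | "coboundaries R F d N (Suc s) t =
      coboundary_map F d s ` carrier (graded_Hom R (F s) N t)"

definition Hom_cohomology ::
    "'r gring \<Rightarrow> (nat \<Rightarrow> ('r, 'f) gmodule) \<Rightarrow> (nat \<Rightarrow> 'f \<Rightarrow> 'f) \<Rightarrow> ('r, 'n) gmodule \<Rightarrow>
     nat \<Rightarrow> ('r, ('f \<Rightarrow> 'n) set) degreewise_module"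
  where "Hom_cohomology R F d N s =
    \<lparr>part = (\<lambda>t. (graded_Hom R (F s) N t)\<lparr>carrier := cocycles R F d N s t\<rparr>
                   Mod coboundaries R F d N s t),
     act = (\<lambda>e t r C. coboundaries R F d N s (t - e) <#>\<^bsub>graded_Hom R (F s) N (t - e)\<^esub>
              (\<lambda>f. \<lambda>x\<in>carrier (F s). f (r \<odot>\<^bsub>F s\<^esub> x)) ` C)\<rparr>"

definition graded_Ext ::
    "'r gring \<Rightarrow> nat \<Rightarrow> ('r, 'm) gmodule \<Rightarrow> ('r, 'n) gmodule \<Rightarrow>
     ('r, ((('r, 'm) gen \<Rightarrow> 'r) \<Rightarrow> 'n) set) degreewise_module"
  where "graded_Ext R s M N = Hom_cohomology R (std_free R M) (std_boundary R M) N s"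


section \<open>The graded polynomial ring\<close>

definition localized_ints :: "nat \<Rightarrow> rat set"
  where "localized_ints p = {of_int a / of_int b |a b. \<not> int p dvd b}"

type_synonym rat_mpoly = "(nat \<Rightarrow>\<^sub>0 nat) \<Rightarrow>\<^sub>0 rat"

definition weight :: "(nat \<Rightarrow> nat) \<Rightarrow> (nat \<Rightarrow>\<^sub>0 nat) \<Rightarrow> nat"
  where "weight w m = (\<Sum>i\<in>Poly_Mapping.keys m. w i * Poly_Mapping.lookup m i)"

text \<open>The polynomial ring in the variables indexed by \<open>1, \<dots>, n\<close> over the integers localized
  at \<^term>\<open>p\<close>, with the \<open>i\<close>-th variable in degree \<^term>\<open>w i\<close>.\<close>

definition graded_poly_ring :: "nat \<Rightarrow> nat \<Rightarrow> (nat \<Rightarrow> nat) \<Rightarrow> rat_mpoly gring"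
  where "graded_poly_ring p n w =
    (let P = {f. (\<forall>m. Poly_Mapping.lookup f m \<in> localized_ints p) \<and>
                 (\<forall>m\<in>Poly_Mapping.keys f. Poly_Mapping.keys m \<subseteq> {1..n})}
     in \<lparr>carrier = P, monoid.mult = (*), one = 1, zero = 0, add = (+),
         hpart = (\<lambda>d. {f \<in> P. \<forall>m\<in>Poly_Mapping.keys f. int (weight w m) = d})\<rparr>)"


section \<open>The standard free resolution is a resolution\<close>

text \<open>By \<open>std_resolution\<close> below, the modules and maps used to define Ext form an
  exact sequence of graded modules and degree-preserving linear maps ending in \<^term>\<open>M\<close>. The
  assumption on \<^term>\<open>R\<close> is that it is a commutative graded ring.\<close>

context graded_module begin

lemma gpart_sub: "x \<in> gpart M i \<Longrightarrow> x \<in> carrier M"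
  using subgroup.subset[OF gpart_subgroup] by auto

lemma gpart_zero: "\<zero>\<^bsub>M\<^esub> \<in> gpart M i"
  using subgroup.one_closed[OF gpart_subgroup] by auto

lemma gpart_add: "x \<in> gpart M i \<Longrightarrow> y \<in> gpart M i \<Longrightarrow> x \<oplus>\<^bsub>M\<^esub> y \<in> gpart M i"
  using subgroup.m_closed[OF gpart_subgroup] by auto

lemma gpart_neg: "x \<in> gpart M i \<Longrightarrow> \<ominus>\<^bsub>M\<^esub> x \<in> gpart M i"
  using subgroup.m_inv_closed[OF gpart_subgroup] by (auto simp: a_inv_def)

lemma decompE:
  assumes "x \<in> carrier M"
  obtains c I where "\<And>i. c i \<in> gpart M i" "finite I" "\<And>i. i \<notin> I \<Longrightarrow> c i = \<zero>\<^bsub>M\<^esub>"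
    "x = (\<Oplus>\<^bsub>M\<^esub>i\<in>I. c i)"
proof -
  obtain c where "(\<forall>i. c i \<in> gpart M i)" "finite {i. c i \<noteq> \<zero>\<^bsub>M\<^esub>}"
     "x = (\<Oplus>\<^bsub>M\<^esub>i\<in>{i. c i \<noteq> \<zero>\<^bsub>M\<^esub>}. c i)"
    using ex1_implies_ex[OF gpart_direct_sum[OF assms]] by blast
  then show ?thesis by (intro that[of c "{i. c i \<noteq> \<zero>\<^bsub>M\<^esub>}"]) auto
qed

lemma sum_shrink:
  assumes "\<And>i. c i \<in> gpart M i" "finite I" "\<And>i. i \<notin> I \<Longrightarrow> c i = \<zero>\<^bsub>M\<^esub>"
  shows "(\<Oplus>\<^bsub>M\<^esub>i\<in>I. c i) = (\<Oplus>\<^bsub>M\<^esub>i\<in>{i. c i \<noteq> \<zero>\<^bsub>M\<^esub>}. c i)" "finite {i. c i \<noteq> \<zero>\<^bsub>M\<^esub>}"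
proof -
  have sub: "{i. c i \<noteq> \<zero>\<^bsub>M\<^esub>} \<subseteq> I" using assms(3) by auto
  show "finite {i. c i \<noteq> \<zero>\<^bsub>M\<^esub>}" by (rule finite_subset[OF sub assms(2)])
  show "(\<Oplus>\<^bsub>M\<^esub>i\<in>I. c i) = (\<Oplus>\<^bsub>M\<^esub>i\<in>{i. c i \<noteq> \<zero>\<^bsub>M\<^esub>}. c i)"
    by (rule M.add.finprod_mono_neutral_cong_left[symmetric, OF assms(2) sub])
       (use assms gpart_sub in auto)
qed

lemma decomp_unique:
  assumes c: "\<And>i. c i \<in> gpart M i" "finite I" "\<And>i. i \<notin> I \<Longrightarrow> c i = \<zero>\<^bsub>M\<^esub>"
    and c': "\<And>i. c' i \<in> gpart M i" "finite J" "\<And>i. i \<notin> J \<Longrightarrow> c' i = \<zero>\<^bsub>M\<^esub>"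
    and eq: "(\<Oplus>\<^bsub>M\<^esub>i\<in>I. c i) = (\<Oplus>\<^bsub>M\<^esub>i\<in>J. c' i)"
  shows "c = c'"
proof -
  have car: "(\<Oplus>\<^bsub>M\<^esub>i\<in>I. c i) \<in> carrier M"
    by (intro M.finsum_closed) (use c gpart_sub in auto)
  show ?thesis
    using gpart_direct_sum[OF car] sum_shrink[of c, OF c] sum_shrink[of c', OF c'] c(1) c'(1) eq
    by (metis (no_types, lifting))
qed

end

locale graded_base =
  fixes R :: "'r gring" (structure)
  assumes reg: "graded_module R (regular_gmodule R)"
begin

sublocale RG: graded_module R "regular_gmodule R" by (rule reg)

lemma reg_simps [simp]: "carrier (regular_gmodule R) = carrier R" "zero (regular_gmodule R) = \<zero>"
  "add (regular_gmodule R) = add R" "smult (regular_gmodule R) = monoid.mult R" 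
  "gpart (regular_gmodule R) = hpart R"
  by (auto simp: regular_gmodule_def)

lemma reg_finsum: "finsum (regular_gmodule R) = finsum R"
proof -
  have "finsum (regular_gmodule R) f A = finsum R f A" for f :: "'b \<Rightarrow> 'r" and A
    by (simp add: finsum_def finprod_def)
  then show ?thesis by blast
qed

lemma hpart_sub: "x \<in> hpart R i \<Longrightarrow> x \<in> carrier R" using RG.gpart_sub by simp
lemma hpart_zero: "\<zero> \<in> hpart R i" using RG.gpart_zero by simp
lemma hpart_add: "x \<in> hpart R i \<Longrightarrow> y \<in> hpart R i \<Longrightarrow> x \<oplus> y \<in> hpart R i" 
  using RG.gpart_add by simp
lemma hpart_neg: "x \<in> hpart R i \<Longrightarrow> \<ominus> x \<in> hpart R i" 
proof -
  assume a: "x \<in> hpart R i"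
  have x: "x \<in> carrier R" using a hpart_sub by auto
  have "\<ominus>\<^bsub>regular_gmodule R\<^esub> x \<oplus> x = \<zero>" using RG.M.l_neg[of x] x by simp
  moreover have "\<ominus>\<^bsub>regular_gmodule R\<^esub> x \<in> carrier R" using RG.M.a_inv_closed[of x] x by simp
  ultimately have "\<ominus>\<^bsub>regular_gmodule R\<^esub> x = \<ominus> x" using x RG.R.minus_equality by metis
  then show ?thesis using RG.gpart_neg[of x i] a by simp
qed
lemma hpart_mult: "x \<in> hpart R i \<Longrightarrow> y \<in> hpart R j \<Longrightarrow> x \<otimes> y \<in> hpart R (i + j)" 
  using RG.gpart_smult by simp

lemmas hdecompE = RG.decompE[simplified reg_finsum reg_simps]
lemmas hdecomp_unique = RG.decomp_unique[simplified reg_finsum reg_simps]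

abbreviation "FM X deg \<equiv> free_gmodule R X deg"

lemma free_simps:
  "f \<in> carrier (FM X deg) \<longleftrightarrow>
    (\<forall>x. f x \<in> carrier R) \<and> finite {x. f x \<noteq> \<zero>} \<and> {x. f x \<noteq> \<zero>} \<subseteq> X"
  "zero (FM X deg) = (\<lambda>x. \<zero>)"
  "add (FM X deg) = (\<lambda>f g x. f x \<oplus> g x)"
  "smult (FM X deg) = (\<lambda>r f x. r \<otimes> f x)"
  "f \<in> gpart (FM X deg) i \<longleftrightarrow> f \<in> carrier (FM X deg) \<and> (\<forall>x. f x \<in> hpart R (i - deg x))"
  by (auto simp: free_gmodule_def Let_def)

lemma free_carrierI:
  assumes "\<And>x. h x \<in> carrier R" "{x. h x \<noteq> \<zero>} \<subseteq> S" "finite S" "S \<subseteq> X"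
  shows "h \<in> carrier (FM X deg)"
  unfolding free_simps using assms finite_subset by blast

lemma free_carrierD:
  assumes "f \<in> carrier (FM X deg)"
  shows "f x \<in> carrier R" "finite {x. f x \<noteq> \<zero>}" "{x. f x \<noteq> \<zero>} \<subseteq> X"
  using assms unfolding free_simps by blast+

lemma free_add_closed:
  assumes "f \<in> carrier (FM X deg)" "g \<in> carrier (FM X deg)"
  shows "f \<oplus>\<^bsub>FM X deg\<^esub> g \<in> carrier (FM X deg)"
proof (rule free_carrierI[where S = "{x. f x \<noteq> \<zero>} \<union> {x. g x \<noteq> \<zero>}"])
  note D = free_carrierD[OF assms(1)] free_carrierD[OF assms(2)]
  show "(f \<oplus>\<^bsub>FM X deg\<^esub> g) x \<in> carrier R" for x
    using D(1)[of x] D(4)[of x] by (simp add: free_simps)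
  show "{x. (f \<oplus>\<^bsub>FM X deg\<^esub> g) x \<noteq> \<zero>} \<subseteq> {x. f x \<noteq> \<zero>} \<union> {x. g x \<noteq> \<zero>}"
    by (auto simp: free_simps)
  show "finite ({x. f x \<noteq> \<zero>} \<union> {x. g x \<noteq> \<zero>})" using D by blast
  show "{x. f x \<noteq> \<zero>} \<union> {x. g x \<noteq> \<zero>} \<subseteq> X" using D by blast
qed

lemma free_smult_closed:
  assumes "r \<in> carrier R" "f \<in> carrier (FM X deg)"
  shows "r \<odot>\<^bsub>FM X deg\<^esub> f \<in> carrier (FM X deg)"
proof (rule free_carrierI[where S = "{x. f x \<noteq> \<zero>}"])
  show "(r \<odot>\<^bsub>FM X deg\<^esub> f) x \<in> carrier R" for x
    using free_carrierD(1)[OF assms(2), of x] assms(1) by (simp add: free_simps)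
  show "{x. (r \<odot>\<^bsub>FM X deg\<^esub> f) x \<noteq> \<zero>} \<subseteq> {x. f x \<noteq> \<zero>}"
    using assms(1) by (auto simp: free_simps)
qed (rule free_carrierD[OF assms(2)])+

lemma free_neg_closed:
  assumes "f \<in> carrier (FM X deg)"
  shows "(\<lambda>x. \<ominus> f x) \<in> carrier (FM X deg)"
proof (rule free_carrierI[where S = "{x. f x \<noteq> \<zero>}"])
  show "\<ominus> f x \<in> carrier R" for x
    using free_carrierD(1)[OF assms, of x] by simp
  show "{x. \<ominus> f x \<noteq> \<zero>} \<subseteq> {x. f x \<noteq> \<zero>}" by auto
qed (rule free_carrierD[OF assms])+

lemma free_module: "module R (FM X deg)"
proof (rule moduleI)
  show "cring R" by (rule RG.R.is_cring)
  show "abelian_group (FM X deg)"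
  proof (rule abelian_groupI)
    fix f assume f: "f \<in> carrier (FM X deg)"
    show "\<exists>g\<in>carrier (FM X deg). g \<oplus>\<^bsub>FM X deg\<^esub> f = \<zero>\<^bsub>FM X deg\<^esub>"
      using f free_neg_closed[OF f] by (intro bexI[of _ "\<lambda>x. \<ominus> f x"]) (auto simp: free_simps RG.R.l_neg)
  next
    show "\<zero>\<^bsub>FM X deg\<^esub> \<in> carrier (FM X deg)" by (simp add: free_simps)
  qed (simp_all add: free_add_closed, simp_all add: free_simps fun_eq_iff RG.R.a_ac)
next
  show "r \<odot>\<^bsub>FM X deg\<^esub> f \<in> carrier (FM X deg)" if "r \<in> carrier R" "f \<in> carrier (FM X deg)" for r f using that by (rule free_smult_closed)
next
  fix r s f assume r: "r \<in> carrier R" and s: "s \<in> carrier R" and f: "f \<in> carrier (FM X deg)"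
  have fc: "f x \<in> carrier R" for x using f by (simp add: free_simps)
  show "(r \<oplus> s) \<odot>\<^bsub>FM X deg\<^esub> f = r \<odot>\<^bsub>FM X deg\<^esub> f \<oplus>\<^bsub>FM X deg\<^esub> s \<odot>\<^bsub>FM X deg\<^esub> f"
    unfolding free_simps using RG.R.l_distr[OF r s] fc by (simp only: RG.R.l_distr[OF r s] refl)
  show "(r \<otimes> s) \<odot>\<^bsub>FM X deg\<^esub> f = r \<odot>\<^bsub>FM X deg\<^esub> (s \<odot>\<^bsub>FM X deg\<^esub> f)"
    unfolding free_simps by (simp only: RG.R.m_assoc[OF r s fc])
next
  fix r f g assume r: "r \<in> carrier R" and f: "f \<in> carrier (FM X deg)" and g: "g \<in> carrier (FM X deg)"
  have fc: "f x \<in> carrier R" "g x \<in> carrier R" for x using f g by (simp_all add: free_simps)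
  show "r \<odot>\<^bsub>FM X deg\<^esub> (f \<oplus>\<^bsub>FM X deg\<^esub> g) = r \<odot>\<^bsub>FM X deg\<^esub> f \<oplus>\<^bsub>FM X deg\<^esub> r \<odot>\<^bsub>FM X deg\<^esub> g"
    unfolding free_simps by (simp only: RG.R.r_distr[OF fc r])
next
  fix f assume f: "f \<in> carrier (FM X deg)"
  have fc: "f x \<in> carrier R" for x using f by (simp add: free_simps)
  show "\<one> \<odot>\<^bsub>FM X deg\<^esub> f = f"
    unfolding free_simps by (simp only: RG.R.l_one[OF fc])
qed

lemma free_finsum:
  assumes "finite I" "\<And>i. i \<in> I \<Longrightarrow> C i \<in> carrier (FM X deg)"
  shows "(\<Oplus>\<^bsub>FM X deg\<^esub>i\<in>I. C i) x = (\<Oplus>i\<in>I. C i x)"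
  using assms
proof (induction I rule: finite_induct)
  case empty
  interpret F: module R "FM X deg" by (rule free_module)
  show ?case by (simp add: free_simps)
next
  case (insert a I)
  interpret F: module R "FM X deg" by (rule free_module)
  have "(\<Oplus>\<^bsub>FM X deg\<^esub>i\<in>insert a I. C i) = C a \<oplus>\<^bsub>FM X deg\<^esub> (\<Oplus>\<^bsub>FM X deg\<^esub>i\<in>I. C i)"
    using insert by (intro F.M.finsum_insert) auto
  moreover have "(\<Oplus>i\<in>insert a I. C i x) = C a x \<oplus> (\<Oplus>i\<in>I. C i x)"
    using insert by (intro RG.R.finsum_insert) (auto simp: free_simps)
  ultimately show ?case using insert by (simp add: free_simps(3))
qed

lemma free_graded: "graded_module R (FM X deg)"
proof -
  interpret F: module R "FM X deg" by (rule free_module)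
  show ?thesis
  proof (intro graded_module.intro graded_module_axioms.intro free_module)
    fix i
    show "subgroup (gpart (FM X deg) i) (add_monoid (FM X deg))"
    proof (rule F.M.add.subgroupI)
      show "gpart (FM X deg) i \<subseteq> carrier (FM X deg)" by (auto simp: free_simps(5))
      have "\<zero>\<^bsub>FM X deg\<^esub> \<in> gpart (FM X deg) i" 
        unfolding free_simps(5) using F.M.zero_closed by (auto simp: free_simps(2) hpart_zero)
      then show "gpart (FM X deg) i \<noteq> {}" by auto
    next
      fix f assume f: "f \<in> gpart (FM X deg) i"
      then have fc: "f \<in> carrier (FM X deg)" by (auto simp: free_simps(5))
      have "\<ominus>\<^bsub>FM X deg\<^esub> f = (\<lambda>x. \<ominus> f x)"
        by (rule F.M.minus_equality) 
           (use fc free_neg_closed[OF fc] in \<open>auto simp: free_simps RG.R.l_neg\<close>)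
      moreover have "(\<lambda>x. \<ominus> f x) \<in> gpart (FM X deg) i"
        using f free_neg_closed[OF fc] unfolding free_simps(5) by (auto intro: hpart_neg)
      ultimately show "\<ominus>\<^bsub>FM X deg\<^esub> f \<in> gpart (FM X deg) i"
        by simp
    next
      fix f g assume "f \<in> gpart (FM X deg) i" "g \<in> gpart (FM X deg) i"
      then show "f \<oplus>\<^bsub>FM X deg\<^esub> g \<in> gpart (FM X deg) i"
        using F.M.a_closed[of f g] unfolding free_simps(5) by (auto simp: free_simps(3) intro: hpart_add)
    qed
  next
    fix r d f i assume r: "r \<in> hpart R d" and f: "f \<in> gpart (FM X deg) i"
    have "r \<otimes> f x \<in> hpart R (d + i - deg x)" for x
      using hpart_mult[OF r, of "f x" "i - deg x"] f by (simp add: free_simps(5) algebra_simps)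
    then show "r \<odot>\<^bsub>FM X deg\<^esub> f \<in> gpart (FM X deg) (d + i)"
      using f hpart_sub[OF r] F.smult_closed[of r f] unfolding free_simps(5) by (auto simp: free_simps(4))
  next
    fix f assume f: "f \<in> carrier (FM X deg)"
    let ?S = "{x. f x \<noteq> \<zero>}"
    have fS: "finite ?S" "?S \<subseteq> X" and fc: "\<And>x. f x \<in> carrier R" using f by (auto simp: free_simps(1))
    have "\<exists>c I. (\<forall>i. c i \<in> hpart R i) \<and> finite I \<and> (\<forall>i. i \<notin> I \<longrightarrow> c i = \<zero>) \<and> f x = (\<Oplus>i\<in>I. c i)" for x
      by (rule hdecompE[OF fc[of x]]) blast
    then obtain c I where c: "\<And>x i. c x i \<in> hpart R i" "\<And>x. finite (I x)" 
       "\<And>x i. i \<notin> I x \<Longrightarrow> c x i = \<zero>" "\<And>x. f x = (\<Oplus>i\<in>I x. c x i)"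
      by metis
    have c0: "c x = (\<lambda>_. \<zero>)" if "f x = \<zero>" for x
      by (rule hdecomp_unique[of "c x" "I x" "\<lambda>_. \<zero>" "{}"]) 
         (use c that hpart_zero in \<open>auto simp: RG.R.add.finprod_one_eqI\<close>)
    define C where "C i x = c x (i - deg x)" for i x
    define J where "J = (\<Union>x\<in>?S. (\<lambda>d. d + deg x) ` I x)"
    have J: "finite J" unfolding J_def using fS c(2) by auto
    have CJ: "C i = \<zero>\<^bsub>FM X deg\<^esub>" if "i \<notin> J" for i
    proof 
      fix x 
      show "C i x = \<zero>\<^bsub>FM X deg\<^esub> x"
      proof (cases "f x = \<zero>")
        case True then show ?thesis by (simp only: C_def c0 free_simps(2))
      next
        case False
        then have "i - deg x \<notin> I x" using that unfolding J_def by force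
        then have "c x (i - deg x) = \<zero>" by (rule c(3))
        then show ?thesis by (simp only: C_def free_simps(2))
      qed
    qed
    have Cg: "C i \<in> gpart (FM X deg) i" for i
    proof -
      have "{x. C i x \<noteq> \<zero>} \<subseteq> ?S" by (auto simp: C_def c0)
      then show ?thesis unfolding free_simps(5) free_simps(1) 
        using fS c(1) hpart_sub finite_subset unfolding C_def by blast
    qed
    have Csum: "f = (\<Oplus>\<^bsub>FM X deg\<^esub>i\<in>J. C i)"
    proof 
      fix x
      have "(\<Oplus>\<^bsub>FM X deg\<^esub>i\<in>J. C i) x = (\<Oplus>i\<in>J. c x (i - deg x))"
        using free_finsum[OF J, of C X deg x] Cg by (auto simp: C_def free_simps(5))
      also have "\<dots> = (\<Oplus>d\<in>(\<lambda>i. i - deg x) ` J. c x d)"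
        by (rule RG.R.add.finprod_reindex[symmetric, of "c x" "\<lambda>i. i - deg x"])
             (auto simp: inj_on_def intro: hpart_sub c(1))
      also have "\<dots> = (\<Oplus>d\<in>I x. c x d)"
      proof (cases "f x = \<zero>")
        case True then show ?thesis by (simp add: c0)
      next
        case False
        have cc: "c x i \<in> carrier R" for i using hpart_sub c(1) by blast
        have "I x \<subseteq> (\<lambda>i. i - deg x) ` J"
        proof 
          fix d assume "d \<in> I x"
          then have "d + deg x \<in> J" using False unfolding J_def by auto
          then show "d \<in> (\<lambda>i. i - deg x) ` J" by force
        qed
        then show ?thesis
          by (intro RG.R.add.finprod_mono_neutral_cong_right) (use J c cc in auto)
      qed
      also have "\<dots> = f x" using c(4) by simp
      finally show "f x = (\<Oplus>\<^bsub>FM X deg\<^esub>i\<in>J. C i) x" by simp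
    qed
    have Cc: "C i \<in> carrier (FM X deg)" for i using Cg[of i] by (simp add: free_simps(5))
    have fin: "finite {i. C i \<noteq> \<zero>\<^bsub>FM X deg\<^esub>}" by (rule finite_subset[OF _ J]) (use CJ in auto)
    have shr: "(\<Oplus>\<^bsub>FM X deg\<^esub>i\<in>J. C i) = (\<Oplus>\<^bsub>FM X deg\<^esub>i\<in>{i. C i \<noteq> \<zero>\<^bsub>FM X deg\<^esub>}. C i)"
      by (rule F.M.add.finprod_mono_neutral_cong_right) (use J CJ Cc in auto)
    show "\<exists>!c. (\<forall>i. c i \<in> gpart (FM X deg) i) \<and> finite {i. c i \<noteq> \<zero>\<^bsub>FM X deg\<^esub>} \<and>
           f = (\<Oplus>\<^bsub>FM X deg\<^esub>i\<in>{i. c i \<noteq> \<zero>\<^bsub>FM X deg\<^esub>}. c i)"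
    proof (rule ex1I[of _ C])
      show "(\<forall>i. C i \<in> gpart (FM X deg) i) \<and> finite {i. C i \<noteq> \<zero>\<^bsub>FM X deg\<^esub>} \<and>
           f = (\<Oplus>\<^bsub>FM X deg\<^esub>i\<in>{i. C i \<noteq> \<zero>\<^bsub>FM X deg\<^esub>}. C i)"
        using Cg fin trans[OF Csum shr] by (intro conjI allI)
    next
      fix C' assume C': "(\<forall>i. C' i \<in> gpart (FM X deg) i) \<and> finite {i. C' i \<noteq> \<zero>\<^bsub>FM X deg\<^esub>} \<and>
           f = (\<Oplus>\<^bsub>FM X deg\<^esub>i\<in>{i. C' i \<noteq> \<zero>\<^bsub>FM X deg\<^esub>}. C' i)"
      let ?K = "{i. C' i \<noteq> \<zero>\<^bsub>FM X deg\<^esub>}"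
      have eq: "(\<lambda>d. C' (d + deg x) x) = c x" for x
      proof (rule hdecomp_unique)
        show "C' (d + deg x) x \<in> hpart R d" for d using C' unfolding free_simps(5) by (metis add_diff_cancel_right')
        show "finite ((\<lambda>i. i - deg x) ` ?K)" using C' by auto
        show "C' (d + deg x) x = \<zero>" if "d \<notin> (\<lambda>i. i - deg x) ` ?K" for d
        proof -
          have "d + deg x \<notin> ?K" using that by force
          then show ?thesis by (simp add: free_simps(2))
        qed
        have "f x = (\<Oplus>i\<in>?K. C' i x)"
          using free_finsum[of ?K C' X deg x] C' by (auto simp: free_simps(5))
        also have "\<dots> = (\<Oplus>i\<in>?K. C' ((i - deg x) + deg x) x)" by simp
        also have "\<dots> = (\<Oplus>d\<in>(\<lambda>i. i - deg x) ` ?K. C' (d + deg x) x)"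
        proof (rule RG.R.add.finprod_reindex[symmetric, of "\<lambda>d. C' (d + deg x) x" "\<lambda>i. i - deg x"])
          show "(\<lambda>d. C' (d + deg x) x) \<in> (\<lambda>i. i - deg x) ` ?K \<rightarrow> carrier R" 
            using C' by (auto simp: free_simps)
        qed (auto simp: inj_on_def)
        finally show "(\<Oplus>d\<in>(\<lambda>i. i - deg x) ` ?K. C' (d + deg x) x) = (\<Oplus>d\<in>I x. c x d)" using c(4) by simp
      qed (use c in auto)
      show "C' = C"
      proof (intro ext)
        fix i x
        show "C' i x = C i x" using fun_cong[OF eq[of x], of "i - deg x"] by (simp add: C_def)
      qed
    qed
  qed
qed

end

context graded_base begin

lemma combination_ex:
  assumes "\<And>x. f x \<in> carrier R" "finite {x. f x \<noteq> \<zero>}"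
  shows "\<exists>z. combination R z = f"
proof -
  obtain xs where xs: "set xs = {x. f x \<noteq> \<zero>}" "distinct xs" using finite_distinct_list[OF assms(2)] by blast
  have "combination R (map (\<lambda>x. (f x, x)) ys) = (\<lambda>x. if x \<in> set ys then f x else \<zero>)"
    if "distinct ys" for ys
    using that
  proof (induction ys)
    case (Cons a ys)
    then show ?case using assms(1) by (auto simp: combination_def)
  qed (simp add: combination_def)
  from this[OF xs(2)] have "combination R (map (\<lambda>x. (f x, x)) xs) = f" using xs(1) by auto
  then show ?thesis ..
qed

end

locale lin_ext = graded_base R + N: graded_module R N for R :: "'r gring" (structure) and N :: "('r,'n) gmodule" +
  fixes X :: "'x set" and deg :: "'x \<Rightarrow> int" and b :: "'x \<Rightarrow> 'n"
  assumes b: "x \<in> X \<Longrightarrow> b x \<in> gpart N (deg x)"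
begin

sublocale F: graded_module R "FM X deg" by (rule free_graded)

lemma bc: "x \<in> X \<Longrightarrow> b x \<in> carrier N" using b N.gpart_sub by blast

lemma superset:
  assumes "f \<in> carrier (FM X deg)" "finite S" "{x. f x \<noteq> \<zero>} \<subseteq> S" "S \<subseteq> X"
  shows "linear_extension R N b f = (\<Oplus>\<^bsub>N\<^esub>x\<in>S. f x \<odot>\<^bsub>N\<^esub> b x)"
proof -
  have "f x \<odot>\<^bsub>N\<^esub> b x \<in> carrier N" if "x \<in> S" for x
    using that assms bc by (intro N.smult_closed) (auto simp: free_simps)
  then show ?thesis unfolding linear_extension_def
    by (intro N.M.add.finprod_mono_neutral_cong_left) (use assms bc in \<open>auto simp: free_simps\<close>)
qed

lemma closed: "f \<in> carrier (FM X deg) \<Longrightarrow> linear_extension R N b f \<in> carrier N"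
  unfolding linear_extension_def using bc
  by (intro N.M.finsum_closed) (auto simp: free_simps)

lemma additive:
  assumes "f \<in> carrier (FM X deg)" "g \<in> carrier (FM X deg)"
  shows "linear_extension R N b (f \<oplus>\<^bsub>FM X deg\<^esub> g) = linear_extension R N b f \<oplus>\<^bsub>N\<^esub> linear_extension R N b g"
proof -
  let ?S = "{x. f x \<noteq> \<zero>} \<union> {x. g x \<noteq> \<zero>}"
  have S: "finite ?S" "?S \<subseteq> X" and fc: "\<And>x. f x \<in> carrier R" "\<And>x. g x \<in> carrier R"
    using assms by (auto simp: free_simps)
  have sub: "{x. (f \<oplus>\<^bsub>FM X deg\<^esub> g) x \<noteq> \<zero>} \<subseteq> ?S" by (auto simp: free_simps)
  have "linear_extension R N b (f \<oplus>\<^bsub>FM X deg\<^esub> g) = (\<Oplus>\<^bsub>N\<^esub>x\<in>?S. (f \<oplus>\<^bsub>FM X deg\<^esub> g) x \<odot>\<^bsub>N\<^esub> b x)"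
    by (rule superset[OF _ S(1) sub S(2)]) (use assms F.M.a_closed in auto)
  also have "\<dots> = (\<Oplus>\<^bsub>N\<^esub>x\<in>?S. f x \<odot>\<^bsub>N\<^esub> b x \<oplus>\<^bsub>N\<^esub> g x \<odot>\<^bsub>N\<^esub> b x)"
    by (rule N.M.finsum_cong') (use S bc fc in \<open>auto simp: free_simps N.smult_l_distr subset_iff\<close>)
  also have "\<dots> = (\<Oplus>\<^bsub>N\<^esub>x\<in>?S. f x \<odot>\<^bsub>N\<^esub> b x) \<oplus>\<^bsub>N\<^esub> (\<Oplus>\<^bsub>N\<^esub>x\<in>?S. g x \<odot>\<^bsub>N\<^esub> b x)"
    by (rule N.M.finsum_addf) (use S bc fc in \<open>auto simp: subset_iff\<close>)
  also have "\<dots> = linear_extension R N b f \<oplus>\<^bsub>N\<^esub> linear_extension R N b g"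
    using superset[OF assms(1) S(1) _ S(2)] superset[OF assms(2) S(1) _ S(2)] by auto
  finally show ?thesis .
qed

lemma smult:
  assumes "f \<in> carrier (FM X deg)" "r \<in> carrier R"
  shows "linear_extension R N b (r \<odot>\<^bsub>FM X deg\<^esub> f) = r \<odot>\<^bsub>N\<^esub> linear_extension R N b f"
proof -
  let ?S = "{x. f x \<noteq> \<zero>}"
  have S: "finite ?S" "?S \<subseteq> X" and fc: "\<And>x. f x \<in> carrier R"
    using assms by (auto simp: free_simps)
  have sub: "{x. (r \<odot>\<^bsub>FM X deg\<^esub> f) x \<noteq> \<zero>} \<subseteq> ?S" using assms by (auto simp: free_simps)
  have "linear_extension R N b (r \<odot>\<^bsub>FM X deg\<^esub> f) = (\<Oplus>\<^bsub>N\<^esub>x\<in>?S. (r \<odot>\<^bsub>FM X deg\<^esub> f) x \<odot>\<^bsub>N\<^esub> b x)"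
    by (rule superset[OF _ S(1) sub S(2)]) (use assms F.smult_closed in auto)
  also have "\<dots> = (\<Oplus>\<^bsub>N\<^esub>x\<in>?S. r \<odot>\<^bsub>N\<^esub> (f x \<odot>\<^bsub>N\<^esub> b x))"
    by (rule N.M.finsum_cong') (use S bc fc assms(2) in \<open>auto simp: free_simps N.smult_assoc1 subset_iff\<close>)
  also have "\<dots> = r \<odot>\<^bsub>N\<^esub> linear_extension R N b f"
    unfolding linear_extension_def
    by (rule N.finsum_smult_ldistr[symmetric]) (use S bc fc assms(2) in \<open>auto simp: subset_iff\<close>)
  finally show ?thesis .
qed

lemma sum_in:
  assumes "subgroup K (add_monoid N)" "finite A" "\<And>x. x \<in> A \<Longrightarrow> g x \<in> K"
  shows "(\<Oplus>\<^bsub>N\<^esub>x\<in>A. g x) \<in> K"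
  using assms(2,3)
proof (induction A rule: finite_induct)
  case empty then show ?case using subgroup.one_closed[OF assms(1)] by simp
next
  case (insert a A)
  have "g x \<in> carrier N" if "x \<in> insert a A" for x
    using insert(4)[OF that] subgroup.subset[OF assms(1)] by auto
  then have "(\<Oplus>\<^bsub>N\<^esub>x\<in>insert a A. g x) = g a \<oplus>\<^bsub>N\<^esub> (\<Oplus>\<^bsub>N\<^esub>x\<in>A. g x)"
    using insert by (intro N.M.finsum_insert) auto
  then show ?case using insert subgroup.m_closed[OF assms(1)] by auto
qed

lemma graded:
  assumes "f \<in> gpart (FM X deg) i"
  shows "linear_extension R N b f \<in> gpart N i"
  unfolding linear_extension_def
proof (rule sum_in[OF N.gpart_subgroup])
  show "finite {x. f x \<noteq> \<zero>}" using assms unfolding free_simps by blast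
  fix x assume x: "x \<in> {x. f x \<noteq> \<zero>}"
  then have "x \<in> X" using assms unfolding free_simps by blast
  then show "f x \<odot>\<^bsub>N\<^esub> b x \<in> gpart N i"
    using N.gpart_smult[of "f x" "i - deg x" "b x" "deg x"] b assms by (auto simp: free_simps)
qed

lemma linear: "linear_extension R N b \<in> linear_maps R (FM X deg) N"
  unfolding linear_maps_def using closed additive smult by (auto simp: hom_def)

lemma image:
  assumes N': "graded_module R N'"
    and h: "h \<in> linear_maps R N N'" and hg: "\<And>i y. y \<in> gpart N i \<Longrightarrow> h y \<in> gpart N' i"
    and b0: "\<And>x. x \<in> X \<Longrightarrow> h (b x) = \<zero>\<^bsub>N'\<^esub>"
    and sur: "\<And>i y. y \<in> gpart N i \<Longrightarrow> h y = \<zero>\<^bsub>N'\<^esub> \<Longrightarrow> \<exists>x\<in>X. deg x = i \<and> b x = y"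
  shows "linear_extension R N b ` carrier (FM X deg) = {y \<in> carrier N. h y = \<zero>\<^bsub>N'\<^esub>}"
proof -
  interpret N': graded_module R N' by fact
  interpret h: group_hom "add_monoid N" "add_monoid N'" h
    using h unfolding group_hom_def group_hom_axioms_def linear_maps_def
    by (auto simp: N.M.add.is_group N'.M.add.is_group)
  have hm: "h (r \<odot>\<^bsub>N\<^esub> x) = r \<odot>\<^bsub>N'\<^esub> h x" if "r \<in> carrier R" "x \<in> carrier N" for r x
    using h that by (auto simp: linear_maps_def)
  let ?K = "{y \<in> carrier N. h y = \<zero>\<^bsub>N'\<^esub>}"
  have K: "subgroup ?K (add_monoid N)"
    using h.subgroup_kernel by (simp add: kernel_def)
  show ?thesis
  proof (intro equalityI subsetI)
    fix y assume "y \<in> linear_extension R N b ` carrier (FM X deg)"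
    then obtain f where f: "f \<in> carrier (FM X deg)" "y = linear_extension R N b f" by auto
    have fc: "\<And>x. f x \<in> carrier R" and fin: "finite {x. f x \<noteq> \<zero>}" and sX: "\<And>x. f x \<noteq> \<zero> \<Longrightarrow> x \<in> X" 
      using f unfolding free_simps by auto
    show "y \<in> ?K" unfolding f(2) linear_extension_def
      by (rule sum_in[OF K]) (use fin bc hm b0 sX fc in auto)
  next
    fix y assume y: "y \<in> ?K"
    then have yc: "y \<in> carrier N" "h y = \<zero>\<^bsub>N'\<^esub>" by auto
    obtain c I where c: "\<And>i. c i \<in> gpart N i" "finite I" "\<And>i. i \<notin> I \<Longrightarrow> c i = \<zero>\<^bsub>N\<^esub>" 
        "y = (\<Oplus>\<^bsub>N\<^esub>i\<in>I. c i)"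
      using N.decompE[OF yc(1)] by blast
    have cc: "c i \<in> carrier N" for i using c(1) N.gpart_sub by blast
    have hfin: "h (\<Oplus>\<^bsub>N\<^esub>i\<in>J. c i) = (\<Oplus>\<^bsub>N'\<^esub>i\<in>J. h (c i))" if "finite J" for J
      using that 
    proof (induction J rule: finite_induct)
      case empty then show ?case using h.hom_one by simp
    next
      case (insert a J)
      have hc: "h (c i) \<in> carrier N'" for i using h.hom_closed[of "c i"] cc by simp
      have s: "(\<Oplus>\<^bsub>N\<^esub>i\<in>J. c i) \<in> carrier N" using cc by (intro N.M.finsum_closed) auto
      have "h (\<Oplus>\<^bsub>N\<^esub>i\<in>insert a J. c i) = h (c a \<oplus>\<^bsub>N\<^esub> (\<Oplus>\<^bsub>N\<^esub>i\<in>J. c i))"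
        using N.M.finsum_insert[of J a c] insert cc by auto
      also have "\<dots> = h (c a) \<oplus>\<^bsub>N'\<^esub> h (\<Oplus>\<^bsub>N\<^esub>i\<in>J. c i)"
        using h.hom_mult[of "c a" "\<Oplus>\<^bsub>N\<^esub>i\<in>J. c i"] cc s by simp
      also have "\<dots> = (\<Oplus>\<^bsub>N'\<^esub>i\<in>insert a J. h (c i))"
        using N'.M.finsum_insert[of J a "\<lambda>i. h (c i)"] insert hc by auto
      finally show ?case .
    qed
    have "(\<lambda>i. h (c i)) = (\<lambda>_. \<zero>\<^bsub>N'\<^esub>)"
    proof (rule N'.decomp_unique[where I = I and J = "{}"])
      show "(\<Oplus>\<^bsub>N'\<^esub>i\<in>I. h (c i)) = (\<Oplus>\<^bsub>N'\<^esub>i\<in>{}. \<zero>\<^bsub>N'\<^esub>)" 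
        using hfin[OF c(2)] c(4) yc by simp
    qed (use c hg N'.gpart_zero h.hom_one in auto)
    then have h0: "h (c i) = \<zero>\<^bsub>N'\<^esub>" for i by (metis)
    from sur[OF c(1) h0] obtain e where e: "\<And>i. e i \<in> X" "\<And>i. deg (e i) = i" "\<And>i. b (e i) = c i"
      by metis
    have inj: "inj_on e J" for J by (metis e(2) inj_on_def)
    define f where "f x = (if x \<in> e ` I then \<one> else \<zero>)" for x
    have sub: "{x. f x \<noteq> \<zero>} \<subseteq> e ` I" by (auto simp: f_def)
    have fF: "f \<in> carrier (FM X deg)"
      unfolding free_simps using finite_subset[OF sub] c(2) sub e(1) by (auto simp: f_def)
    have "linear_extension R N b f = (\<Oplus>\<^bsub>N\<^esub>x\<in>e ` I. f x \<odot>\<^bsub>N\<^esub> b x)"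
      by (rule superset[OF fF _ sub]) (use c e in auto)
    also have "\<dots> = (\<Oplus>\<^bsub>N\<^esub>x\<in>e ` I. b x)"
      by (rule N.M.finsum_cong') (use bc e cc in \<open>auto simp: f_def\<close>)
    also have "\<dots> = (\<Oplus>\<^bsub>N\<^esub>i\<in>I. b (e i))"
      by (rule N.M.add.finprod_reindex) (use bc e inj in auto)
    also have "\<dots> = y" using c(4) e(3) by simp
    finally show "y \<in> linear_extension R N b ` carrier (FM X deg)" using fF by blast
  qed
qed

end

context graded_base begin

context fixes M :: "('r, 'm) gmodule" assumes M: "graded_module R M" begin

interpretation M: graded_module R M by (rule M)

lemma std_free_graded: "graded_module R (std_free R M k)"
  unfolding std_free_def by (rule free_graded)

lemma eps_ext: "lin_ext R M (std_basis R M 0) gen_deg gen_elt"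
  by unfold_locales auto

lemma bd_ext: "lin_ext R (std_free R M k) (std_basis R M (Suc k)) gen_deg (gen_cycle R)"
proof -
  interpret F: graded_module R "std_free R M k" by (rule std_free_graded)
  show ?thesis
    by unfold_locales (cases k; auto simp: std_free_def Let_def)
qed

lemma syz_ex:
  assumes "y \<in> gpart (FM X deg) i" shows "\<exists>z. combination R z = y"
  using combination_ex[of y] assms unfolding free_simps by auto

theorem std_resolution:
  "std_augmentation R M \<in> linear_maps R (std_free R M 0) M"
  "std_augmentation R M ` gpart (std_free R M 0) i \<subseteq> gpart M i"
  "std_augmentation R M ` carrier (std_free R M 0) = carrier M"
  "std_boundary R M k \<in> linear_maps R (std_free R M (Suc k)) (std_free R M k)"
  "std_boundary R M k ` gpart (std_free R M (Suc k)) i \<subseteq> gpart (std_free R M k) i"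
  "std_boundary R M 0 ` carrier (std_free R M (Suc 0)) =
     {y \<in> carrier (std_free R M 0). std_augmentation R M y = \<zero>\<^bsub>M\<^esub>}"
  "std_boundary R M (Suc k) ` carrier (std_free R M (Suc (Suc k))) =
     {y \<in> carrier (std_free R M (Suc k)). std_boundary R M k y = \<zero>\<^bsub>std_free R M k\<^esub>}"
proof -
  interpret E: lin_ext R M "std_basis R M 0" gen_deg gen_elt by (rule eps_ext)
  interpret B: lin_ext R "std_free R M k" "std_basis R M (Suc k)" gen_deg "gen_cycle R" for k
    by (rule bd_ext)
  show E1: "std_augmentation R M \<in> linear_maps R (std_free R M 0) M"
    unfolding std_augmentation_def std_free_def by (rule E.linear)
  show E2: "std_augmentation R M ` gpart (std_free R M 0) i \<subseteq> gpart M i" for i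
    unfolding std_augmentation_def std_free_def using E.graded by auto
  show B1: "std_boundary R M k \<in> linear_maps R (std_free R M (Suc k)) (std_free R M k)" for k
    using B.linear unfolding std_boundary_def std_free_def by auto
  show B2: "std_boundary R M k ` gpart (std_free R M (Suc k)) i \<subseteq> gpart (std_free R M k) i" for k i
    using B.graded unfolding std_boundary_def std_free_def by auto
  have "linear_extension R M gen_elt ` carrier (FM (std_basis R M 0) gen_deg) =
      {y \<in> carrier M. (\<lambda>y. \<zero>\<^bsub>M\<^esub>) y = \<zero>\<^bsub>M\<^esub>}"
  proof (rule E.image[OF M])
    show "(\<lambda>y. \<zero>\<^bsub>M\<^esub>) \<in> linear_maps R M M" by (auto simp: linear_maps_def hom_def)
    show "\<exists>x\<in>std_basis R M 0. gen_deg x = i \<and> gen_elt x = y" if "y \<in> gpart M i" for i y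
      using that by (intro bexI[of _ "Elt i y"]) auto
  qed (auto intro: M.gpart_zero)
  then show "std_augmentation R M ` carrier (std_free R M 0) = carrier M"
    by (simp add: std_augmentation_def std_free_def)
  show "std_boundary R M 0 ` carrier (std_free R M (Suc 0)) =
     {y \<in> carrier (std_free R M 0). std_augmentation R M y = \<zero>\<^bsub>M\<^esub>}"
    unfolding std_boundary_def std_free_def[of R M "Suc 0"]
  proof (rule B.image[OF M E1])
    fix i y assume y: "y \<in> gpart (std_free R M 0) i" "std_augmentation R M y = \<zero>\<^bsub>M\<^esub>"
    obtain z where z: "combination R z = y" using syz_ex y(1) unfolding std_free_def by blast
    show "\<exists>x\<in>std_basis R M (Suc 0). gen_deg x = i \<and> gen_cycle R x = y"
      using y z by (intro bexI[of _ "Syz i z"]) (auto simp: std_free_def)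
  qed (use E2 in auto)
  show "std_boundary R M (Suc k) ` carrier (std_free R M (Suc (Suc k))) =
     {y \<in> carrier (std_free R M (Suc k)). std_boundary R M k y = \<zero>\<^bsub>std_free R M k\<^esub>}"
    unfolding std_boundary_def[of R M "Suc k"] std_free_def[of R M "Suc (Suc k)"]
  proof (rule B.image[OF std_free_graded B1])
    fix i y assume y: "y \<in> gpart (std_free R M (Suc k)) i" "std_boundary R M k y = \<zero>\<^bsub>std_free R M k\<^esub>"
    obtain z where z: "combination R z = y" using syz_ex y(1) unfolding std_free_def by blast
    show "\<exists>x\<in>std_basis R M (Suc (Suc k)). gen_deg x = i \<and> gen_cycle R x = y"
      using y z by (intro bexI[of _ "Syz i z"]) (auto simp: std_free_def std_boundary_def Let_def)
  qed (use B2 in \<open>auto simp: std_boundary_def std_free_def Let_def\<close>)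
qed

end
end

end

theory Submission
  imports Defs "HOL-Library.Function_Algebras" "HOL-Library.Product_Plus"
begin

text \<open>Write \<open>x\<^sub>0\<close> for the prime \<open>p\<close>. Since every \<open>M\<^sub>i\<close> generates a finite submodule, each of
  \<open>x\<^sub>0, \<dots>, x\<^sub>n\<close> acts nilpotently on every homogeneous element of \<open>M\<close>. Hence \<open>Ext(M, Q)\<close> vanishes in all
  degrees when one of the \<open>x\<^sub>j\<close> acts invertibly on \<open>Q\<close>: the standard resolution \<open>F\<close> of \<open>M\<close> becomes
  contractible once \<open>x\<^sub>j\<close> is inverted (\<open>cocycle_0_eq_0\<close>, \<open>cocycle_Suc_is_coboundary\<close>). No finiteness
  of \<open>M\<close> as a whole, and no passage to the limit over finite submodules, is needed for this.

  Put \<open>Q\<^sub>0 = R\<close> and \<open>Q\<^sub>j\<^sub>+\<^sub>1 = Q\<^sub>j[1/x\<^sub>j] / Q\<^sub>j\<close>. The long exact sequences of the extensions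
  \<open>0 \<rightarrow> Q\<^sub>j \<rightarrow> Q\<^sub>j[1/x\<^sub>j] \<rightarrow> Q\<^sub>j\<^sub>+\<^sub>1 \<rightarrow> 0\<close> then give isomorphisms from \<open>Ext(M, Q\<^sub>j\<^sub>+\<^sub>1)\<close> in degree \<open>s\<close> to
  \<open>Ext(M, Q\<^sub>j)\<close> in degree \<open>s + 1\<close>, and \<open>Hom(M, Q\<^sub>j) = 0\<close> for \<open>j \<le> n\<close> (\<open>conn_cob\<close>,
  \<open>shift_cob\<close>, \<open>coc_sub_cob\<close>). The last module \<open>Q\<^sub>n\<^sub>+\<^sub>1\<close> is the span of the monomials with all exponents
  negative, with coefficients in \<open>\<rat>\<close> modulo the localized integers. It is, up to a shift, the graded
  dual of \<open>R\<close>: a homomorphism from a graded module \<open>N\<close> to \<open>Q\<^sub>n\<^sub>+\<^sub>1\<close> that lowers degrees by \<open>t\<close> is the same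
  as a homomorphism of groups from \<open>N\<close> in degree \<open>t - D\<close> to \<open>\<rat>\<close> modulo the localized integers, obtained
  by taking the coefficient of the monomial with exponents \<open>(-1, \<dots>, -1)\<close>, which has degree \<open>-D\<close>
  (\<open>represent\<close>). As this group is divisible, \<open>Q\<^sub>n\<^sub>+\<^sub>1\<close> is injective (\<open>top_vanishing\<close>), and
  \<open>Hom(M, Q\<^sub>n\<^sub>+\<^sub>1)\<close> is the dual of \<open>M\<close> shifted by \<open>D\<close>, the parts of \<open>M\<close> being \<open>p\<close>-power torsion
  (\<open>induces_total\<close>, \<open>induces_surj\<close>, \<open>induces_one_iff\<close>).

  All the \<open>Q\<^sub>j\<close> and \<open>Q\<^sub>j[1/x\<^sub>j]\<close> are quotients of subgroups of the ring of Laurent polynomials with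
  rational coefficients. The stages of \<open>F\<close> being free, a cochain with values in such a quotient lifts to
  a function from the basis to Laurent polynomials. So quotient modules are not formed: cocycles are
  functions that satisfy the cocycle condition modulo a subgroup, and the connecting isomorphisms are
  relations between such functions that are additive and compatible with scalars.\<close>


abbreviation lookup where "lookup \<equiv> Poly_Mapping.lookup"
abbreviation single where "single \<equiv> Poly_Mapping.single"
abbreviation keys where "keys \<equiv> Poly_Mapping.keys"


section \<open>Arithmetic of the integers localized at a prime\<close>

lemma localized_intsI: "\<not> int p dvd b \<Longrightarrow> of_int a / of_int b \<in> localized_ints p"
  unfolding localized_ints_def by blast

lemma localized_intsE:
  assumes "q \<in> localized_ints p"
  obtains a b where "q = of_int a / of_int b" "\<not> int p dvd b" "b \<noteq> 0"
  using assms unfolding localized_ints_def by auto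

context
  fixes p :: nat
  assumes p: "Factorial_Ring.prime p"
begin

lemma localized_ints_of_int: "of_int a \<in> localized_ints p"
proof -
  have "\<not> int p dvd 1" using p by (auto simp: prime_nat_iff)
  from localized_intsI[OF this, of a] show ?thesis by simp
qed

lemma localized_ints_0: "0 \<in> localized_ints p" using localized_ints_of_int[of 0] by simp
lemma localized_ints_1: "1 \<in> localized_ints p" using localized_ints_of_int[of 1] by simp

lemma localized_ints_add:
  assumes "q \<in> localized_ints p" "r \<in> localized_ints p" shows "q + r \<in> localized_ints p"
proof -
  obtain a b where q: "q = of_int a / of_int b" "\<not> int p dvd b" "b \<noteq> 0" by (rule localized_intsE[OF assms(1)])
  obtain c d where r: "r = of_int c / of_int d" "\<not> int p dvd d" "d \<noteq> 0" by (rule localized_intsE[OF assms(2)])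
  have "q + r = of_int (a * d + c * b) / of_int (b * d)" using q r by (simp add: field_simps)
  moreover have "\<not> int p dvd b * d" using q r p by (simp add: prime_dvd_mult_iff)
  ultimately show ?thesis by (metis localized_intsI)
qed

lemma localized_ints_mult:
  assumes "q \<in> localized_ints p" "r \<in> localized_ints p" shows "q * r \<in> localized_ints p"
proof -
  obtain a b where q: "q = of_int a / of_int b" "\<not> int p dvd b" "b \<noteq> 0" by (rule localized_intsE[OF assms(1)])
  obtain c d where r: "r = of_int c / of_int d" "\<not> int p dvd d" "d \<noteq> 0" by (rule localized_intsE[OF assms(2)])
  have "q * r = of_int (a * c) / of_int (b * d)" using q r by (simp add: field_simps)
  moreover have "\<not> int p dvd b * d" using q r p by (simp add: prime_dvd_mult_iff)
  ultimately show ?thesis by (metis localized_intsI)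
qed

lemma localized_ints_minus: "q \<in> localized_ints p \<Longrightarrow> - q \<in> localized_ints p"
  using localized_ints_mult[OF localized_ints_of_int[of "-1"], of q] by simp

lemma localized_ints_diff:
  "q \<in> localized_ints p \<Longrightarrow> r \<in> localized_ints p \<Longrightarrow> q - r \<in> localized_ints p"
  using localized_ints_add[of q "- r"] localized_ints_minus by simp

lemma localized_ints_diff_commute: "q - r \<in> localized_ints p \<Longrightarrow> r - q \<in> localized_ints p"
  using localized_ints_minus[of "q - r"] by simp

lemma localized_ints_inverse:
  assumes "\<not> int p dvd b" shows "1 / of_int b \<in> localized_ints p"
  using localized_intsI[OF assms, of 1] by simp

text \<open>The intersection of the localized integers with the fractions that have denominator a power of \<open>p\<close>
  is \<open>\<int>\<close>.\<close>

lemma localized_ints_integral: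
  assumes "q \<in> localized_ints p" "of_nat p ^ k * q \<in> \<int>" shows "q \<in> \<int>"
proof -
  obtain a b where q: "q = of_int a / of_int b" "\<not> int p dvd b" "b \<noteq> 0" by (rule localized_intsE[OF assms(1)])
  obtain c where "of_nat p ^ k * q = of_int c" using assms(2) by (auto elim: Ints_cases)
  then have "(of_nat p ^ k * of_int a :: rat) = of_int c * of_int b" using q by (simp add: field_simps)
  then have "(of_int (int p ^ k * a) :: rat) = of_int (c * b)" by simp
  then have "int p ^ k * a = c * b" unfolding of_int_eq_iff .
  then have "b dvd int p ^ k * a" by simp
  moreover have "coprime b (int p ^ k)"
    using prime_imp_coprime[of "int p" b] q(2) p by (simp add: coprime_commute)
  ultimately have "b dvd a" by (simp add: coprime_dvd_mult_right_iff)
  then obtain e where "a = b * e" ..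
  then show ?thesis using q by simp
qed

text \<open>The \<open>p\<close>-power torsion of \<open>\<rat>/\<int>\<close> maps onto that of \<open>\<rat>\<close> modulo the localized integers.\<close>

lemma localized_ints_lift:
  assumes "of_nat p ^ k * q \<in> localized_ints p"
  shows "\<exists>q'. of_nat p ^ k * q' \<in> \<int> \<and> q - q' \<in> localized_ints p"
proof -
  obtain a b where q: "of_nat p ^ k * q = of_int a / of_int b" "\<not> int p dvd b" "b \<noteq> 0"
    by (rule localized_intsE[OF assms(1)])
  have "coprime b (int p ^ k)"
    using prime_imp_coprime[of "int p" b] q(2) p by (simp add: coprime_commute)
  then obtain u v where uv: "b * u + int p ^ k * v = 1"
    using bezout_int[of b "int p ^ k"] by (auto simp: mult.commute)
  have pk: "(of_nat p ^ k :: rat) \<noteq> 0" using p by (simp add: prime_gt_0_nat)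
  have "(of_int (b * u + int p ^ k * v) :: rat) = 1" using uv by simp
  then have uv': "of_int b * of_int u + of_nat p ^ k * of_int v = (1::rat)" by simp
  have b0: "(of_int b :: rat) \<noteq> 0" using q by simp
  let ?q' = "of_int (a * u) / of_nat p ^ k :: rat"
  have qe: "q = of_int a / of_int b / of_nat p ^ k" using q(1) pk by (metis nonzero_mult_div_cancel_left)
  have "q - ?q' = of_int a * (1 - of_int b * of_int u) / (of_int b * of_nat p ^ k)"
    unfolding qe using pk b0 by (simp add: field_simps)
  also have "1 - of_int b * of_int u = (of_nat p ^ k * of_int v :: rat)" using uv' by simp
  also have "of_int a * (of_nat p ^ k * of_int v) / (of_int b * of_nat p ^ k) = (of_int (a * v) / of_int b :: rat)"
    using pk b0 by (simp add: nonzero_divide_eq_eq nonzero_eq_divide_eq ac_simps del: power_eq_0_iff of_nat_eq_0_iff)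
  finally have "q - ?q' \<in> localized_ints p" using localized_intsI[OF q(2), of "a * v"] by simp
  moreover have "of_nat p ^ k * ?q' \<in> \<int>" using pk by (simp del: of_int_mult)
  ultimately show ?thesis by blast
qed

end


section \<open>Extension of homomorphisms into a quotient of the rationals\<close>

text \<open>A homomorphism from a subgroup of \<open>G\<close> to \<open>\<rat>/Z\<close> is represented by its graph, a
  subgroup of \<open>G \<times> \<rat>\<close> in which only elements of \<open>Z\<close> lie over \<open>0\<close>. Since \<open>\<rat>/Z\<close> is divisible,
  it extends to all of \<open>G\<close>. The group \<open>G\<close> is the additive group of a ring only so that integer
  multiples can be written as products.\<close>

lemma divisible_extension:
  fixes K0 :: "('g::ring_1 \<times> rat) set" and Z :: "rat set"
  assumes K0: "(0, 0) \<in> K0" "\<And>a b. a \<in> K0 \<Longrightarrow> b \<in> K0 \<Longrightarrow> a - b \<in> K0"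
      "\<And>q. (0, q) \<in> K0 \<Longrightarrow> q \<in> Z"
  obtains K where "K0 \<subseteq> K" "\<And>a b. a \<in> K \<Longrightarrow> b \<in> K \<Longrightarrow> a - b \<in> K"
      "\<And>q. (0, q) \<in> K \<Longrightarrow> q \<in> Z" "\<And>g. \<exists>q. (g, q) \<in> K"
proof -
  define \<A> where "\<A> = {K. K0 \<subseteq> K \<and> (\<forall>a\<in>K. \<forall>b\<in>K. a - b \<in> K) \<and> (\<forall>q. (0, q) \<in> K \<longrightarrow> q \<in> Z)}"
  have "\<exists>K\<in>\<A>. \<forall>X\<in>\<A>. K \<subseteq> X \<longrightarrow> X = K"
  proof (rule subset_Zorn_nonempty)
    show "\<A> \<noteq> {}" using K0 unfolding \<A>_def by blast
    fix C assume C: "C \<noteq> {}" "subset.chain \<A> C"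
    have CA: "X \<in> \<A>" if "X \<in> C" for X using C(2) that unfolding subset_chain_def by blast
    show "\<Union>C \<in> \<A>"
      unfolding \<A>_def
    proof (intro CollectI conjI ballI allI impI)
      show "K0 \<subseteq> \<Union>C" using C(1) CA unfolding \<A>_def by blast
      show "q \<in> Z" if "(0, q) \<in> \<Union>C" for q
        using that CA unfolding \<A>_def by blast
      fix a b assume "a \<in> \<Union>C" "b \<in> \<Union>C"
      then obtain X where "X \<in> C" "a \<in> X" "b \<in> X"
        using C(2) unfolding subset_chain_def by blast
      then show "a - b \<in> \<Union>C" using CA unfolding \<A>_def by blast
    qed
  qed
  then obtain K where K: "K \<in> \<A>" and max: "\<And>X. X \<in> \<A> \<Longrightarrow> K \<subseteq> X \<Longrightarrow> X = K" by blast
  have sub: "K0 \<subseteq> K" and diff: "\<And>a b. a \<in> K \<Longrightarrow> b \<in> K \<Longrightarrow> a - b \<in> K"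
    and ker: "\<And>q. (0, q) \<in> K \<Longrightarrow> q \<in> Z" using K unfolding \<A>_def by blast+
  have zero: "(0, 0) \<in> K" using sub K0(1) by blast
  have neg: "- a \<in> K" if "a \<in> K" for a using diff[OF zero that] by (simp add: zero_prod_def[symmetric])
  have add: "a + b \<in> K" if "a \<in> K" "b \<in> K" for a b using diff[OF that(1) neg[OF that(2)]] by simp
  have natmul: "(of_nat k * x, of_nat k * q) \<in> K" if "(x, q) \<in> K" for k x q
  proof (induction k)
    case (Suc k) then show ?case using add[OF that Suc] by (simp add: algebra_simps)
  qed (use zero in simp)
  have intmul: "(of_int k * x, of_int k * q) \<in> K" if "(x, q) \<in> K" for k x q
  proof (cases k rule: int_cases2)
    case (nonpos m) then show ?thesis using neg[OF natmul[OF that, of m]] by simp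
  qed (use natmul[OF that] in simp)
  have "\<exists>q. (g, q) \<in> K" for g
  proof -
    \<comment> \<open>the integers \<open>k\<close> with \<open>k g\<close> in the domain form an ideal, generated by some \<open>m\<close>\<close>
    define I where "I = {k::nat. 0 < k \<and> (\<exists>q. (of_nat k * g, q) \<in> K)}"
    obtain m q0 where m: "(of_int m * g, of_int m * q0) \<in> K"
      and gen: "\<And>k q. (of_int k * g, q) \<in> K \<Longrightarrow> m dvd k"
    proof (cases "I = {}")
      case True
      have k0: "k = 0" if "(of_int k * g, q) \<in> K" for k q
      proof (cases k rule: int_cases3)
        case (pos m) with that True show ?thesis unfolding I_def by (auto dest!: spec[of _ m])
      next
        case (neg m)
        then have "(of_nat m * g, - q) \<in> K" using \<open>\<And>a. a \<in> K \<Longrightarrow> - a \<in> K\<close>[OF that] by simp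
        with True neg show ?thesis unfolding I_def by (auto dest!: spec[of _ m])
      qed simp
      show ?thesis by (rule that[of 0 0]) (use zero k0 in auto)
    next
      case False
      define m where "m = (LEAST k. k \<in> I)"
      have mI: "m \<in> I" using False unfolding m_def by (metis LeastI ex_in_conv)
      then obtain q where m0: "0 < m" and q: "(of_nat m * g, q) \<in> K" unfolding I_def by auto
      have mdvd: "int m dvd k" if "(of_int k * g, r) \<in> K" for k r
      proof -
        have "(of_int (k div int m) * (of_nat m * g), of_int (k div int m) * q) \<in> K" by (rule intmul[OF q])
        from diff[OF that this]
        have "((of_int k - of_int (k div int m) * of_nat m) * g, r - of_int (k div int m) * q) \<in> K"
          by (simp add: algebra_simps)
        moreover have "(of_int k - of_int (k div int m) * of_nat m :: 'g) = of_int (k - k div int m * int m)"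
          by simp
        moreover have "k - k div int m * int m = k mod int m" by (simp add: minus_div_mult_eq_mod)
        ultimately have "(of_nat (nat (k mod int m)) * g, r - of_int (k div int m) * q) \<in> K"
          using m0 by (simp add: of_nat_nat)
        moreover have "nat (k mod int m) < m" using m0 by (simp add: nat_less_iff)
        moreover from this have "nat (k mod int m) \<notin> I" unfolding m_def by (rule not_less_Least)
        ultimately have "\<not> 0 < nat (k mod int m)"
          unfolding I_def mem_Collect_eq by metis
        moreover have "0 \<le> k mod int m" using m0 by simp
        ultimately show ?thesis by (simp add: dvd_eq_mod_eq_0)
      qed
      show ?thesis
      proof (rule that)
        show "(of_int (int m) * g, of_int (int m) * (q / of_nat m)) \<in> K" using q m0 by simp
      qed (rule mdvd)
    qed
    define K' where "K' = {(x + of_int k * g, q + of_int k * q0) |x q k. (x, q) \<in> K}"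
    have KK': "K \<subseteq> K'"
    proof
      fix a assume "a \<in> K"
      then have "\<exists>x q k. a = (x + of_int k * g, q + of_int k * q0) \<and> (x, q) \<in> K"
        by (intro exI[of _ "fst a"] exI[of _ "snd a"] exI[of _ 0]) simp
      then show "a \<in> K'" unfolding K'_def by blast
    qed
    have "K' \<in> \<A>" unfolding \<A>_def
    proof (intro CollectI conjI ballI allI impI)
      show "K0 \<subseteq> K'" using sub KK' by blast
      fix q assume "(0, q) \<in> K'"
      then obtain x r k where r: "x + of_int k * g = 0" "q = r + of_int k * q0" "(x, r) \<in> K"
        unfolding K'_def by auto
      have "- x = of_int k * g" using r(1) by (simp add: minus_unique)
      then have "(of_int k * g, - r) \<in> K" using neg[OF r(3)] by simp
      then have "m dvd k" by (rule gen)
      then obtain l where l: "k = l * m" by (metis dvd_div_mult_self)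
      have "(of_int l * (of_int m * g), of_int l * (of_int m * q0)) \<in> K" by (rule intmul[OF m])
      then have "(of_int k * g, of_int k * q0) \<in> K" unfolding l by (simp only: of_int_mult mult.assoc)
      from add[OF r(3) this] show "q \<in> Z" using ker r by auto
    next
      fix a b assume "a \<in> K'" "b \<in> K'"
      then obtain x q k y r l where *: "a = (x + of_int k * g, q + of_int k * q0)" "(x, q) \<in> K"
         "b = (y + of_int l * g, r + of_int l * q0)" "(y, r) \<in> K" unfolding K'_def by blast
      have "a - b = ((x - y) + of_int (k - l) * g, (q - r) + of_int (k - l) * q0)"
        unfolding * by (simp add: algebra_simps)
      moreover have "(x - y, q - r) \<in> K" using diff[OF *(2) *(4)] by simp
      ultimately show "a - b \<in> K'" unfolding K'_def by blast
    qed
    from max[OF this KK'] have "K' = K" .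
    moreover have "(0 + of_int 1 * g, 0 + of_int 1 * q0) \<in> K'" unfolding K'_def using zero by blast
    ultimately show ?thesis by auto
  qed
  then show ?thesis using that[OF sub diff ker] by blast
qed


section \<open>Laurent polynomials\<close>

type_synonym laurent = "(nat \<Rightarrow> int) \<Rightarrow>\<^sub>0 rat"

lemma poly_mapping_sum_singles:
  assumes "finite S" "keys f \<subseteq> S"
  shows "f = (\<Sum>m\<in>S. single m (lookup f m))"
proof (rule poly_mapping_eqI)
  fix k
  have "lookup (\<Sum>m\<in>S. single m (lookup f m)) k
     = (\<Sum>m\<in>S. if m = k then lookup f m else 0)"
    by (simp add: lookup_sum lookup_single when_def)
  also have "\<dots> = lookup f k"
    using assms by (auto simp: sum.delta' in_keys_iff)
  finally show "lookup f k = lookup (\<Sum>m\<in>S. single m (lookup f m)) k"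
    by simp
qed

lemma poly_mapping_induct_add:
  assumes "P 0" "\<And>f g. P f \<Longrightarrow> P g \<Longrightarrow> P (f + g)"
    and "\<And>m. m \<in> keys f \<Longrightarrow> P (single m (lookup f m))"
  shows "P (f :: 'a \<Rightarrow>\<^sub>0 'b::comm_monoid_add)"
proof -
  have "P (\<Sum>m\<in>S. single m (lookup f m))" if "finite S" "S \<subseteq> keys f" for S
    using that by (induction S rule: finite_induct) (use assms in auto)
  from this[of "keys f"] show ?thesis
    using poly_mapping_sum_singles[of "keys f" f] by simp
qed

lemma lookup_single_mult:
  "lookup (single \<kappa> r * a) \<mu> = r * lookup a (\<mu> - \<kappa>)"
  for a :: "'k::ab_group_add \<Rightarrow>\<^sub>0 'b::comm_semiring_1"
proof (induction a rule: poly_mapping_induct_add)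
  case (3 m)
  have "\<kappa> + m = \<mu> \<longleftrightarrow> m = \<mu> - \<kappa>" by (auto simp: algebra_simps)
  then show ?case by (simp add: mult_single lookup_single when_def)
qed (simp_all add: lookup_add distrib_left)

text \<open>An exponent of a polynomial, regarded as one of a Laurent polynomial. The exponents of Laurent
  polynomials are arbitrary functions, so that exponents can be subtracted.\<close>

definition int_exponent :: "(nat \<Rightarrow>\<^sub>0 nat) \<Rightarrow> nat \<Rightarrow> int"
  where "int_exponent m = (\<lambda>i. int (lookup m i))"

lemma int_exponent_add: "int_exponent (m + k) = int_exponent m + int_exponent k"
  by (simp add: int_exponent_def lookup_add fun_eq_iff)

lemma int_exponent_0: "int_exponent 0 = 0" by (simp add: int_exponent_def fun_eq_iff)

lemma int_exponent_inject: "int_exponent m = int_exponent k \<longleftrightarrow> m = k"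
  by (auto simp: int_exponent_def fun_eq_iff intro: poly_mapping_eqI)

lemma int_exponent_surj:
  assumes "\<And>i. 0 \<le> \<mu> i" "finite {i. \<mu> i \<noteq> 0}"
  obtains m where "int_exponent m = \<mu>" "keys m = {i. \<mu> i \<noteq> 0}"
proof -
  have fin: "finite {i. nat (\<mu> i) \<noteq> 0}" by (rule finite_subset[OF _ assms(2)]) auto
  define m where "m = Abs_poly_mapping (\<lambda>i. nat (\<mu> i))"
  have l: "lookup m i = nat (\<mu> i)" for i unfolding m_def using fin by simp
  have "nat (\<mu> i) \<noteq> 0 \<longleftrightarrow> \<mu> i \<noteq> 0" for i using assms(1)[of i] by linarith
  then have "keys m = {i. \<mu> i \<noteq> 0}" unfolding set_eq_iff in_keys_iff l by simp
  then show ?thesis using assms(1) by (intro that[of m]) (auto simp: int_exponent_def l fun_eq_iff)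
qed

text \<open>The inclusion of polynomials into Laurent polynomials.\<close>

definition emb :: "rat_mpoly \<Rightarrow> laurent"
  where "emb f = (\<Sum>m\<in>keys f. single (int_exponent m) (lookup f m))"

lemma emb_superset:
  assumes "finite S" "keys f \<subseteq> S"
  shows "emb f = (\<Sum>m\<in>S. single (int_exponent m) (lookup f m))"
  unfolding emb_def using assms by (intro sum.mono_neutral_left) (auto simp: in_keys_iff)

lemma emb_0 [simp]: "emb 0 = 0" by (simp add: emb_def)

lemma emb_single: "emb (single m q) = single (int_exponent m) q"
  using emb_superset[of "{m}" "single m q"] by simp

lemma emb_add: "emb (f + g) = emb f + emb g"
proof -
  let ?S = "keys f \<union> keys g"
  have "emb (f + g) = (\<Sum>m\<in>?S. single (int_exponent m) (lookup (f + g) m))"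
    using keys_add[of f g] by (intro emb_superset) auto
  also have "\<dots> = emb f + emb g"
    by (simp add: emb_superset[of ?S f] emb_superset[of ?S g] lookup_add single_add sum.distrib)
  finally show ?thesis .
qed

lemma emb_sum: "emb (sum f A) = (\<Sum>x\<in>A. emb (f x))"
  by (induction A rule: infinite_finite_induct) (auto simp: emb_add)

lemma emb_uminus: "emb (- f) = - emb f"
  using emb_add[of f "- f"] by (simp add: eq_neg_iff_add_eq_0 add.commute)

lemma emb_diff: "emb (f - g) = emb f - emb g"
  using emb_add[of f "- g"] by (simp add: emb_uminus)

lemma emb_mult: "emb (f * g) = emb f * emb g"
proof (induction f rule: poly_mapping_induct_add)
  case (3 m)
  show ?case
  proof (induction g rule: poly_mapping_induct_add)
    case (3 k) then show ?case by (simp add: mult_single emb_single int_exponent_add)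
  qed (auto simp: distrib_left emb_add)
qed (auto simp: distrib_right emb_add)

lemma emb_1 [simp]: "emb 1 = 1"
  using emb_single[of 0 1] by (simp add: int_exponent_0)

lemma emb_power: "emb (f ^ k) = emb f ^ k" by (induction k) (auto simp: emb_mult)

lemma lookup_emb: "lookup (emb f) (int_exponent m) = lookup f m"
  by (induction f rule: poly_mapping_induct_add)
    (auto simp: emb_add lookup_add emb_single lookup_single int_exponent_inject)

lemma keys_emb: "keys (emb f) = int_exponent ` keys f"
proof
  have "keys (emb f) \<subseteq> (\<Union>m\<in>keys f.
     keys (single (int_exponent m) (lookup f m)))"
    unfolding emb_def by (rule keys_sum)
  then show "keys (emb f) \<subseteq> int_exponent ` keys f" by (auto split: if_splits)
qed (auto simp: in_keys_iff lookup_emb)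

lemma emb_inject: "emb f = emb g \<longleftrightarrow> f = g"
  by (metis lookup_emb poly_mapping_eqI)

lemma emb_eq_0: "emb f = 0 \<longleftrightarrow> f = 0"
  using emb_inject[of f 0] by simp


section \<open>Subgroups of Laurent polynomials given by conditions on the coefficients\<close>

text \<open>The Laurent polynomials whose coefficient at each exponent \<open>\<mu>\<close> lies in \<open>S \<mu>\<close>.\<close>

definition laurent_in :: "((nat \<Rightarrow> int) \<Rightarrow> rat set) \<Rightarrow> laurent set"
  where "laurent_in S = {a. \<forall>\<mu>. lookup a \<mu> \<in> S \<mu>}"

text \<open>All the sets \<open>S \<mu>\<close> are subgroups of \<open>\<rat>\<close>.\<close>

definition coeff_subgroups :: "((nat \<Rightarrow> int) \<Rightarrow> rat set) \<Rightarrow> bool"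
  where "coeff_subgroups S \<longleftrightarrow> (\<forall>\<mu>. 0 \<in> S \<mu> \<and> (\<forall>q\<in>S \<mu>. \<forall>r\<in>S \<mu>. q - r \<in> S \<mu>))"

lemma coeff_subgroups_Int:
  "coeff_subgroups S \<Longrightarrow> coeff_subgroups T \<Longrightarrow> coeff_subgroups (\<lambda>\<mu>. S \<mu> \<inter> T \<mu>)"
  unfolding coeff_subgroups_def by blast

lemma laurent_in_Int: "laurent_in (\<lambda>\<mu>. S \<mu> \<inter> T \<mu>) = laurent_in S \<inter> laurent_in T"
  unfolding laurent_in_def by blast

context
  fixes S :: "(nat \<Rightarrow> int) \<Rightarrow> rat set"
  assumes S: "coeff_subgroups S"
begin

lemma laurent_in_0: "0 \<in> laurent_in S"
  using S by (simp add: laurent_in_def coeff_subgroups_def)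

lemma laurent_in_diff: "a \<in> laurent_in S \<Longrightarrow> b \<in> laurent_in S \<Longrightarrow> a - b \<in> laurent_in S"
  using S by (simp add: laurent_in_def coeff_subgroups_def lookup_minus)

lemma laurent_in_uminus: "a \<in> laurent_in S \<Longrightarrow> - a \<in> laurent_in S"
  using laurent_in_diff[OF laurent_in_0] by simp

lemma laurent_in_add: "a \<in> laurent_in S \<Longrightarrow> b \<in> laurent_in S \<Longrightarrow> a + b \<in> laurent_in S"
  using laurent_in_diff[of a "- b"] laurent_in_uminus by simp

lemma laurent_in_sum: "(\<And>x. x \<in> A \<Longrightarrow> f x \<in> laurent_in S) \<Longrightarrow> sum f A \<in> laurent_in S"
  by (induction A rule: infinite_finite_induct) (auto simp: laurent_in_0 laurent_in_add)

lemma laurent_in_single: "q \<in> S \<mu> \<Longrightarrow> single \<mu> q \<in> laurent_in S"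
  using S by (simp add: laurent_in_def coeff_subgroups_def lookup_single when_def)

end

lemma laurent_in_single_mult:
  assumes "a \<in> laurent_in S" "\<And>\<mu> q. q \<in> S \<mu> \<Longrightarrow> r * q \<in> T (\<kappa> + \<mu>)"
  shows "single \<kappa> r * a \<in> laurent_in T"
proof -
  have "r * lookup a (\<mu> - \<kappa>) \<in> T (\<kappa> + (\<mu> - \<kappa>))" for \<mu>
    using assms unfolding laurent_in_def by blast
  then show ?thesis unfolding laurent_in_def by (simp add: lookup_single_mult)
qed


section \<open>The graded polynomial ring\<close>

locale weighted_poly_ring =
  fixes p n :: nat and w :: "nat \<Rightarrow> nat"
  assumes p: "Factorial_Ring.prime p" and w: "\<And>i. i \<in> {1..n} \<Longrightarrow> 0 < w i"
begin

abbreviation "R \<equiv> graded_poly_ring p n w"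
abbreviation "Zp \<equiv> localized_ints p"

lemmas Zp_simps = localized_ints_0[OF p] localized_ints_1[OF p] localized_ints_of_int[OF p]
lemmas Zp_intros = localized_ints_add[OF p] localized_ints_mult[OF p] localized_ints_minus[OF p]
  localized_ints_diff[OF p]

text \<open>The degree of the monomial with exponent \<open>\<mu>\<close>.\<close>

definition deg :: "(nat \<Rightarrow> int) \<Rightarrow> int"
  where "deg \<mu> = (\<Sum>i\<in>{1..n}. int (w i) * \<mu> i)"

lemma deg_add: "deg (\<mu> + \<nu>) = deg \<mu> + deg \<nu>"
  by (simp add: deg_def distrib_left sum.distrib)

lemma deg_diff: "deg (\<mu> - \<nu>) = deg \<mu> - deg \<nu>"
  by (simp add: deg_def right_diff_distrib sum_subtractf)

lemma deg_int_exponent: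
  assumes "keys m \<subseteq> {1..n}" shows "deg (int_exponent m) = int (weight w m)"
proof -
  have "int (weight w m) = (\<Sum>i\<in>keys m. int (w i) * int_exponent m i)"
    by (simp add: weight_def int_exponent_def)
  also have "\<dots> = deg (int_exponent m)"
    unfolding deg_def by (intro sum.mono_neutral_left) (use assms in \<open>auto simp: in_keys_iff int_exponent_def\<close>)
  finally show ?thesis by simp
qed

text \<open>The Laurent polynomials that are homogeneous of degree \<open>d\<close>.\<close>

definition homog :: "int \<Rightarrow> laurent set"
  where "homog d = laurent_in (\<lambda>\<mu>. if deg \<mu> = d then UNIV else {0})"

lemma homog_coeffs: "coeff_subgroups (\<lambda>\<mu>. if deg \<mu> = d then UNIV else {0})"
  by (simp add: coeff_subgroups_def)

lemmas homog_0 = laurent_in_0[OF homog_coeffs, folded homog_def]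
  and homog_add = laurent_in_add[OF homog_coeffs, folded homog_def]
  and homog_diff = laurent_in_diff[OF homog_coeffs, folded homog_def]
  and homog_sum = laurent_in_sum[OF homog_coeffs, folded homog_def]

lemma homog_iff: "a \<in> homog d \<longleftrightarrow> (\<forall>\<mu>\<in>keys a. deg \<mu> = d)"
  unfolding homog_def laurent_in_def by (force simp: in_keys_iff split: if_splits)

lemma homog_mult: "a \<in> homog d \<Longrightarrow> b \<in> homog e \<Longrightarrow> a * b \<in> homog (d + e)"
  unfolding homog_iff using keys_mult[of a b] by (fastforce simp: deg_add)

lemma homog_single: "single \<mu> q \<in> homog (deg \<mu>)"
  by (simp add: homog_iff)

text \<open>The prime \<open>p\<close> plays the role of a variable with index \<open>0\<close>. The term \<open>q x\<^sup>\<mu>\<close> is integral in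
  direction \<open>i\<close> if the \<open>i\<close>-th variable does not occur in its denominator.\<close>

definition integral_at :: "nat \<Rightarrow> (nat \<Rightarrow> int) \<Rightarrow> rat \<Rightarrow> bool"
  where "integral_at i \<mu> q \<longleftrightarrow> (if i = 0 then q \<in> Zp else 0 \<le> \<mu> i)"

text \<open>\<open>laurent_in (A j)\<close> is the polynomial ring with the variables of index less than \<open>j\<close> inverted,
  and \<open>laurent_in (N k)\<close> consists of the Laurent polynomials each of whose terms is integral in
  some direction less than \<open>k\<close>. The module \<open>Q\<^sub>j\<close> is the quotient of \<open>laurent_in (A j)\<close> by its
  intersection with \<open>laurent_in (N j)\<close>, and \<open>Q\<^sub>j[1/x\<^sub>j]\<close> is the quotient of \<open>laurent_in (A (Suc j))\<close> by
  its intersection with \<open>laurent_in (N j)\<close>.\<close>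

definition A :: "nat \<Rightarrow> (nat \<Rightarrow> int) \<Rightarrow> rat set"
  where "A j \<mu> = {q. q = 0 \<or> (\<forall>i. i \<notin> {1..n} \<longrightarrow> \<mu> i = 0) \<and> (\<forall>i\<in>{j..n}. integral_at i \<mu> q)}"

definition N :: "nat \<Rightarrow> (nat \<Rightarrow> int) \<Rightarrow> rat set"
  where "N k \<mu> = {q. q = 0 \<or> (\<exists>i<k. integral_at i \<mu> q)}"

lemma A_outside: "q \<in> A j \<mu> \<Longrightarrow> q \<noteq> 0 \<Longrightarrow> i \<notin> {1..n} \<Longrightarrow> \<mu> i = 0"
  unfolding A_def mem_Collect_eq by blast

lemma A_integral: "q \<in> A j \<mu> \<Longrightarrow> q \<noteq> 0 \<Longrightarrow> i \<in> {j..n} \<Longrightarrow> integral_at i \<mu> q"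
  unfolding A_def mem_Collect_eq by blast

lemma A_memI:
  assumes "q \<noteq> 0 \<Longrightarrow> \<forall>i. i \<notin> {1..n} \<longrightarrow> \<mu> i = 0" "\<And>i. q \<noteq> 0 \<Longrightarrow> i \<in> {j..n} \<Longrightarrow> integral_at i \<mu> q"
  shows "q \<in> A j \<mu>"
  using assms unfolding A_def mem_Collect_eq by blast

lemma A_0: "0 \<in> A j \<mu>" by (simp add: A_def)
lemma N_0: "0 \<in> N k \<mu>" by (simp add: N_def)

lemma A_coeffs: "coeff_subgroups (A j)"
  unfolding coeff_subgroups_def
proof (intro allI conjI ballI A_0)
  fix \<mu> q r assume q: "q \<in> A j \<mu>" and r: "r \<in> A j \<mu>"
  show "q - r \<in> A j \<mu>"
  proof (rule A_memI)
    assume "q - r \<noteq> 0"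
    then have "q \<noteq> 0 \<or> r \<noteq> 0" by auto
    then show "\<forall>i. i \<notin> {1..n} \<longrightarrow> \<mu> i = 0" using A_outside[OF q] A_outside[OF r] by blast
  next
    fix i assume "q - r \<noteq> 0" and i: "i \<in> {j..n}"
    have "integral_at i \<mu> (q - r)" if *: "q = 0 \<or> integral_at i \<mu> q" "r = 0 \<or> integral_at i \<mu> r"
    proof (cases "i = 0")
      case True
      then have "q \<in> Zp" "r \<in> Zp" using * Zp_simps(1) unfolding integral_at_def by metis+
      then show ?thesis using True Zp_intros(4) by (simp add: integral_at_def)
    next
      case False
      then show ?thesis using * \<open>q - r \<noteq> 0\<close> unfolding integral_at_def by (metis diff_self)
    qed
    moreover have "q = 0 \<or> integral_at i \<mu> q" using A_integral[OF q _ i] by auto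
    moreover have "r = 0 \<or> integral_at i \<mu> r" using A_integral[OF r _ i] by auto
    ultimately show "integral_at i \<mu> (q - r)" by blast
  qed
qed

lemma N_coeffs: "coeff_subgroups (N k)"
  unfolding coeff_subgroups_def
proof (intro allI conjI ballI)
  fix \<mu> q r assume q: "q \<in> N k \<mu>" and r: "r \<in> N k \<mu>"
  show "q - r \<in> N k \<mu>"
  proof (cases "\<exists>i<k. i \<noteq> 0 \<and> 0 \<le> \<mu> i")
    case True
    then obtain i where "i < k" "integral_at i \<mu> (q - r)" unfolding integral_at_def by auto
    then show ?thesis unfolding N_def by blast
  next
    case False
    have "integral_at i \<mu> x \<longleftrightarrow> i = 0 \<and> x \<in> Zp" if "i < k" for i x
    proof (cases "i = 0")
      case i: False
      then have "\<not> 0 \<le> \<mu> i" using False that by blast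
      then show ?thesis using i by (simp add: integral_at_def)
    qed (simp add: integral_at_def)
    then have *: "x \<in> N k \<mu> \<longleftrightarrow> x = 0 \<or> 0 < k \<and> x \<in> Zp" for x
      unfolding N_def mem_Collect_eq by metis
    have "q \<in> Zp" "r \<in> Zp" using q[unfolded *] r[unfolded *] Zp_simps(1) by metis+
    then have "q - r \<in> Zp" by (rule Zp_intros(4))
    moreover have "q - r = 0 \<or> 0 < k" using q[unfolded *] r[unfolded *] by auto
    ultimately show ?thesis unfolding * by blast
  qed
qed (simp add: N_def)

lemmas AN_coeffs = coeff_subgroups_Int[OF A_coeffs N_coeffs]

text \<open>If the \<open>S \<mu>\<close> are subgroups, this makes \<open>laurent_in S\<close> closed under multiplication by elements of \<open>R\<close>.\<close>

definition R_stable :: "((nat \<Rightarrow> int) \<Rightarrow> rat set) \<Rightarrow> bool"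
  where "R_stable S \<longleftrightarrow> (\<forall>m \<mu> q r. keys m \<subseteq> {1..n} \<longrightarrow> r \<in> Zp \<longrightarrow> q \<in> S \<mu> \<longrightarrow>
           r * q \<in> S (int_exponent m + \<mu>))"

lemma R_stable_Int: "R_stable S \<Longrightarrow> R_stable T \<Longrightarrow> R_stable (\<lambda>\<mu>. S \<mu> \<inter> T \<mu>)"
  unfolding R_stable_def by blast

lemma integral_at_mult:
  "r \<in> Zp \<Longrightarrow> integral_at i \<mu> q \<Longrightarrow> integral_at i (int_exponent m + \<mu>) (r * q)"
  using Zp_intros(2)[of r q] by (auto simp: integral_at_def int_exponent_def)

lemma A_stable: "R_stable (A j)"
proof -
  have "int_exponent m i = 0" if "keys m \<subseteq> {1..n}" "i \<notin> {1..n}" for m i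
    using that by (auto simp: int_exponent_def in_keys_iff subset_iff)
  then show ?thesis unfolding R_stable_def A_def using integral_at_mult by auto
qed

lemma N_stable: "R_stable (N k)"
  unfolding R_stable_def N_def using integral_at_mult by auto

lemmas AN_stable = R_stable_Int[OF A_stable N_stable]

lemma R_simps [simp]: "monoid.mult R = (*)" "one R = 1" "zero R = 0" "add R = (+)"
  by (simp_all add: graded_poly_ring_def Let_def)

lemma R_carrier: "f \<in> carrier R \<longleftrightarrow>
    (\<forall>m. lookup f m \<in> Zp) \<and> (\<forall>m\<in>keys f. keys m \<subseteq> {1..n})"
  by (simp add: graded_poly_ring_def Let_def)

lemma R_hpart_weight: "f \<in> hpart R d \<longleftrightarrow>
    f \<in> carrier R \<and> (\<forall>m\<in>keys f. int (weight w m) = d)"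
  by (simp add: graded_poly_ring_def Let_def)

lemma R_hpart: "f \<in> hpart R d \<longleftrightarrow> f \<in> carrier R \<and> emb f \<in> homog d"
proof -
  have "int (weight w m) = deg (int_exponent m)" if "f \<in> carrier R" "m \<in> keys f" for m
    using that deg_int_exponent[of m] unfolding R_carrier by simp
  then show ?thesis unfolding R_hpart_weight homog_iff keys_emb by auto
qed

lemma emb_mult_in:
  assumes S: "coeff_subgroups S" "R_stable S" and f: "f \<in> carrier R" and a: "a \<in> laurent_in S"
  shows "emb f * a \<in> laurent_in S"
  unfolding emb_def sum_distrib_right
proof (rule laurent_in_sum[OF S(1)])
  fix m assume "m \<in> keys f"
  then have "keys m \<subseteq> {1..n}" "lookup f m \<in> Zp" using f unfolding R_carrier by auto
  then show "single (int_exponent m) (lookup f m) * a \<in> laurent_in S"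
    using S(2) unfolding R_stable_def by (intro laurent_in_single_mult[OF a]) blast
qed

lemma A0_exponent:
  assumes "q \<in> A 0 \<mu>" "q \<noteq> 0"
  obtains m where "int_exponent m = \<mu>" "keys m \<subseteq> {1..n}" "q \<in> Zp"
proof -
  have *: "\<forall>i. i \<notin> {1..n} \<longrightarrow> \<mu> i = 0" "\<forall>i\<in>{0..n}. integral_at i \<mu> q"
    using assms unfolding A_def by auto
  have sub: "{i. \<mu> i \<noteq> 0} \<subseteq> {1..n}" using * by auto
  have "0 \<le> \<mu> i" for i
    using * unfolding integral_at_def by (cases "i \<in> {1..n}") force+
  then obtain m where "int_exponent m = \<mu>" "keys m = {i. \<mu> i \<noteq> 0}"
    using int_exponent_surj[of \<mu>] finite_subset[OF sub] by blast
  moreover have "q \<in> Zp" using bspec[OF *(2), of 0] by (simp add: integral_at_def)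
  ultimately show ?thesis using that sub by auto
qed

lemma R_carrier_emb: "f \<in> carrier R \<longleftrightarrow> emb f \<in> laurent_in (A 0)"
proof
  assume f: "f \<in> carrier R"
  have "1 \<in> laurent_in (A 0)"
    using laurent_in_single[OF A_coeffs, of 1 0 0] by (simp add: A_def integral_at_def Zp_simps)
  from emb_mult_in[OF A_coeffs A_stable f this] show "emb f \<in> laurent_in (A 0)" by simp
next
  assume f: "emb f \<in> laurent_in (A 0)"
  have "lookup f m \<in> Zp \<and> keys m \<subseteq> {1..n}" if "m \<in> keys f" for m
  proof -
    have "lookup f m \<in> A 0 (int_exponent m)" "lookup f m \<noteq> 0"
      using f that unfolding laurent_in_def by (auto simp: lookup_emb[symmetric] in_keys_iff)
    then show ?thesis by (elim A0_exponent) (auto simp: int_exponent_inject)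
  qed
  then show "f \<in> carrier R" unfolding R_carrier by (metis Zp_simps(1) in_keys_iff)
qed

lemma emb_surj:
  assumes "a \<in> laurent_in (A 0)"
  obtains f where "f \<in> carrier R" "emb f = a"
proof -
  have "\<exists>f. emb f = single \<mu> (lookup a \<mu>)" if "\<mu> \<in> keys a" for \<mu>
  proof -
    have "lookup a \<mu> \<in> A 0 \<mu>" "lookup a \<mu> \<noteq> 0"
      using assms that unfolding laurent_in_def by (auto simp: in_keys_iff)
    then obtain m where "int_exponent m = \<mu>" by (elim A0_exponent)
    then show ?thesis using emb_single by blast
  qed
  then obtain g where g: "\<And>\<mu>. \<mu> \<in> keys a \<Longrightarrow> emb (g \<mu>) = single \<mu> (lookup a \<mu>)"
    by metis
  have "emb (\<Sum>\<mu>\<in>keys a. g \<mu>) = (\<Sum>\<mu>\<in>keys a. single \<mu> (lookup a \<mu>))"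
    by (simp add: emb_sum g)
  also have "\<dots> = a" by (rule poly_mapping_sum_singles[symmetric]) auto
  finally show ?thesis using that assms R_carrier_emb by metis
qed

lemma R_closed:
  "0 \<in> carrier R" "1 \<in> carrier R"
  "f \<in> carrier R \<Longrightarrow> g \<in> carrier R \<Longrightarrow> f + g \<in> carrier R"
  "f \<in> carrier R \<Longrightarrow> g \<in> carrier R \<Longrightarrow> f - g \<in> carrier R"
  "f \<in> carrier R \<Longrightarrow> - f \<in> carrier R"
  "f \<in> carrier R \<Longrightarrow> g \<in> carrier R \<Longrightarrow> f * g \<in> carrier R"
proof -
  show "0 \<in> carrier R" by (simp add: R_carrier Zp_simps)
  show "1 \<in> carrier R" by (simp add: R_carrier lookup_one Zp_simps when_def)
qed (unfold R_carrier_emb emb_add emb_diff emb_uminus emb_mult,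
    auto intro: laurent_in_add laurent_in_diff laurent_in_uminus A_coeffs
      emb_mult_in[unfolded R_carrier_emb] A_stable)

lemma R_hpart_closed:
  "0 \<in> hpart R d" "1 \<in> hpart R 0"
  "f \<in> hpart R d \<Longrightarrow> g \<in> hpart R d \<Longrightarrow> f + g \<in> hpart R d"
  "f \<in> hpart R d \<Longrightarrow> g \<in> hpart R d \<Longrightarrow> f - g \<in> hpart R d"
  "f \<in> hpart R d \<Longrightarrow> - f \<in> hpart R d"
  "f \<in> hpart R d \<Longrightarrow> g \<in> hpart R e \<Longrightarrow> f * g \<in> hpart R (d + e)"
proof -
  have "1 \<in> homog 0" using homog_single[of 0 1] by (simp add: deg_def)
  then show "1 \<in> hpart R 0" by (simp add: R_hpart R_closed)
  show "f \<in> hpart R d \<Longrightarrow> - f \<in> hpart R d"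
    using homog_diff[OF homog_0, of "emb f" d] by (simp add: R_hpart R_closed emb_uminus)
qed (auto simp: R_hpart R_closed homog_0 emb_add emb_diff emb_mult homog_add homog_diff homog_mult)

lemma R_hpart_sum: "(\<And>x. x \<in> X \<Longrightarrow> f x \<in> hpart R d) \<Longrightarrow> sum f X \<in> hpart R d"
  by (induction X rule: infinite_finite_induct) (auto simp: R_hpart_closed)

lemma R_power: "f \<in> hpart R d \<Longrightarrow> f ^ k \<in> hpart R (int k * d)"
proof (induction k)
  case (Suc k) then show ?case using R_hpart_closed(6)[of f d "f ^ k" "int k * d"] by (simp add: algebra_simps)
qed (simp add: R_hpart_closed)

lemma R_hpart_carrier: "f \<in> hpart R d \<Longrightarrow> f \<in> carrier R" by (simp add: R_hpart)

lemma R_cring: "cring R"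
proof (rule cringI)
  show "abelian_group R"
  proof (rule abelian_groupI)
    fix x assume "x \<in> carrier R"
    then show "\<exists>y\<in>carrier R. y \<oplus>\<^bsub>R\<^esub> x = \<zero>\<^bsub>R\<^esub>" using R_closed(5) by (intro bexI[of _ "- x"]) auto
  qed (auto simp: R_closed algebra_simps)
  show "Group.comm_monoid R" by (rule comm_monoidI) (auto simp: R_closed algebra_simps)
qed (simp add: R_closed algebra_simps)

lemma R_finsum:
  assumes "\<And>x. x \<in> X \<Longrightarrow> f x \<in> carrier R"
  shows "finsum R f X = sum f X"
proof -
  interpret cring R by (rule R_cring)
  show ?thesis using assms
  proof (induction X rule: infinite_finite_induct)
    case (insert x F)
    then have "finsum R f (insert x F) = f x \<oplus>\<^bsub>R\<^esub> finsum R f F" by (intro finsum_insert) auto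
    with insert show ?case by simp
  qed (simp_all add: finsum_infinite)
qed

lemma regular_module: "module R (regular_gmodule R)"
proof -
  interpret cring R by (rule R_cring)
  show ?thesis
    by (rule moduleI, rule R_cring, rule abelian_groupI)
      (auto simp: regular_gmodule_def R_closed algebra_simps intro!: bexI[of _ "- _"])
qed

lemma regular_graded: "graded_module R (regular_gmodule R)"
proof (intro graded_module.intro graded_module_axioms.intro regular_module)
  interpret cring R by (rule R_cring)
  interpret RM: module R "regular_gmodule R" by (rule regular_module)
  have s: "carrier (regular_gmodule R) = carrier R" "zero (regular_gmodule R) = 0"
    "add (regular_gmodule R) = (+)" "smult (regular_gmodule R) = (*)"
    "gpart (regular_gmodule R) = hpart R" "finsum (regular_gmodule R) = finsum R"
    by (auto simp: regular_gmodule_def finsum_def finprod_def fun_eq_iff)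
  {
    fix i show "subgroup (gpart (regular_gmodule R) i) (add_monoid (regular_gmodule R))"
    proof (rule RM.M.add.subgroupI)
      show "gpart (regular_gmodule R) i \<noteq> {}" using R_hpart_closed(1) by (auto simp: s)
    next
      fix a assume a: "a \<in> gpart (regular_gmodule R) i"
      have "\<ominus>\<^bsub>regular_gmodule R\<^esub> a = - a"
        using a by (intro RM.M.minus_equality) (auto simp: s R_closed R_hpart_carrier)
      then show "\<ominus>\<^bsub>regular_gmodule R\<^esub> a \<in> gpart (regular_gmodule R) i"
        using a by (simp add: s R_hpart_closed)
    qed (auto simp: s R_hpart_closed R_hpart_carrier)
  next
    fix r d x i
    show "r \<in> hpart R d \<Longrightarrow> x \<in> gpart (regular_gmodule R) i \<Longrightarrow>
       r \<odot>\<^bsub>regular_gmodule R\<^esub> x \<in> gpart (regular_gmodule R) (d + i)"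
      by (simp add: s R_hpart_closed)
  next
    fix x assume x: "x \<in> carrier (regular_gmodule R)"
    define c where "c d = (\<Sum>m\<in>{m \<in> keys x. int (weight w m) = d}.
       single m (lookup x m))" for d
    have lc: "lookup (c d) m = (if int (weight w m) = d then lookup x m else 0)" for d m
      by (simp add: c_def lookup_sum lookup_single when_def in_keys_iff)
    have cR: "c d \<in> hpart R d" for d
    proof -
      have "keys (c d) \<subseteq> keys x" by (auto simp: in_keys_iff lc split: if_splits)
      then show ?thesis using x unfolding R_hpart_weight R_carrier s
        by (auto simp: lc Zp_simps in_keys_iff split: if_splits)
    qed
    have c0: "c d = 0 \<longleftrightarrow> d \<notin> (\<lambda>m. int (weight w m)) ` keys x" for d
    proof -
      have "c d = 0 \<longleftrightarrow> (\<forall>m. lookup (c d) m = 0)" by (metis lookup_zero poly_mapping_eqI)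
      then show ?thesis by (auto simp: lc in_keys_iff)
    qed
    then have cset: "{d. c d \<noteq> 0} = (\<lambda>m. int (weight w m)) ` keys x" by auto
    have cfin: "finite {d. c d \<noteq> 0}" unfolding cset by simp
    have csum: "x = (\<Sum>d\<in>{d. c d \<noteq> 0}. c d)"
    proof (rule poly_mapping_eqI)
      fix m
      have "lookup (\<Sum>d\<in>{d. c d \<noteq> 0}. c d) m =
        (if int (weight w m) \<in> {d. c d \<noteq> 0} then lookup x m else 0)"
        unfolding lookup_sum lc using cfin by (simp add: sum.delta')
      also have "\<dots> = lookup x m" unfolding cset by (auto simp: in_keys_iff)
      finally show "lookup x m = lookup (\<Sum>d\<in>{d. c d \<noteq> 0}. c d) m" by simp
    qed
    show "\<exists>!c. (\<forall>i. c i \<in> gpart (regular_gmodule R) i) \<and>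
        finite {i. c i \<noteq> \<zero>\<^bsub>regular_gmodule R\<^esub>} \<and>
        x = (\<Oplus>\<^bsub>regular_gmodule R\<^esub>i\<in>{i. c i \<noteq> \<zero>\<^bsub>regular_gmodule R\<^esub>}. c i)"
    proof (rule ex1I[of _ c])
      show "(\<forall>i. c i \<in> gpart (regular_gmodule R) i) \<and>
        finite {i. c i \<noteq> \<zero>\<^bsub>regular_gmodule R\<^esub>} \<and>
        x = (\<Oplus>\<^bsub>regular_gmodule R\<^esub>i\<in>{i. c i \<noteq> \<zero>\<^bsub>regular_gmodule R\<^esub>}. c i)"
        unfolding s using cR cfin csum R_finsum[of "{d. c d \<noteq> 0}" c] R_hpart_carrier[OF cR] by simp
    next
      fix c' assume "(\<forall>i. c' i \<in> gpart (regular_gmodule R) i) \<and>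
        finite {i. c' i \<noteq> \<zero>\<^bsub>regular_gmodule R\<^esub>} \<and>
        x = (\<Oplus>\<^bsub>regular_gmodule R\<^esub>i\<in>{i. c' i \<noteq> \<zero>\<^bsub>regular_gmodule R\<^esub>}. c' i)"
      then have c': "\<And>i. c' i \<in> hpart R i" "finite {i. c' i \<noteq> 0}" "x = (\<Sum>i\<in>{i. c' i \<noteq> 0}. c' i)"
        using R_finsum[of "{i. c' i \<noteq> 0}" c'] R_hpart_carrier unfolding s by (blast, blast, metis)
      have l0: "lookup (c' d) m = 0" if "int (weight w m) \<noteq> d" for d m
        using c'(1)[of d] that unfolding R_hpart_weight by (auto simp: in_keys_iff)
      show "c' = c"
      proof (intro ext poly_mapping_eqI)
        fix d m
        show "lookup (c' d) m = lookup (c d) m"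
        proof (cases "int (weight w m) = d")
          case True
          have "lookup x m = (\<Sum>i\<in>{i. c' i \<noteq> 0}. if i = d then lookup (c' d) m else 0)"
            by (subst c'(3), unfold lookup_sum, rule sum.cong) (use True l0 in auto)
          also have "\<dots> = lookup (c' d) m" using c'(2) by (simp add: sum.delta)
          finally show ?thesis using True by (simp add: lc)
        qed (simp add: lc l0)
      qed
    qed
  }
qed

end

sublocale weighted_poly_ring \<subseteq> graded_base "graded_poly_ring p n w"
  by (rule graded_base.intro) (rule regular_graded)


section \<open>Cochains of the standard resolution with Laurent polynomial values\<close>

text \<open>The value on the formal linear combination \<open>y\<close> of the linear map given by \<open>c\<close> on the basis.\<close>

definition ev :: "('b \<Rightarrow> rat_mpoly) \<Rightarrow> ('b \<Rightarrow> laurent) \<Rightarrow> laurent"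
  where "ev y c = (\<Sum>b\<in>{b. y b \<noteq> 0}. emb (y b) * c b)"

text \<open>The multiple \<open>r b\<close> of the basis element \<open>b\<close>.\<close>

definition unit_vec :: "rat_mpoly \<Rightarrow> 'b \<Rightarrow> 'b \<Rightarrow> rat_mpoly"
  where "unit_vec r b = (\<lambda>x. if x = b then r else 0)"

lemma ev_superset:
  assumes "finite S" "{b. y b \<noteq> 0} \<subseteq> S" shows "ev y c = (\<Sum>b\<in>S. emb (y b) * c b)"
  unfolding ev_def using assms by (intro sum.mono_neutral_left) auto

lemma ev_unit_vec: "ev (unit_vec r b) c = emb r * c b"
proof -
  have "ev (unit_vec r b) c = (\<Sum>x\<in>{b}. emb (unit_vec r b x) * c x)"
    by (rule ev_superset) (auto simp: unit_vec_def)
  then show ?thesis by (simp add: unit_vec_def)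
qed

lemma ev_zero [simp]: "ev (\<lambda>x. 0) c = 0" "ev y (\<lambda>b. 0) = 0"
  by (simp_all add: ev_def)

lemma ev_add:
  assumes "finite {b. y b \<noteq> 0}" "finite {b. z b \<noteq> 0}"
  shows "ev (\<lambda>b. y b + z b) c = ev y c + ev z c"
proof -
  let ?S = "{b. y b \<noteq> 0} \<union> {b. z b \<noteq> 0}"
  have S: "finite ?S" using assms by simp
  have "ev (\<lambda>b. y b + z b) c = (\<Sum>b\<in>?S. emb (y b + z b) * c b)" by (rule ev_superset[OF S]) auto
  also have "\<dots> = (\<Sum>b\<in>?S. emb (y b) * c b) + (\<Sum>b\<in>?S. emb (z b) * c b)"
    by (simp add: emb_add distrib_right sum.distrib)
  also have "\<dots> = ev y c + ev z c" using S by (simp add: ev_superset[of ?S])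
  finally show ?thesis .
qed

lemma ev_mult:
  assumes "finite {b. y b \<noteq> 0}" shows "ev (\<lambda>b. r * y b) c = emb r * ev y c"
proof -
  have "ev (\<lambda>b. r * y b) c = (\<Sum>b\<in>{b. y b \<noteq> 0}. emb (r * y b) * c b)"
    by (rule ev_superset[OF assms]) auto
  then show ?thesis by (simp add: ev_def emb_mult sum_distrib_left mult.assoc)
qed

lemma ev_diff:
  assumes "finite {b. y b \<noteq> 0}" "finite {b. z b \<noteq> 0}"
  shows "ev (\<lambda>b. y b - z b) c = ev y c - ev z c"
proof -
  have "ev (\<lambda>b. y b + (-1) * z b) c = ev y c + ev (\<lambda>b. (-1) * z b) c"
    by (rule ev_add) (use assms in auto)
  also have "ev (\<lambda>b. (-1) * z b) c = emb (-1) * ev z c" by (rule ev_mult[OF assms(2)])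
  finally show ?thesis by (simp add: emb_uminus)
qed

lemma ev_sum:
  assumes "finite I" "\<And>i. i \<in> I \<Longrightarrow> finite {b. y i b \<noteq> 0}"
  shows "ev (\<lambda>b. \<Sum>i\<in>I. y i b) c = (\<Sum>i\<in>I. ev (y i) c)"
  using assms
proof (induction I rule: finite_induct)
  case (insert i I)
  have sub: "{b. (\<Sum>i\<in>I. y i b) \<noteq> 0} \<subseteq> (\<Union>i\<in>I. {b. y i b \<noteq> 0})"
    by (auto dest: sum.not_neutral_contains_not_neutral)
  have "finite {b. (\<Sum>i\<in>I. y i b) \<noteq> 0}" by (rule finite_subset[OF sub]) (use insert in auto)
  then have "ev (\<lambda>b. y i b + (\<Sum>i\<in>I. y i b)) c = ev (y i) c + ev (\<lambda>b. \<Sum>i\<in>I. y i b) c"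
    using insert by (intro ev_add) auto
  with insert show ?case by simp
qed simp

lemma ev_cong: "(\<And>b. y b \<noteq> 0 \<Longrightarrow> c b = c' b) \<Longrightarrow> ev y c = ev y c'"
  unfolding ev_def by (rule sum.cong) auto

lemma ev_fun_add: "ev y (\<lambda>b. c b + c' b) = ev y c + ev y c'"
  by (simp add: ev_def distrib_left sum.distrib)

lemma ev_fun_diff: "ev y (\<lambda>b. c b - c' b) = ev y c - ev y c'"
  by (simp add: ev_def right_diff_distrib sum_subtractf)

lemma ev_fun_mult: "ev y (\<lambda>b. a * c b) = a * ev y c"
  by (simp add: ev_def sum_distrib_left mult.left_commute)

lemma unit_vec_induct:
  assumes "finite {b. y b \<noteq> 0}" "P (\<lambda>b. 0)" "\<And>y z. P y \<Longrightarrow> P z \<Longrightarrow> P (\<lambda>b. y b + z b)"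
    and "\<And>b. y b \<noteq> 0 \<Longrightarrow> P (unit_vec (y b) b)"
  shows "P y"
proof -
  have "P (\<lambda>x. if x \<in> S then y x else 0)" if "finite S" "S \<subseteq> {b. y b \<noteq> 0}" for S
    using that
  proof (induction S rule: finite_induct)
    case (insert b S)
    then have "P (\<lambda>x. unit_vec (y b) b x + (if x \<in> S then y x else 0))" by (intro assms(3,4)) auto
    moreover have "(\<lambda>x. unit_vec (y b) b x + (if x \<in> S then y x else 0)) = (\<lambda>x. if x \<in> insert b S then y x else 0)"
      using insert.hyps by (auto simp: unit_vec_def)
    ultimately show ?case by simp
  qed (simp add: assms(2))
  from this[OF assms(1)] have "P (\<lambda>x. if x \<in> {b. y b \<noteq> 0} then y x else 0)" by simp
  moreover have "(\<lambda>x. if x \<in> {b. y b \<noteq> 0} then y x else 0) = y" by auto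
  ultimately show ?thesis by simp
qed

locale poly_gmodule = weighted_poly_ring p n w + M: graded_module "graded_poly_ring p n w" M
  for p n w and M :: "(rat_mpoly, 'm) gmodule"
begin

abbreviation "X \<equiv> std_basis R M"
abbreviation "F \<equiv> std_free R M"
abbreviation "aug \<equiv> std_augmentation R M"

lemma M_graded: "graded_module R M" ..

lemma F_iff: "y \<in> carrier (F s) \<longleftrightarrow>
    (\<forall>b. y b \<in> carrier R) \<and> finite {b. y b \<noteq> 0} \<and> (\<forall>b. y b \<noteq> 0 \<longrightarrow> b \<in> X s)"
  unfolding std_free_def free_simps by auto

lemma F_simps: "zero (F s) = (\<lambda>x. 0)" "add (F s) = (\<lambda>f g x. f x + g x)"
  "smult (F s) = (\<lambda>r f x. r * f x)"
  unfolding std_free_def free_simps by simp_all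

lemma F_gpart: "y \<in> gpart (F s) i \<longleftrightarrow>
    finite {b. y b \<noteq> 0} \<and> (\<forall>b. y b \<noteq> 0 \<longrightarrow> b \<in> X s) \<and> (\<forall>b. y b \<in> hpart R (i - gen_deg b))"
  unfolding std_free_def free_simps using R_hpart_carrier by auto

lemma F_gpart_carrier: "y \<in> gpart (F s) i \<Longrightarrow> y \<in> carrier (F s)"
  unfolding F_gpart F_iff using R_hpart_carrier by blast

lemma unit_vec_carrier: "r \<in> carrier R \<Longrightarrow> b \<in> X s \<Longrightarrow> unit_vec r b \<in> carrier (F s)"
  unfolding F_iff unit_vec_def by (simp add: R_closed)

lemma unit_vec_gpart: "r \<in> hpart R d \<Longrightarrow> b \<in> X s \<Longrightarrow> unit_vec r b \<in> gpart (F s) (d + gen_deg b)"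
  unfolding F_gpart unit_vec_def by (simp add: R_hpart_closed)

text \<open>The boundary map of the standard resolution, written with a sum in the ring of polynomials.\<close>

definition bd :: "((rat_mpoly, 'm) gen \<Rightarrow> rat_mpoly) \<Rightarrow> (rat_mpoly, 'm) gen \<Rightarrow> rat_mpoly"
  where "bd y = (\<lambda>x. \<Sum>b\<in>{b. y b \<noteq> 0}. y b * gen_cycle R b x)"

lemma gen_cycle_gpart: "b \<in> X (Suc s) \<Longrightarrow> gen_cycle R b \<in> gpart (F s) (gen_deg b)"
  by (cases s) (auto simp: std_free_def Let_def)

lemma gen_cycle_D:
  assumes "b \<in> X (Suc s)"
  shows "finite {a. gen_cycle R b a \<noteq> 0}" "\<And>a. gen_cycle R b a \<noteq> 0 \<Longrightarrow> a \<in> X s"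
    "\<And>a. gen_cycle R b a \<in> hpart R (gen_deg b - gen_deg a)"
  using gen_cycle_gpart[OF assms] unfolding F_gpart by blast+

lemma std_boundary_bd:
  assumes "y \<in> carrier (F (Suc s))"
  shows "std_boundary R M s y = bd y"
proof
  fix x
  have y: "finite {b. y b \<noteq> 0}" "\<And>b. y b \<noteq> 0 \<Longrightarrow> b \<in> X (Suc s)" "\<And>b. y b \<in> carrier R"
    using assms unfolding F_iff by auto
  interpret Fs: graded_module R "F s" by (rule std_free_graded[OF M_graded])
  have c: "y b \<odot>\<^bsub>F s\<^esub> gen_cycle R b \<in> carrier (F s)" if "y b \<noteq> 0" for b
    by (rule Fs.smult_closed[OF y(3) F_gpart_carrier[OF gen_cycle_gpart[OF y(2)[OF that]]]])
  have "std_boundary R M s y x = (\<Oplus>\<^bsub>F s\<^esub>b\<in>{b. y b \<noteq> 0}. y b \<odot>\<^bsub>F s\<^esub> gen_cycle R b) x"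
    by (simp add: std_boundary_def linear_extension_def)
  also have "\<dots> = finsum R (\<lambda>b. (y b \<odot>\<^bsub>F s\<^esub> gen_cycle R b) x) {b. y b \<noteq> 0}"
    unfolding std_free_def by (rule free_finsum) (use y c in \<open>auto simp: std_free_def\<close>)
  also have "\<dots> = (\<Sum>b\<in>{b. y b \<noteq> 0}. (y b \<odot>\<^bsub>F s\<^esub> gen_cycle R b) x)"
    by (rule R_finsum) (use c in \<open>auto simp: F_iff\<close>)
  finally show "std_boundary R M s y x = bd y x" by (simp add: bd_def F_simps)
qed

lemma bd_gpart: "y \<in> gpart (F (Suc s)) i \<Longrightarrow> bd y \<in> gpart (F s) i"
  using std_resolution(5)[OF M_graded, of s i] std_boundary_bd[OF F_gpart_carrier] by force

lemma gen_cycle_bd: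
  assumes "b \<in> X (Suc (Suc s))" shows "bd (gen_cycle R b) = (\<lambda>x. 0)"
proof -
  have "std_boundary R M s (gen_cycle R b) = \<zero>\<^bsub>F s\<^esub>"
    using assms by (auto simp: std_boundary_def std_free_def Let_def)
  then show ?thesis
    using std_boundary_bd[OF F_gpart_carrier[OF gen_cycle_gpart[OF assms]]] by (simp add: F_simps)
qed

lemma gen_cycle_aug: "b \<in> X (Suc 0) \<Longrightarrow> aug (gen_cycle R b) = \<zero>\<^bsub>M\<^esub>"
  by auto

text \<open>The basis of the standard resolution is so large that each homogeneous cycle is the boundary
  of a single basis element.\<close>

lemma cycle_is_gen_cycle:
  assumes "y \<in> gpart (F (Suc s)) i" "bd y = (\<lambda>x. 0)"
  obtains b where "b \<in> X (Suc (Suc s))" "gen_deg b = i" "gen_cycle R b = y"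
proof -
  obtain z where z: "combination R z = y" using syz_ex[OF M_graded] assms(1) unfolding std_free_def by blast
  have "linear_extension R (F s) (gen_cycle R) y = \<zero>\<^bsub>F s\<^esub>"
    using std_boundary_bd[OF F_gpart_carrier[OF assms(1)]] assms(2) by (simp add: F_simps std_boundary_def)
  then have "Syz i z \<in> X (Suc (Suc s))" using z assms(1) by (simp add: Let_def std_free_def)
  then show ?thesis using that[of "Syz i z"] z by simp
qed

lemma aug_cycle_is_gen_cycle:
  assumes "y \<in> gpart (F 0) i" "aug y = \<zero>\<^bsub>M\<^esub>"
  obtains b where "b \<in> X (Suc 0)" "gen_deg b = i" "gen_cycle R b = y"
proof -
  obtain z where z: "combination R z = y" using syz_ex[OF M_graded] assms(1) unfolding std_free_def by blast
  then have "Syz i z \<in> X (Suc 0)" using assms by (simp add: std_free_def)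
  then show ?thesis using that[of "Syz i z"] z by simp
qed

lemma aug_add: "y \<in> carrier (F 0) \<Longrightarrow> z \<in> carrier (F 0) \<Longrightarrow> aug (\<lambda>b. y b + z b) = aug y \<oplus>\<^bsub>M\<^esub> aug z"
  using std_resolution(1)[OF M_graded] by (auto simp: linear_maps_def hom_def F_simps)

lemma aug_smult: "r \<in> carrier R \<Longrightarrow> y \<in> carrier (F 0) \<Longrightarrow> aug (\<lambda>b. r * y b) = r \<odot>\<^bsub>M\<^esub> aug y"
  using std_resolution(1)[OF M_graded] by (auto simp: linear_maps_def F_simps)

lemma aug_gpart: "y \<in> gpart (F 0) i \<Longrightarrow> aug y \<in> gpart M i"
  using std_resolution(2)[OF M_graded] by auto

lemma aug_unit_vec:
  assumes "r \<in> carrier R" "m \<in> gpart M i"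
  shows "aug (unit_vec r (Elt i m)) = r \<odot>\<^bsub>M\<^esub> m"
proof -
  have mc: "m \<in> carrier M" using M.gpart_sub[OF assms(2)] .
  have "{x. unit_vec 1 (Elt i m :: (rat_mpoly, 'm) gen) x \<noteq> 0} = {Elt i m}" by (auto simp: unit_vec_def)
  moreover have "finsum M (\<lambda>x. unit_vec 1 (Elt i m :: (rat_mpoly, 'm) gen) x \<odot>\<^bsub>M\<^esub> gen_elt x) {Elt i m} = \<one>\<^bsub>R\<^esub> \<odot>\<^bsub>M\<^esub> m"
    using M.smult_closed[of 1 m] R_closed(2) mc by (simp add: unit_vec_def)
  ultimately have "aug (unit_vec 1 (Elt i m)) = m"
    unfolding std_augmentation_def linear_extension_def using M.smult_one[OF mc] by simp
  moreover have "unit_vec r (Elt i m :: (rat_mpoly, 'm) gen) = (\<lambda>b. r * unit_vec 1 (Elt i m) b)" by (auto simp: unit_vec_def)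
  moreover have "(Elt i m :: (rat_mpoly, 'm) gen) \<in> X 0" using assms by auto
  ultimately show ?thesis using aug_smult[OF assms(1)] unit_vec_carrier[OF R_closed(2)] by metis
qed

text \<open>A cochain of degree \<open>s\<close> is given by its values on the basis of stage \<open>s\<close>; its values elsewhere
  are irrelevant. The coboundary \<open>\<delta>\<close> is the same function in all degrees.\<close>

definition \<delta> :: "((rat_mpoly, 'm) gen \<Rightarrow> laurent) \<Rightarrow> (rat_mpoly, 'm) gen \<Rightarrow> laurent"
  where "\<delta> c = (\<lambda>b. ev (gen_cycle R b) c)"

lemma \<delta>_add: "\<delta> (\<lambda>b. c b + c' b) = (\<lambda>b. \<delta> c b + \<delta> c' b)"
  and \<delta>_diff: "\<delta> (\<lambda>b. c b - c' b) = (\<lambda>b. \<delta> c b - \<delta> c' b)"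
  and \<delta>_mult: "\<delta> (\<lambda>b. a * c b) = (\<lambda>b. a * \<delta> c b)"
  by (simp_all add: \<delta>_def ev_fun_add ev_fun_diff ev_fun_mult)

lemma \<delta>_cong: "b \<in> X (Suc s) \<Longrightarrow> (\<And>a. a \<in> X s \<Longrightarrow> c a = c' a) \<Longrightarrow> \<delta> c b = \<delta> c' b"
  unfolding \<delta>_def using gen_cycle_D(2) by (intro ev_cong) blast

lemma ev_bd:
  assumes "y \<in> carrier (F (Suc s))" shows "ev (bd y) c = ev y (\<delta> c)"
proof -
  have y: "finite {b. y b \<noteq> 0}" "\<And>b. y b \<noteq> 0 \<Longrightarrow> b \<in> X (Suc s)"
    using assms unfolding F_iff by auto
  have fin: "finite {x. gen_cycle R b x \<noteq> 0}" if "y b \<noteq> 0" for b using gen_cycle_D(1) y(2) that by blast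
  have "finite {x. y b * gen_cycle R b x \<noteq> 0}" if "y b \<noteq> 0" for b
    by (rule finite_subset[OF _ fin[OF that]]) auto
  then have "ev (bd y) c = (\<Sum>b\<in>{b. y b \<noteq> 0}. ev (\<lambda>x. y b * gen_cycle R b x) c)"
    unfolding bd_def using y by (intro ev_sum) auto
  also have "\<dots> = (\<Sum>b\<in>{b. y b \<noteq> 0}. emb (y b) * ev (gen_cycle R b) c)"
    by (rule sum.cong) (use fin ev_mult in auto)
  finally show ?thesis by (simp add: ev_def[of y] \<delta>_def)
qed

lemma \<delta>_\<delta>: "b \<in> X (Suc (Suc s)) \<Longrightarrow> \<delta> (\<delta> c) b = 0"
  using ev_bd[OF F_gpart_carrier[OF gen_cycle_gpart], of b s c] gen_cycle_bd[of b s]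
  by (simp add: \<delta>_def)

text \<open>The cochains with values in \<open>laurent_in S\<close> that lower degrees by \<open>t\<close>.\<close>

definition coch :: "nat \<Rightarrow> int \<Rightarrow> ((nat \<Rightarrow> int) \<Rightarrow> rat set) \<Rightarrow> ((rat_mpoly, 'm) gen \<Rightarrow> laurent) set"
  where "coch s t S = {c. \<forall>b\<in>X s. c b \<in> laurent_in S \<and> c b \<in> homog (gen_deg b - t)}"

lemma cochI: "(\<And>b. b \<in> X s \<Longrightarrow> c b \<in> laurent_in S) \<Longrightarrow> (\<And>b. b \<in> X s \<Longrightarrow> c b \<in> homog (gen_deg b - t)) \<Longrightarrow>
    c \<in> coch s t S"
  unfolding coch_def by blast

lemma cochD: "c \<in> coch s t S \<Longrightarrow> b \<in> X s \<Longrightarrow> c b \<in> laurent_in S"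
  "c \<in> coch s t S \<Longrightarrow> b \<in> X s \<Longrightarrow> c b \<in> homog (gen_deg b - t)"
  unfolding coch_def by blast+

lemma coch_Int: "coch s t (\<lambda>\<mu>. S \<mu> \<inter> T \<mu>) = coch s t S \<inter> coch s t T"
  unfolding coch_def laurent_in_Int by blast

lemma ev_in:
  assumes "coeff_subgroups S" "R_stable S" "c \<in> coch s t S" "y \<in> carrier (F s)"
  shows "ev y c \<in> laurent_in S"
  unfolding ev_def
  by (rule laurent_in_sum[OF assms(1)], rule emb_mult_in[OF assms(1,2)])
     (use assms cochD in \<open>auto simp: F_iff\<close>)

lemma ev_homog:
  assumes "c \<in> coch s t S" "y \<in> gpart (F s) i"
  shows "ev y c \<in> homog (i - t)"
  unfolding ev_def
proof (rule homog_sum)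
  fix b assume "b \<in> {b. y b \<noteq> 0}"
  then have "c b \<in> homog (gen_deg b - t)" "emb (y b) \<in> homog (i - gen_deg b)"
    using assms cochD unfolding F_gpart R_hpart by auto
  from homog_mult[OF this(2,1)] show "emb (y b) * c b \<in> homog (i - t)" by simp
qed

lemma \<delta>_coch:
  assumes "coeff_subgroups S" "R_stable S" "c \<in> coch s t S"
  shows "\<delta> c \<in> coch (Suc s) t S"
  unfolding \<delta>_def
  by (rule cochI) (use assms ev_in ev_homog gen_cycle_gpart F_gpart_carrier in blast)+

lemma coch_add:
  "coeff_subgroups S \<Longrightarrow> c \<in> coch s t S \<Longrightarrow> c' \<in> coch s t S \<Longrightarrow> (\<lambda>b. c b + c' b) \<in> coch s t S"
  by (rule cochI) (auto intro: laurent_in_add homog_add dest: cochD)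

lemma coch_diff:
  "coeff_subgroups S \<Longrightarrow> c \<in> coch s t S \<Longrightarrow> c' \<in> coch s t S \<Longrightarrow> (\<lambda>b. c b - c' b) \<in> coch s t S"
  by (rule cochI) (auto intro: laurent_in_diff homog_diff dest: cochD)

lemma coch_mult:
  assumes "coeff_subgroups S" "R_stable S" "c \<in> coch s t S" "r \<in> hpart R d"
  shows "(\<lambda>b. emb r * c b) \<in> coch s (t - d) S"
proof (rule cochI)
  fix b assume b: "b \<in> X s"
  show "emb r * c b \<in> laurent_in S"
    by (rule emb_mult_in[OF assms(1,2)]) (use assms cochD b R_hpart_carrier in blast)+
  have "emb r * c b \<in> homog (d + (gen_deg b - t))"
    by (rule homog_mult) (use assms cochD b R_hpart in blast)+
  then show "emb r * c b \<in> homog (gen_deg b - (t - d))" by (simp add: algebra_simps)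
qed

lemma coch_mono: "(\<And>\<mu>. S \<mu> \<subseteq> T \<mu>) \<Longrightarrow> coch s t S \<subseteq> coch s t T"
  unfolding coch_def laurent_in_def by blast

lemma coch_cong: "(\<And>b. b \<in> X s \<Longrightarrow> c b = c' b) \<Longrightarrow> c \<in> coch s t S \<longleftrightarrow> c' \<in> coch s t S"
  unfolding coch_def by auto


section \<open>Vanishing for coefficients on which a variable is invertible\<close>

text \<open>Let \<open>x\<close> act locally nilpotently on \<open>M\<close>, and let \<open>\<xi>\<close> be its inverse. Then the standard
  resolution becomes contractible when \<open>x\<close> is inverted. Because cycles are boundaries of basis
  elements, the contraction can be chosen to send each basis element \<open>b\<close> to \<open>\<xi> ^ e b\<close> times a single
  basis element \<open>\<sigma> b\<close>.\<close>

context
  fixes x :: rat_mpoly and d :: int and \<xi> :: laurent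
  assumes x: "x \<in> hpart R d" and \<xi>: "emb x * \<xi> = 1" "\<xi> \<in> homog (- d)"
    and nilpotent: "\<And>i m. m \<in> gpart M i \<Longrightarrow> \<exists>e. x ^ e \<odot>\<^bsub>M\<^esub> m = \<zero>\<^bsub>M\<^esub>"
begin

text \<open>The operator on cochains given by the contraction, which lowers the degree by one.\<close>

definition H :: "((rat_mpoly, 'm) gen \<Rightarrow> (rat_mpoly, 'm) gen) \<Rightarrow> ((rat_mpoly, 'm) gen \<Rightarrow> nat) \<Rightarrow>
    ((rat_mpoly, 'm) gen \<Rightarrow> laurent) \<Rightarrow> (rat_mpoly, 'm) gen \<Rightarrow> laurent"
  where "H \<sigma> e c = (\<lambda>b. \<xi> ^ e b * c (\<sigma> b))"

text \<open>The map \<open>\<sigma>\<close> goes from stage \<open>k\<close> to stage \<open>k + 1\<close>, and \<open>\<xi> ^ e b\<close> times \<open>\<sigma> b\<close> has the degree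
  of \<open>b\<close>.\<close>

definition raises :: "nat \<Rightarrow> ((rat_mpoly, 'm) gen \<Rightarrow> (rat_mpoly, 'm) gen) \<Rightarrow> ((rat_mpoly, 'm) gen \<Rightarrow> nat) \<Rightarrow> bool"
  where "raises k \<sigma> e \<longleftrightarrow> (\<forall>b\<in>X k. \<sigma> b \<in> X (Suc k) \<and> gen_deg (\<sigma> b) = gen_deg b + int (e b) * d)"

lemma power_cancel: "emb x ^ k * \<xi> ^ k = 1"
  using \<xi>(1) by (simp add: power_mult_distrib[symmetric])

lemma H_coch:
  assumes "raises k \<sigma> e" "c \<in> coch (Suc k) t S" "\<And>a. a \<in> laurent_in S \<Longrightarrow> \<xi> * a \<in> laurent_in S"
  shows "H \<sigma> e c \<in> coch k t S"
proof (rule cochI)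
  fix b assume b: "b \<in> X k"
  then have \<sigma>: "\<sigma> b \<in> X (Suc k)" "gen_deg (\<sigma> b) = gen_deg b + int (e b) * d"
    using assms(1) unfolding raises_def by auto
  have "\<xi> ^ j * c (\<sigma> b) \<in> laurent_in S" for j
    by (induction j) (use cochD[OF assms(2) \<sigma>(1)] assms(3) in \<open>auto simp: mult.assoc\<close>)
  then show "H \<sigma> e c b \<in> laurent_in S" by (simp add: H_def)
  have "\<xi> ^ j * c (\<sigma> b) \<in> homog (gen_deg (\<sigma> b) - t - int j * d)" for j
  proof (induction j)
    case (Suc j)
    from homog_mult[OF \<xi>(2) this] show ?case by (simp add: algebra_simps)
  qed (use cochD[OF assms(2) \<sigma>(1)] in simp)
  from this[of "e b"] show "H \<sigma> e c b \<in> homog (gen_deg b - t)" by (simp add: H_def \<sigma>(2))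
qed

text \<open>If \<open>x\<^sup>k\<close> annihilates \<open>m\<close> then \<open>x\<^sup>k\<close> times the basis element for \<open>m\<close> is a cycle.\<close>

lemma contraction_0: "\<exists>\<sigma> e. raises 0 \<sigma> e \<and> (\<forall>c. \<forall>b\<in>X 0. H \<sigma> e (\<delta> c) b = c b)"
proof -
  have "\<exists>b' k. b' \<in> X (Suc 0) \<and> gen_deg b' = gen_deg b + int k * d \<and> gen_cycle R b' = unit_vec (x ^ k) b"
    if "b \<in> X 0" for b
  proof -
    from that obtain i m where b: "b = Elt i m" "m \<in> gpart M i" by auto
    obtain k where k: "x ^ k \<odot>\<^bsub>M\<^esub> m = \<zero>\<^bsub>M\<^esub>" using nilpotent[OF b(2)] by blast
    have "unit_vec (x ^ k) b \<in> gpart (F 0) (int k * d + gen_deg b)"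
      by (rule unit_vec_gpart[OF R_power[OF x] that])
    moreover have "aug (unit_vec (x ^ k) b) = \<zero>\<^bsub>M\<^esub>"
      unfolding b(1) using aug_unit_vec[OF R_hpart_carrier[OF R_power[OF x]] b(2)] k by simp
    ultimately show ?thesis by (rule aug_cycle_is_gen_cycle) (auto simp: add.commute)
  qed
  then obtain \<sigma> e where se: "\<And>b. b \<in> X 0 \<Longrightarrow> \<sigma> b \<in> X (Suc 0) \<and> gen_deg (\<sigma> b) = gen_deg b + int (e b) * d
      \<and> gen_cycle R (\<sigma> b) = unit_vec (x ^ e b) b" by metis
  have "H \<sigma> e (\<delta> c) b = c b" if "b \<in> X 0" for c b
  proof -
    have "H \<sigma> e (\<delta> c) b = \<xi> ^ e b * (emb x ^ e b * c b)"
      using se[OF that] by (simp add: H_def \<delta>_def ev_unit_vec emb_power)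
    also have "\<dots> = (emb x ^ e b * \<xi> ^ e b) * c b" by (simp only: ac_simps)
    finally show ?thesis by (simp add: power_cancel)
  qed
  then show ?thesis using se unfolding raises_def by blast
qed

text \<open>The second hypothesis is the homotopy identity on coboundaries. It makes the contraction extend
  to the next stage in such a way that the homotopy identity holds on all cochains of degree \<open>k + 1\<close>.\<close>

lemma contraction_Suc:
  assumes r: "raises k \<sigma> e" and h: "\<And>c b. b \<in> X (Suc k) \<Longrightarrow> \<delta> (H \<sigma> e (\<delta> c)) b = \<delta> c b"
  shows "\<exists>\<sigma>' e'. raises (Suc k) \<sigma>' e' \<and>
    (\<forall>c. \<forall>b\<in>X (Suc k). H \<sigma>' e' (\<delta> c) b = c b - \<delta> (H \<sigma> e c) b)"
proof -
  have "\<exists>b' E. b' \<in> X (Suc (Suc k)) \<and> gen_deg b' = gen_deg b + int E * d \<and>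
     (\<forall>c. \<delta> c b' = emb x ^ E * (c b - \<delta> (H \<sigma> e c) b))" if b: "b \<in> X (Suc k)" for b
  proof -
    define z where "z = gen_cycle R b"
    define S where "S = {a. z a \<noteq> 0}"
    define E where "E = (\<Sum>a\<in>S. e a)"
    have S: "finite S" "S \<subseteq> X k" using gen_cycle_D[OF b] unfolding S_def z_def by auto
    have zh: "z a \<in> hpart R (gen_deg b - gen_deg a)" for a using gen_cycle_D[OF b] unfolding z_def by auto
    have E: "e a \<le> E" if "a \<in> S" for a unfolding E_def using S that by (simp add: member_le_sum)
    have \<sigma>: "\<sigma> a \<in> X (Suc k)" "gen_deg (\<sigma> a) = gen_deg a + int (e a) * d" if "a \<in> S" for a
      using r S that unfolding raises_def by auto
    \<comment> \<open>\<open>u\<close> is \<open>b\<close> minus the contraction applied to its boundary \<open>z\<close>, multiplied by \<open>x\<^sup>E\<close> to clear the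
      powers of \<open>\<xi>\<close>\<close>
    define v where "v = (\<lambda>a. unit_vec (z a * x ^ (E - e a)) (\<sigma> a))"
    define u where "u = (\<lambda>y. unit_vec (x ^ E) b y - (\<Sum>a\<in>S. v a y))"
    have finv: "finite {y. v a y \<noteq> 0}" for a unfolding v_def unit_vec_def by simp
    have sub: "{y. (\<Sum>a\<in>S. v a y) \<noteq> 0} \<subseteq> \<sigma> ` S"
    proof
      fix y assume y: "y \<in> {y. (\<Sum>a\<in>S. v a y) \<noteq> 0}"
      show "y \<in> \<sigma> ` S"
      proof (rule ccontr)
        assume "y \<notin> \<sigma> ` S"
        then have "(\<Sum>a\<in>S. v a y) = 0" by (intro sum.neutral) (auto simp: v_def unit_vec_def)
        with y show False by simp
      qed
    qed
    have finS: "finite {y. (\<Sum>a\<in>S. v a y) \<noteq> 0}" by (rule finite_subset[OF sub]) (use S in simp)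
    have finu: "finite {y. unit_vec (x ^ E) b y \<noteq> 0}" unfolding unit_vec_def by simp
    have usub: "{y. u y \<noteq> 0} \<subseteq> insert b (\<sigma> ` S)" using sub unfolding u_def unit_vec_def by auto
    have ug: "u \<in> gpart (F (Suc k)) (gen_deg b + int E * d)"
      unfolding F_gpart
    proof (intro conjI allI impI)
      show "finite {y. u y \<noteq> 0}" by (rule finite_subset[OF usub]) (use S in simp)
      show "y \<in> X (Suc k)" if "u y \<noteq> 0" for y using usub \<sigma> b that by auto
      fix y
      have "unit_vec (x ^ E) b y \<in> hpart R (gen_deg b + int E * d - gen_deg y)"
        using R_power[OF x, of E] by (simp add: unit_vec_def R_hpart_closed)
      moreover have "v a y \<in> hpart R (gen_deg b + int E * d - gen_deg y)" if "a \<in> S" for a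
      proof (cases "y = \<sigma> a")
        case True
        have "gen_deg b - gen_deg a + int (E - e a) * d = gen_deg b + int E * d - gen_deg y"
          using True \<sigma>(2)[OF that] E[OF that] by (simp add: of_nat_diff algebra_simps)
        with R_hpart_closed(6)[OF zh R_power[OF x, of "E - e a"], of a]
        have "z a * x ^ (E - e a) \<in> hpart R (gen_deg b + int E * d - gen_deg y)" by simp
        then show ?thesis using True by (simp add: v_def unit_vec_def)
      qed (simp add: v_def unit_vec_def R_hpart_closed)
      ultimately show "u y \<in> hpart R (gen_deg b + int E * d - gen_deg y)"
        unfolding u_def by (intro R_hpart_closed(4) R_hpart_sum)
    qed
    have evu: "ev u c = emb x ^ E * (c b - \<delta> (H \<sigma> e c) b)" for c
    proof -
      have "emb (z a * x ^ (E - e a)) * c (\<sigma> a) = emb x ^ E * (emb (z a) * H \<sigma> e c a)" if "a \<in> S" for a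
      proof -
        have "emb x ^ E * \<xi> ^ e a = emb x ^ (E - e a) * (emb x ^ e a * \<xi> ^ e a)"
          using E[OF that] by (simp add: mult.assoc[symmetric] power_add[symmetric])
        then have *: "emb x ^ (E - e a) = emb x ^ E * \<xi> ^ e a" by (simp add: power_cancel)
        show ?thesis unfolding H_def emb_mult emb_power * by (simp only: ac_simps)
      qed
      then have "(\<Sum>a\<in>S. ev (v a) c) = emb x ^ E * ev z (H \<sigma> e c)"
        unfolding v_def ev_unit_vec ev_def[of z] S_def[symmetric] sum_distrib_left by (intro sum.cong) auto
      moreover have "ev u c = ev (unit_vec (x ^ E) b) c - (\<Sum>a\<in>S. ev (v a) c)"
        unfolding u_def ev_diff[OF finu finS] using ev_sum[OF S(1), of v c] finv by simp
      ultimately show ?thesis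
        by (simp add: ev_unit_vec emb_power \<delta>_def z_def right_diff_distrib)
    qed
    \<comment> \<open>\<open>u\<close> is a cycle, as all cochains of the form \<open>\<delta> c\<close> vanish on it\<close>
    have "emb (bd u y) = 0" for y
    proof -
      have "ev (bd u) (\<lambda>a. if a = y then 1 else 0) = (\<Sum>a\<in>{a. bd u a \<noteq> 0}. if a = y then emb (bd u a) else 0)"
        unfolding ev_def by (rule sum.cong) auto
      also have "\<dots> = emb (bd u y)"
        using bd_gpart[OF ug] by (simp add: F_gpart sum.delta)
      finally have "emb (bd u y) = ev (bd u) (\<lambda>a. if a = y then 1 else 0)" by simp
      also have "\<dots> = 0"
        unfolding ev_bd[OF F_gpart_carrier[OF ug]] evu h[OF b] by simp
      finally show ?thesis .
    qed
    then have "bd u = (\<lambda>x. 0)" by (auto simp: emb_eq_0)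
    then obtain b' where "b' \<in> X (Suc (Suc k))" "gen_deg b' = gen_deg b + int E * d" "gen_cycle R b' = u"
      using cycle_is_gen_cycle[OF ug] by blast
    then show ?thesis using evu unfolding \<delta>_def[of _ ] by (intro exI[of _ b'] exI[of _ E]) auto
  qed
  then obtain \<sigma>' e' where s: "\<And>b. b \<in> X (Suc k) \<Longrightarrow> \<sigma>' b \<in> X (Suc (Suc k)) \<and>
     gen_deg (\<sigma>' b) = gen_deg b + int (e' b) * d \<and>
     (\<forall>c. \<delta> c (\<sigma>' b) = emb x ^ e' b * (c b - \<delta> (H \<sigma> e c) b))" by metis
  have "H \<sigma>' e' (\<delta> c) b = c b - \<delta> (H \<sigma> e c) b" if "b \<in> X (Suc k)" for c b
  proof -
    have "H \<sigma>' e' (\<delta> c) b = (emb x ^ e' b * \<xi> ^ e' b) * (c b - \<delta> (H \<sigma> e c) b)"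
      using s[OF that] unfolding H_def[of \<sigma>' e'] by (simp only: ac_simps)
    then show ?thesis by (simp add: power_cancel)
  qed
  then show ?thesis using s unfolding raises_def by blast
qed

lemma contraction_ex:
  "\<exists>\<sigma> e. raises k \<sigma> e \<and> (\<forall>c. \<forall>b\<in>X (Suc k). \<delta> (H \<sigma> e (\<delta> c)) b = \<delta> c b)"
proof (induction k)
  case 0
  obtain \<sigma> e where *: "raises 0 \<sigma> e" "\<And>c b. b \<in> X 0 \<Longrightarrow> H \<sigma> e (\<delta> c) b = c b"
    using contraction_0 by blast
  have "\<delta> (H \<sigma> e (\<delta> c)) b = \<delta> c b" if "b \<in> X (Suc 0)" for c b
    using \<delta>_cong[OF that *(2)] .
  with * show ?case by blast
next
  case (Suc k)
  then obtain \<sigma> e where "raises k \<sigma> e" "\<And>c b. b \<in> X (Suc k) \<Longrightarrow> \<delta> (H \<sigma> e (\<delta> c)) b = \<delta> c b" by blast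
  from contraction_Suc[OF this] obtain \<sigma>' e' where *: "raises (Suc k) \<sigma>' e'"
    "\<And>c b. b \<in> X (Suc k) \<Longrightarrow> H \<sigma>' e' (\<delta> c) b = c b - \<delta> (H \<sigma> e c) b" by blast
  have "\<delta> (H \<sigma>' e' (\<delta> c)) b = \<delta> c b" if b: "b \<in> X (Suc (Suc k))" for c b
  proof -
    have "\<delta> (H \<sigma>' e' (\<delta> c)) b = \<delta> (\<lambda>b. c b - \<delta> (H \<sigma> e c) b) b" by (rule \<delta>_cong[OF b *(2)])
    also have "\<dots> = \<delta> c b" by (simp add: \<delta>_diff \<delta>_\<delta>[OF b])
    finally show ?thesis .
  qed
  with * show ?case by blast
qed

lemma cocycle_0_eq_0:
  assumes "\<And>b. b \<in> X (Suc 0) \<Longrightarrow> \<delta> c b = 0" "b \<in> X 0"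
  shows "c b = 0"
proof -
  obtain \<sigma> e where *: "raises 0 \<sigma> e" "\<And>c b. b \<in> X 0 \<Longrightarrow> H \<sigma> e (\<delta> c) b = c b"
    using contraction_0 by blast
  have "\<delta> c (\<sigma> b) = 0" using assms *(1) unfolding raises_def by blast
  then show ?thesis using *(2)[OF assms(2), of c] by (simp add: H_def)
qed

lemma cocycle_Suc_is_coboundary:
  assumes c: "c \<in> coch (Suc k) t S" "\<And>b. b \<in> X (Suc (Suc k)) \<Longrightarrow> \<delta> c b = 0"
    and S: "\<And>a. a \<in> laurent_in S \<Longrightarrow> \<xi> * a \<in> laurent_in S"
  shows "\<exists>h\<in>coch k t S. \<forall>b\<in>X (Suc k). \<delta> h b = c b"
proof -
  obtain \<sigma> e where r: "raises k \<sigma> e" and h: "\<And>c b. b \<in> X (Suc k) \<Longrightarrow> \<delta> (H \<sigma> e (\<delta> c)) b = \<delta> c b"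
    using contraction_ex by blast
  from contraction_Suc[OF this] obtain \<sigma>' e' where *: "raises (Suc k) \<sigma>' e'"
    "\<And>c b. b \<in> X (Suc k) \<Longrightarrow> H \<sigma>' e' (\<delta> c) b = c b - \<delta> (H \<sigma> e c) b" by blast
  have "\<delta> (H \<sigma> e c) b = c b" if b: "b \<in> X (Suc k)" for b
  proof -
    have "\<delta> c (\<sigma>' b) = 0" using c(2) *(1) b unfolding raises_def by blast
    then show ?thesis using *(2)[OF b, of c] by (simp add: H_def)
  qed
  then show ?thesis using H_coch[OF r c(1) S] by blast
qed

end

end


section \<open>Local nilpotence\<close>

locale locally_finite_gmodule = poly_gmodule p n w M
  for p n w and M :: "(rat_mpoly, 'm) gmodule" +
  assumes lf: "locally_finite (graded_poly_ring p n w) M"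
begin

lemma gpart_unique_degree:
  assumes "m \<in> gpart M i" "m \<in> gpart M j" "i \<noteq> j"
  shows "m = \<zero>\<^bsub>M\<^esub>"
proof -
  have m: "m \<in> carrier M" using M.gpart_sub assms by blast
  have "(\<lambda>k. if k = i then m else \<zero>\<^bsub>M\<^esub>) = (\<lambda>k. if k = j then m else \<zero>\<^bsub>M\<^esub>)"
    by (rule M.decomp_unique[where I = "{i}" and J = "{j}"])
      (use assms m in \<open>auto simp: M.gpart_zero\<close>)
  from fun_cong[OF this, of i] show ?thesis using assms(3) by simp
qed

lemma power_coincidence:
  assumes "r \<in> carrier R" "m \<in> gpart M i"
  obtains a b where "a < b" "r ^ a \<odot>\<^bsub>M\<^esub> m = r ^ b \<odot>\<^bsub>M\<^esub> m"
proof -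
  let ?N = "submodule_generated R M (gpart M i)"
  have fin: "finite ?N" using lf unfolding locally_finite_def by blast
  have "r ^ k \<in> carrier R" for k by (induction k) (auto simp: R_closed assms)
  then have "r ^ k \<odot>\<^bsub>M\<^esub> m \<in> ?N" for k
    using assms(2) unfolding submodule_generated_def submodule_def submodule_axioms_def by blast
  then have "finite (range (\<lambda>k. r ^ k \<odot>\<^bsub>M\<^esub> m))" using fin by (meson finite_subset image_subsetI)
  then have "\<not> inj (\<lambda>k. r ^ k \<odot>\<^bsub>M\<^esub> m)" using finite_imageD infinite_UNIV_nat by blast
  then obtain a b where "a \<noteq> b" "r ^ a \<odot>\<^bsub>M\<^esub> m = r ^ b \<odot>\<^bsub>M\<^esub> m" unfolding inj_def by blast
  then show ?thesis using that by (cases a b rule: linorder_cases) auto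
qed

text \<open>The constant polynomial with value \<open>q\<close>.\<close>

definition const :: "rat \<Rightarrow> rat_mpoly"
  where "const q = single 0 q"

lemma const_hpart: "q \<in> Zp \<Longrightarrow> const q \<in> hpart R 0"
  unfolding R_hpart_weight R_carrier const_def
  by (auto simp: lookup_single when_def Zp_simps weight_def in_keys_iff split: if_splits)

lemma const_mult: "const q * const r = const (q * r)" by (simp add: const_def mult_single)

lemma const_power: "const q ^ k = const (q ^ k)"
  by (induction k) (simp_all add: const_mult, simp add: const_def)

lemma emb_const: "emb (const q) = single 0 q"
  by (simp add: const_def emb_single int_exponent_0)

lemma p_in_Zp: "of_nat p \<in> Zp" using Zp_simps(3)[of "int p"] by simp

lemma nilpotent_p:
  assumes m: "m \<in> gpart M i" shows "\<exists>e. const (of_nat p) ^ e \<odot>\<^bsub>M\<^esub> m = \<zero>\<^bsub>M\<^esub>"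
proof -
  let ?r = "const (of_nat p)"
  have mc: "m \<in> carrier M" by (rule M.gpart_sub[OF m])
  have r: "?r \<in> carrier R" by (rule R_hpart_carrier[OF const_hpart[OF p_in_Zp]])
  have rk: "?r ^ k \<in> carrier R" for k by (induction k) (auto simp: R_closed r)
  obtain a b where ab: "a < b" "?r ^ a \<odot>\<^bsub>M\<^esub> m = ?r ^ b \<odot>\<^bsub>M\<^esub> m"
    by (rule power_coincidence[OF r m])
  define c where "c = b - a"
  have c: "0 < c" "b = a + c" using ab by (auto simp: c_def)
  \<comment> \<open>\<open>1 - p\<^sup>c\<close> is a unit of the localized integers\<close>
  have "int p dvd int p ^ c" using c(1) by simp
  moreover have "\<not> int p dvd 1" using p by (auto simp: prime_nat_iff)
  ultimately have "\<not> int p dvd (1 - int p ^ c)" by (metis dvd_diff_right_iff dvd_diff_commute)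
  then have u: "1 / (1 - of_nat p ^ c) \<in> Zp" using localized_ints_inverse[OF p, of "1 - int p ^ c"] by simp
  have ne: "(1 - of_nat p ^ c :: rat) \<noteq> 0"
    using c(1) p by (metis Zp_simps(1) \<open>\<not> int p dvd 1 - int p ^ c\<close> diff_eq_diff_eq dvd_0_right eq_iff_diff_eq_0
        of_int_1 of_int_eq_iff of_int_of_nat_eq of_int_power)
  let ?u = "const (1 / (1 - of_nat p ^ c))"
  have uR: "?u \<in> carrier R" by (rule R_hpart_carrier[OF const_hpart[OF u]])
  have "?u * (?r ^ a - ?r ^ b) = const ((1 / (1 - of_nat p ^ c)) * (of_nat p ^ a - of_nat p ^ b))"
    by (simp add: const_power const_mult right_diff_distrib) (simp add: const_def single_diff)
  also have "(1 / (1 - of_nat p ^ c)) * (of_nat p ^ a - of_nat p ^ b) = (of_nat p ^ a :: rat)"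
    using ne unfolding c(2) by (simp add: power_add field_simps)
  finally have ur: "?u * (?r ^ a - ?r ^ b) = ?r ^ a" by (simp add: const_power)
  have dR: "?r ^ a - ?r ^ b \<in> carrier R" using rk by (intro R_closed)
  have "?r ^ a \<odot>\<^bsub>M\<^esub> m = (?r ^ a - ?r ^ b) \<odot>\<^bsub>M\<^esub> m \<oplus>\<^bsub>M\<^esub> ?r ^ b \<odot>\<^bsub>M\<^esub> m"
    using M.smult_l_distr[OF dR rk[of b] mc] by simp
  then have "(?r ^ a - ?r ^ b) \<odot>\<^bsub>M\<^esub> m = \<zero>\<^bsub>M\<^esub>"
    using ab(2) M.smult_closed[OF dR mc] M.smult_closed[OF rk mc] by (simp add: M.M.add.r_cancel_one')
  then have "?r ^ a \<odot>\<^bsub>M\<^esub> m = \<zero>\<^bsub>M\<^esub>"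
    using M.smult_assoc1[OF uR dR mc] ur M.smult_r_null[OF uR] by simp
  then show ?thesis by blast
qed

lemma nilpotent_positive_degree:
  assumes "r \<in> hpart R d" "d \<noteq> 0" and m: "m \<in> gpart M i"
  shows "\<exists>e. r ^ e \<odot>\<^bsub>M\<^esub> m = \<zero>\<^bsub>M\<^esub>"
proof -
  obtain a b where ab: "a < b" "r ^ a \<odot>\<^bsub>M\<^esub> m = r ^ b \<odot>\<^bsub>M\<^esub> m"
    by (rule power_coincidence[OF R_hpart_carrier[OF assms(1)] m])
  have "r ^ k \<odot>\<^bsub>M\<^esub> m \<in> gpart M (int k * d + i)" for k
    by (rule M.gpart_smult[OF R_power[OF assms(1)] m])
  from gpart_unique_degree[OF this[of a] this[of b, folded ab(2)]] show ?thesis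
    using ab(1) assms(2) by auto
qed

text \<open>The \<open>j\<close>-th variable, where the variable of index \<open>0\<close> is the prime \<open>p\<close>, and its inverse.\<close>

definition var :: "nat \<Rightarrow> rat_mpoly"
  where "var j = (if j = 0 then const (of_nat p) else single (single j 1) 1)"

definition var_deg :: "nat \<Rightarrow> int"
  where "var_deg j = (if j = 0 then 0 else int (w j))"

definition var_inv_exponent :: "nat \<Rightarrow> nat \<Rightarrow> int"
  where "var_inv_exponent j = (if j = 0 then 0 else (\<lambda>i. if i = j then - 1 else 0))"

definition var_inv_coeff :: "nat \<Rightarrow> rat"
  where "var_inv_coeff j = (if j = 0 then 1 / of_nat p else 1)"

definition var_inv :: "nat \<Rightarrow> laurent"
  where "var_inv j = single (var_inv_exponent j) (var_inv_coeff j)"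

lemma var_hpart: "j \<le> n \<Longrightarrow> var j \<in> hpart R (var_deg j)"
  using const_hpart[OF p_in_Zp] unfolding var_def var_deg_def
  by (auto simp: R_hpart_weight R_carrier lookup_single when_def Zp_simps weight_def in_keys_iff split: if_splits)

lemma var_nilpotent:
  assumes "j \<le> n" "m \<in> gpart M i" shows "\<exists>e. var j ^ e \<odot>\<^bsub>M\<^esub> m = \<zero>\<^bsub>M\<^esub>"
proof (cases "j = 0")
  case True then show ?thesis using nilpotent_p[OF assms(2)] by (simp add: var_def)
next
  case False
  then have "var_deg j \<noteq> 0" using w[of j] assms(1) by (simp add: var_deg_def)
  then show ?thesis using nilpotent_positive_degree[OF var_hpart[OF assms(1)] _ assms(2)] by blast
qed

lemma var_inv: "emb (var j) * var_inv j = 1"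
proof (cases "j = 0")
  case True
  then show ?thesis using p
    by (simp add: var_def var_inv_def var_inv_exponent_def var_inv_coeff_def emb_const mult_single prime_gt_0_nat
        del: single_of_nat)
next
  case False
  then have "int_exponent (single j 1) + var_inv_exponent j = 0"
    by (auto simp: var_inv_exponent_def int_exponent_def lookup_single when_def fun_eq_iff)
  then show ?thesis using False
    by (simp add: var_def var_inv_def var_inv_coeff_def emb_single mult_single)
qed

lemma var_inv_homog:
  assumes "j \<le> n" shows "var_inv j \<in> homog (- var_deg j)"
proof -
  have "deg (var_inv_exponent j) = - var_deg j"
  proof (cases "j = 0")
    case False
    then have "deg (var_inv_exponent j) = (\<Sum>i\<in>{1..n}. if i = j then - int (w i) else 0)"
      unfolding deg_def var_inv_exponent_def by (intro sum.cong) auto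
    also have "\<dots> = - var_deg j" using False assms by (simp add: sum.delta var_deg_def)
    finally show ?thesis .
  qed (simp add: deg_def var_inv_exponent_def var_deg_def)
  then show ?thesis unfolding var_inv_def using homog_single by metis
qed

lemma integral_at_var_inv:
  assumes "i \<noteq> j" "integral_at i \<mu> q"
  shows "i \<noteq> 0 \<or> j \<noteq> 0 \<Longrightarrow> integral_at i (var_inv_exponent j + \<mu>) (var_inv_coeff j * q)"
  using assms unfolding integral_at_def var_inv_exponent_def var_inv_coeff_def by (auto split: if_splits)

text \<open>The denominators of the quotients \<open>Q\<^sub>j\<close> and \<open>Q\<^sub>j[1/x\<^sub>j]\<close>. The intersection of \<open>A j\<close> and \<open>B' j\<close> is
  \<open>B j\<close>, and \<open>B (Suc j)\<close> is the sum of \<open>A j\<close> and \<open>B' j\<close> (\<open>B_Suc_split\<close>), so that \<open>Q\<^sub>j\<close> embeds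
  into \<open>Q\<^sub>j[1/x\<^sub>j]\<close> with cokernel \<open>Q\<^sub>j\<^sub>+\<^sub>1\<close>.\<close>

abbreviation B :: "nat \<Rightarrow> (nat \<Rightarrow> int) \<Rightarrow> rat set"
  where "B j \<equiv> (\<lambda>\<mu>. A j \<mu> \<inter> N j \<mu>)"

abbreviation B' :: "nat \<Rightarrow> (nat \<Rightarrow> int) \<Rightarrow> rat set"
  where "B' j \<equiv> (\<lambda>\<mu>. A (Suc j) \<mu> \<inter> N j \<mu>)"

lemma A_var_inv:
  assumes j: "j \<le> n" and q: "q \<in> A (Suc j) \<mu>"
  shows "var_inv_coeff j * q \<in> A (Suc j) (var_inv_exponent j + \<mu>)"
proof (rule A_memI)
  assume "var_inv_coeff j * q \<noteq> 0"
  then have "q \<noteq> 0" by auto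
  then show "\<forall>i. i \<notin> {1..n} \<longrightarrow> (var_inv_exponent j + \<mu>) i = 0"
    using A_outside[OF q] j by (auto simp: var_inv_exponent_def)
next
  fix i assume "var_inv_coeff j * q \<noteq> 0" and i: "i \<in> {Suc j..n}"
  then have "q \<noteq> 0" by auto
  then show "integral_at i (var_inv_exponent j + \<mu>) (var_inv_coeff j * q)"
    using A_integral[OF q _ i] i by (intro integral_at_var_inv) auto
qed

lemma N_var_inv:
  assumes q: "q \<in> N j \<mu>"
  shows "var_inv_coeff j * q \<in> N j (var_inv_exponent j + \<mu>)"
proof (cases "q = 0")
  case False
  then obtain i where i: "i < j" "integral_at i \<mu> q" using q unfolding N_def by auto
  have "integral_at i (var_inv_exponent j + \<mu>) (var_inv_coeff j * q)"
    by (rule integral_at_var_inv) (use i in auto)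
  then show ?thesis using i(1) unfolding N_def by blast
qed (simp add: N_0)

lemma A_var_inv_mult: "j \<le> n \<Longrightarrow> a \<in> laurent_in (A (Suc j)) \<Longrightarrow> var_inv j * a \<in> laurent_in (A (Suc j))"
  unfolding var_inv_def by (rule laurent_in_single_mult) (auto intro: A_var_inv)

lemma B'_var_inv_mult: "j \<le> n \<Longrightarrow> a \<in> laurent_in (B' j) \<Longrightarrow> var_inv j * a \<in> laurent_in (B' j)"
  unfolding var_inv_def by (rule laurent_in_single_mult) (use A_var_inv N_var_inv in auto)

lemma A_mono: "A j \<mu> \<subseteq> A (Suc j) \<mu>"
  unfolding A_def by auto

lemma N_mono: "N j \<mu> \<subseteq> N (Suc j) \<mu>"
  unfolding N_def using less_SucI by blast

lemma A_sub_N: "j \<le> n \<Longrightarrow> A j \<mu> \<subseteq> N (Suc j) \<mu>"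
  unfolding N_def using A_integral[of _ j \<mu> j] by fastforce

lemma B_Suc_cases:
  assumes "q \<in> B (Suc j) \<mu>" shows "q \<in> A j \<mu> \<or> q \<in> B' j \<mu>"
proof (cases "q = 0")
  case False
  have q: "q \<in> A (Suc j) \<mu>" using assms by blast
  obtain i where i: "i < Suc j" "integral_at i \<mu> q" using assms False unfolding N_def by auto
  show ?thesis
  proof (cases "i = j")
    case True
    have "q \<in> A j \<mu>"
    proof (rule A_memI)
      show "\<forall>i. i \<notin> {1..n} \<longrightarrow> \<mu> i = 0" using A_outside[OF q False] by blast
      fix k assume k: "k \<in> {j..n}"
      show "integral_at k \<mu> q"
      proof (cases "k = j")
        case True then show ?thesis using i \<open>i = j\<close> by simp
      next
        case False then show ?thesis using A_integral[OF q \<open>q \<noteq> 0\<close>] k by auto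
      qed
    qed
    then show ?thesis ..
  next
    case False
    then have "q \<in> N j \<mu>" using i unfolding N_def by auto
    then show ?thesis using q by blast
  qed
qed (simp add: A_0)

lemma B_Suc_split:
  assumes "a \<in> laurent_in (B (Suc j))"
  obtains a1 a2 where "a = a1 + a2" "a1 \<in> laurent_in (A j)" "a2 \<in> laurent_in (B' j)"
    "keys a1 \<subseteq> keys a" "keys a2 \<subseteq> keys a"
proof -
  define a1 where "a1 = (\<Sum>\<mu>\<in>{\<mu> \<in> keys a. lookup a \<mu> \<in> A j \<mu>}.
     single \<mu> (lookup a \<mu>))"
  have l1: "lookup a1 \<mu> = (if lookup a \<mu> \<in> A j \<mu> then lookup a \<mu> else 0)" for \<mu>
    by (simp add: a1_def lookup_sum lookup_single when_def in_keys_iff)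
  define a2 where "a2 = a - a1"
  have l2: "lookup a2 \<mu> = (if lookup a \<mu> \<in> A j \<mu> then 0 else lookup a \<mu>)" for \<mu>
    by (simp add: a2_def lookup_minus l1)
  show ?thesis
  proof (rule that)
    show "a = a1 + a2" by (simp add: a2_def)
    show "a1 \<in> laurent_in (A j)" by (simp add: laurent_in_def l1 A_0)
    show "a2 \<in> laurent_in (B' j)"
      using assms B_Suc_cases unfolding laurent_in_def by (auto simp: l2 A_0 N_0)
  qed (auto simp: in_keys_iff l1 l2 split: if_splits)
qed


section \<open>Dimension shifting\<close>

text \<open>The cocycles and coboundaries with values in the quotient \<open>Q\<^sub>j\<close> of \<open>laurent_in (A j)\<close> by
  \<open>laurent_in (B j)\<close>, lifted to cochains with values in \<open>laurent_in (A j)\<close>. In degree \<open>0\<close> the only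
  coboundary is zero, which lifts to the cochains with values in \<open>laurent_in (B j)\<close>.\<close>

definition coc :: "nat \<Rightarrow> int \<Rightarrow> nat \<Rightarrow> ((rat_mpoly, 'm) gen \<Rightarrow> laurent) set"
  where "coc s t j = {c \<in> coch s t (A j). \<delta> c \<in> coch (Suc s) t (B j)}"

primrec cob :: "nat \<Rightarrow> int \<Rightarrow> nat \<Rightarrow> ((rat_mpoly, 'm) gen \<Rightarrow> laurent) set"
  where
    "cob 0 t j = coch 0 t (B j)"
  | "cob (Suc s) t j = {c. \<exists>h\<in>coch s t (A j). (\<lambda>b. c b - \<delta> h b) \<in> coch (Suc s) t (B j)}"

text \<open>The connecting isomorphism for \<open>0 \<rightarrow> Q\<^sub>j \<rightarrow> Q\<^sub>j[1/x\<^sub>j] \<rightarrow> Q\<^sub>j\<^sub>+\<^sub>1 \<rightarrow> 0\<close>, as a relation between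
  cocycles: the cocycle \<open>c\<close> with values in \<open>Q\<^sub>j\<close> is the coboundary of \<open>h\<close> in the middle term.\<close>

definition conn :: "nat \<Rightarrow> nat \<Rightarrow> int \<Rightarrow> ((rat_mpoly, 'm) gen \<Rightarrow> laurent) \<Rightarrow>
    ((rat_mpoly, 'm) gen \<Rightarrow> laurent) \<Rightarrow> bool"
  where "conn j s t c h \<longleftrightarrow> c \<in> coc (Suc s) t j \<and> h \<in> coc s t (Suc j) \<and>
    (\<lambda>b. c b - \<delta> h b) \<in> coch (Suc s) t (B' j)"

lemma coch_A_mono: "c \<in> coch s t (A j) \<Longrightarrow> c \<in> coch s t (A (Suc j))"
  using coch_mono[of "A j" "A (Suc j)"] A_mono by blast

lemma coch_B_B': "c \<in> coch s t (B j) \<Longrightarrow> c \<in> coch s t (B' j)"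
  using coch_mono[of "B j" "B' j"] A_mono by blast

lemma coch_A_B': "c \<in> coch s t (A j) \<Longrightarrow> c \<in> coch s t (B' j) \<Longrightarrow> c \<in> coch s t (B j)"
  unfolding coch_Int by blast

lemma coch_B'_B: "c \<in> coch s t (B' j) \<Longrightarrow> c \<in> coch s t (B (Suc j))"
  using coch_mono[of "B' j" "B (Suc j)"] N_mono by blast

lemma coch_A_B: "j \<le> n \<Longrightarrow> c \<in> coch s t (A j) \<Longrightarrow> c \<in> coch s t (B (Suc j))"
  using coch_mono[of "A j" "B (Suc j)"] A_mono A_sub_N by blast

lemma coch_B'_A: "c \<in> coch s t (B' j) \<Longrightarrow> c \<in> coch s t (A (Suc j))"
  unfolding coch_Int by blast

lemma coch_zero: "coeff_subgroups S \<Longrightarrow> (\<lambda>b. 0) \<in> coch s t S"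
  by (rule cochI) (auto simp: laurent_in_0 homog_0)

lemma coch_B_split:
  assumes "c \<in> coch s t (B (Suc j))"
  shows "\<exists>f\<in>coch s t (A j). \<exists>g\<in>coch s t (B' j). \<forall>b\<in>X s. c b = f b + g b"
proof -
  have "\<forall>b\<in>X s. \<exists>a. a \<in> laurent_in (A j) \<and> c b - a \<in> laurent_in (B' j) \<and>
     a \<in> homog (gen_deg b - t) \<and> c b - a \<in> homog (gen_deg b - t)"
  proof
    fix b assume b: "b \<in> X s"
    obtain a1 a2 where a: "c b = a1 + a2" "a1 \<in> laurent_in (A j)" "a2 \<in> laurent_in (B' j)"
      "keys a1 \<subseteq> keys (c b)" "keys a2 \<subseteq> keys (c b)"
      by (rule B_Suc_split[OF cochD(1)[OF assms b]])
    have "a1 \<in> homog (gen_deg b - t)" "a2 \<in> homog (gen_deg b - t)"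
      using cochD(2)[OF assms b] a(4,5) unfolding homog_iff by blast+
    moreover have "c b - a1 = a2" using a(1) by simp
    ultimately show "\<exists>a. a \<in> laurent_in (A j) \<and> c b - a \<in> laurent_in (B' j) \<and>
       a \<in> homog (gen_deg b - t) \<and> c b - a \<in> homog (gen_deg b - t)"
      using a(2,3) by (intro exI[of _ a1]) simp
  qed
  from bchoice[OF this] obtain f where f: "\<And>b. b \<in> X s \<Longrightarrow> f b \<in> laurent_in (A j) \<and>
     c b - f b \<in> laurent_in (B' j) \<and> f b \<in> homog (gen_deg b - t) \<and> c b - f b \<in> homog (gen_deg b - t)"
    by blast
  have "f \<in> coch s t (A j)" "(\<lambda>b. c b - f b) \<in> coch s t (B' j)" using f by (auto intro: cochI)
  moreover have "\<forall>b\<in>X s. c b = f b + (c b - f b)" by simp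
  ultimately show ?thesis by (intro bexI)
qed

lemma var_inv_vanishing_0:
  assumes "j \<le> n" "\<And>b. b \<in> X (Suc 0) \<Longrightarrow> \<delta> c b = 0" "b \<in> X 0"
  shows "c b = 0"
  by (rule cocycle_0_eq_0[OF var_hpart[OF assms(1)] var_inv var_inv_homog[OF assms(1)]
        var_nilpotent[OF assms(1)] assms(2,3)])

lemma var_inv_vanishing_Suc:
  assumes "j \<le> n" "c \<in> coch (Suc k) t S" "\<And>b. b \<in> X (Suc (Suc k)) \<Longrightarrow> \<delta> c b = 0"
    and "\<And>a. a \<in> laurent_in S \<Longrightarrow> var_inv j * a \<in> laurent_in S"
  shows "\<exists>h\<in>coch k t S. \<forall>b\<in>X (Suc k). \<delta> h b = c b"
  by (rule cocycle_Suc_is_coboundary[OF var_hpart[OF assms(1)] var_inv var_inv_homog[OF assms(1)]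
        var_nilpotent[OF assms(1)] assms(2,3,4)])

text \<open>The cohomology with values in \<open>Q\<^sub>j[1/x\<^sub>j]\<close> vanishes, because it does so for both
  \<open>laurent_in (A (Suc j))\<close> and \<open>laurent_in (B' j)\<close>.\<close>

lemma relative_vanishing:
  assumes j: "j \<le> n" and f: "f \<in> coch s t (A (Suc j))" "\<delta> f \<in> coch (Suc s) t (B' j)"
  shows "\<exists>g\<in>coch s t (B' j). (s = 0 \<longrightarrow> (\<forall>b\<in>X s. f b = g b)) \<and>
    (\<forall>k. s = Suc k \<longrightarrow> (\<exists>h\<in>coch k t (A (Suc j)). \<forall>b\<in>X s. f b = g b + \<delta> h b))"
proof -
  obtain g where g: "g \<in> coch s t (B' j)" "\<And>b. b \<in> X (Suc s) \<Longrightarrow> \<delta> g b = \<delta> f b"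
  proof -
    have "\<exists>g\<in>coch s t (B' j). \<forall>b\<in>X (Suc s). \<delta> g b = \<delta> f b"
      by (rule var_inv_vanishing_Suc[OF j f(2)]) (auto intro: \<delta>_\<delta> B'_var_inv_mult[OF j])
    then show ?thesis using that by blast
  qed
  let ?e = "\<lambda>b. f b - g b"
  have z: "\<delta> ?e b = 0" if "b \<in> X (Suc s)" for b using g(2)[OF that] by (simp add: \<delta>_diff)
  have e: "?e \<in> coch s t (A (Suc j))" by (rule coch_diff[OF A_coeffs f(1) coch_B'_A[OF g(1)]])
  show ?thesis
  proof (rule bexI[OF _ g(1)], intro conjI allI impI ballI)
    fix b assume "s = 0" "b \<in> X s"
    then show "f b = g b" using var_inv_vanishing_0[OF j, of ?e b] z by simp
  next
    fix k assume s: "s = Suc k"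
    have "\<exists>h\<in>coch k t (A (Suc j)). \<forall>b\<in>X (Suc k). \<delta> h b = ?e b"
      by (rule var_inv_vanishing_Suc[OF j e[unfolded s]]) (use z s A_var_inv_mult[OF j] in blast)+
    then obtain h where "h \<in> coch k t (A (Suc j))" "\<And>b. b \<in> X (Suc k) \<Longrightarrow> \<delta> h b = ?e b" by blast
    then show "\<exists>h\<in>coch k t (A (Suc j)). \<forall>b\<in>X s. f b = g b + \<delta> h b" by (intro bexI[of _ h]) (auto simp: s)
  qed
qed

lemma conn_total:
  assumes j: "j \<le> n" and c: "c \<in> coc (Suc s) t j"
  shows "\<exists>h. conn j s t c h"
proof -
  have c': "c \<in> coch (Suc s) t (A j)" "\<delta> c \<in> coch (Suc (Suc s)) t (B j)" using c unfolding coc_def by auto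
  obtain g h where gh: "g \<in> coch (Suc s) t (B' j)" "h \<in> coch s t (A (Suc j))"
      "\<And>b. b \<in> X (Suc s) \<Longrightarrow> c b = g b + \<delta> h b"
    using relative_vanishing[OF j coch_A_mono[OF c'(1)] coch_B_B'[OF c'(2)]] by blast
  have d: "(\<lambda>b. c b - \<delta> h b) \<in> coch (Suc s) t (B' j)"
    using gh(1) coch_cong[of "Suc s" "\<lambda>b. c b - \<delta> h b" g] gh(3) by simp
  have "(\<lambda>b. c b - g b) \<in> coch (Suc s) t (B (Suc j))"
    by (rule coch_diff[OF AN_coeffs coch_A_B[OF j c'(1)] coch_B'_B[OF gh(1)]])
  then have "\<delta> h \<in> coch (Suc s) t (B (Suc j))"
    using coch_cong[of "Suc s" "\<lambda>b. c b - g b" "\<delta> h"] gh(3) by simp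
  then show ?thesis using c d gh(2) unfolding conn_def coc_def by blast
qed

lemma conn_surj:
  assumes j: "j \<le> n" and h: "h \<in> coc s t (Suc j)"
  shows "\<exists>c. conn j s t c h"
proof -
  have h': "h \<in> coch s t (A (Suc j))" "\<delta> h \<in> coch (Suc s) t (B (Suc j))" using h unfolding coc_def by auto
  obtain f g where fg: "f \<in> coch (Suc s) t (A j)" "g \<in> coch (Suc s) t (B' j)"
      "\<And>b. b \<in> X (Suc s) \<Longrightarrow> \<delta> h b = f b + g b"
    using coch_B_split[OF h'(2)] by blast
  have "(\<lambda>b. 0 - g b) \<in> coch (Suc s) t (B' j)"
    by (rule coch_diff[OF AN_coeffs coch_zero[OF AN_coeffs] fg(2)])
  then have d: "(\<lambda>b. f b - \<delta> h b) \<in> coch (Suc s) t (B' j)"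
    using coch_cong[of "Suc s" "\<lambda>b. f b - \<delta> h b" "\<lambda>b. 0 - g b"] fg(3) by simp
  have "\<delta> (\<lambda>b. 0 - g b) \<in> coch (Suc (Suc s)) t (B' j)"
    by (rule \<delta>_coch[OF AN_coeffs AN_stable]) fact
  moreover have "\<delta> f b = \<delta> (\<lambda>b. 0 - g b) b" if b: "b \<in> X (Suc (Suc s))" for b
  proof -
    have "\<delta> f b = \<delta> (\<lambda>b. \<delta> h b - g b) b" by (rule \<delta>_cong[OF b]) (use fg(3) in simp)
    then show ?thesis using \<delta>_\<delta>[OF b, of h] by (simp add: \<delta>_diff \<delta>_def[of "\<lambda>b. 0"] del: diff_0)
  qed
  ultimately have "\<delta> f \<in> coch (Suc (Suc s)) t (B' j)" using coch_cong by blast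
  then have "\<delta> f \<in> coch (Suc (Suc s)) t (B j)"
    using coch_A_B' \<delta>_coch[OF A_coeffs A_stable fg(1)] by blast
  then show ?thesis using fg(1) d h unfolding conn_def coc_def by blast
qed

lemma conn_cob:
  assumes j: "j \<le> n" and conn: "conn j s t c h"
  shows "c \<in> cob (Suc s) t j \<longleftrightarrow> h \<in> cob s t (Suc j)"
proof
  have c: "c \<in> coch (Suc s) t (A j)" and h: "h \<in> coch s t (A (Suc j))"
    and ch: "(\<lambda>b. c b - \<delta> h b) \<in> coch (Suc s) t (B' j)"
    using conn unfolding conn_def coc_def by auto
  {
    assume "c \<in> cob (Suc s) t j"
    then obtain a where a: "a \<in> coch s t (A j)" "(\<lambda>b. c b - \<delta> a b) \<in> coch (Suc s) t (B j)" by auto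
    let ?f = "\<lambda>b. h b - a b"
    have f: "?f \<in> coch s t (A (Suc j))" by (rule coch_diff[OF A_coeffs h coch_A_mono[OF a(1)]])
    have "(\<lambda>b. (c b - \<delta> a b) - (c b - \<delta> h b)) \<in> coch (Suc s) t (B' j)"
      by (rule coch_diff[OF AN_coeffs coch_B_B'[OF a(2)] ch])
    then have "\<delta> ?f \<in> coch (Suc s) t (B' j)" by (simp add: \<delta>_diff)
    from relative_vanishing[OF j f this] obtain g where g: "g \<in> coch s t (B' j)"
      "s = 0 \<longrightarrow> (\<forall>b\<in>X s. ?f b = g b)"
      "\<forall>k. s = Suc k \<longrightarrow> (\<exists>h\<in>coch k t (A (Suc j)). \<forall>b\<in>X s. ?f b = g b + \<delta> h b)" by blast
    have ga: "(\<lambda>b. g b + a b) \<in> coch s t (B (Suc j))"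
      by (rule coch_add[OF AN_coeffs coch_B'_B[OF g(1)] coch_A_B[OF j a(1)]])
    show "h \<in> cob s t (Suc j)"
    proof (cases s)
      case 0
      have "h b = g b + a b" if "b \<in> X s" for b using g(2) 0 that by (simp add: algebra_simps)
      then show ?thesis using ga coch_cong[of s h "\<lambda>b. g b + a b"] 0 by simp
    next
      case (Suc k)
      then obtain e where e: "e \<in> coch k t (A (Suc j))" "\<And>b. b \<in> X s \<Longrightarrow> ?f b = g b + \<delta> e b"
        using g(3) by blast
      have "h b - \<delta> e b = g b + a b" if "b \<in> X s" for b using e(2)[OF that] by (simp add: algebra_simps)
      then show ?thesis using ga e(1) coch_cong[of s "\<lambda>b. h b - \<delta> e b" "\<lambda>b. g b + a b"] Suc by auto
    qed
  next
    assume hc: "h \<in> cob s t (Suc j)"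
    obtain z where z: "z \<in> coch s t (B (Suc j))" "\<And>b. b \<in> X (Suc s) \<Longrightarrow> \<delta> h b = \<delta> z b"
    proof (cases s)
      case 0 then show ?thesis using hc that[of h] by simp
    next
      case (Suc k)
      then obtain e where e: "e \<in> coch k t (A (Suc j))" "(\<lambda>b. h b - \<delta> e b) \<in> coch s t (B (Suc j))"
        using hc by auto
      show ?thesis by (rule that[OF e(2)]) (simp add: \<delta>_diff \<delta>_\<delta> Suc)
    qed
    obtain f g where fg: "f \<in> coch s t (A j)" "g \<in> coch s t (B' j)" "\<And>b. b \<in> X s \<Longrightarrow> z b = f b + g b"
      using coch_B_split[OF z(1)] by blast
    have \<delta>z: "\<delta> h b = \<delta> f b + \<delta> g b" if b: "b \<in> X (Suc s)" for b
      using z(2)[OF b] \<delta>_cong[OF b fg(3)] by (simp add: \<delta>_add)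
    have "(\<lambda>b. (c b - \<delta> h b) + \<delta> g b) \<in> coch (Suc s) t (B' j)"
      by (rule coch_add[OF AN_coeffs ch \<delta>_coch[OF AN_coeffs AN_stable fg(2)]])
    then have "(\<lambda>b. c b - \<delta> f b) \<in> coch (Suc s) t (B' j)"
      using coch_cong[of "Suc s" "\<lambda>b. (c b - \<delta> h b) + \<delta> g b" "\<lambda>b. c b - \<delta> f b"] \<delta>z by simp
    moreover have "(\<lambda>b. c b - \<delta> f b) \<in> coch (Suc s) t (A j)"
      by (rule coch_diff[OF A_coeffs c \<delta>_coch[OF A_coeffs A_stable fg(1)]])
    ultimately have "(\<lambda>b. c b - \<delta> f b) \<in> coch (Suc s) t (B j)" by (intro coch_A_B')
    then show "c \<in> cob (Suc s) t j" using fg(1) by auto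
  }
qed

lemma coc_add: "c \<in> coc s t j \<Longrightarrow> c' \<in> coc s t j \<Longrightarrow> (\<lambda>b. c b + c' b) \<in> coc s t j"
  unfolding coc_def using coch_add[OF A_coeffs] coch_add[OF AN_coeffs] by (simp add: \<delta>_add)

lemma coc_mult: "c \<in> coc s t j \<Longrightarrow> r \<in> hpart R d \<Longrightarrow> (\<lambda>b. emb r * c b) \<in> coc s (t - d) j"
  unfolding coc_def using coch_mult[OF A_coeffs A_stable] coch_mult[OF AN_coeffs AN_stable]
  by (simp add: \<delta>_mult)

lemma conn_add:
  assumes "conn j s t c h" "conn j s t c' h'"
  shows "conn j s t (\<lambda>b. c b + c' b) (\<lambda>b. h b + h' b)"
proof -
  have "(\<lambda>b. (c b - \<delta> h b) + (c' b - \<delta> h' b)) \<in> coch (Suc s) t (B' j)"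
    by (rule coch_add[OF AN_coeffs]) (use assms in \<open>auto simp: conn_def\<close>)
  then show ?thesis using assms coc_add unfolding conn_def by (simp add: \<delta>_add algebra_simps)
qed

lemma conn_mult:
  assumes "conn j s t c h" "r \<in> hpart R d"
  shows "conn j s (t - d) (\<lambda>b. emb r * c b) (\<lambda>b. emb r * h b)"
proof -
  have "(\<lambda>b. emb r * (c b - \<delta> h b)) \<in> coch (Suc s) (t - d) (B' j)"
    by (rule coch_mult[OF AN_coeffs AN_stable _ assms(2)]) (use assms in \<open>auto simp: conn_def\<close>)
  then show ?thesis using assms coc_mult unfolding conn_def by (simp add: \<delta>_mult right_diff_distrib)
qed

text \<open>The composite of the first \<open>j\<close> connecting isomorphisms.\<close>

primrec shift :: "nat \<Rightarrow> nat \<Rightarrow> int \<Rightarrow> ((rat_mpoly, 'm) gen \<Rightarrow> laurent) \<Rightarrow>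
    ((rat_mpoly, 'm) gen \<Rightarrow> laurent) \<Rightarrow> bool"
  where
    "shift s 0 t c h \<longleftrightarrow> c \<in> coc s t 0 \<and> h = c"
  | "shift s (Suc j) t c h \<longleftrightarrow> (\<exists>g. shift s j t c g \<and> conn j (s - Suc j) t g h)"

lemma shift_coc: "j \<le> s \<Longrightarrow> shift s j t c h \<Longrightarrow> c \<in> coc s t 0 \<and> h \<in> coc (s - j) t j"
  by (induction j arbitrary: h) (auto simp: conn_def)

lemma shift_total:
  "j \<le> s \<Longrightarrow> j \<le> Suc n \<Longrightarrow> c \<in> coc s t 0 \<Longrightarrow> \<exists>h. shift s j t c h"
proof (induction j)
  case (Suc j)
  then obtain g where g: "shift s j t c g" by auto
  have "g \<in> coc (Suc (s - Suc j)) t j" using shift_coc[OF _ g] Suc.prems(1) by (simp add: Suc_diff_Suc)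
  then show ?case using conn_total[of j g "s - Suc j" t] g Suc.prems by auto
qed auto

lemma shift_surj:
  "j \<le> s \<Longrightarrow> j \<le> Suc n \<Longrightarrow> h \<in> coc (s - j) t j \<Longrightarrow> \<exists>c. shift s j t c h"
proof (induction j arbitrary: h)
  case (Suc j)
  have "j \<le> n" using Suc.prems by simp
  then obtain g where g: "conn j (s - Suc j) t g h" using conn_surj[OF _ Suc.prems(3)] by blast
  then have "g \<in> coc (s - j) t j" using Suc.prems(1) by (simp add: conn_def Suc_diff_Suc)
  then obtain c where "shift s j t c g" using Suc by force
  then show ?case using g by auto
qed auto

lemma shift_cob:
  "j \<le> s \<Longrightarrow> j \<le> Suc n \<Longrightarrow> shift s j t c h \<Longrightarrow> c \<in> cob s t 0 \<longleftrightarrow> h \<in> cob (s - j) t j"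
proof (induction j arbitrary: h)
  case (Suc j)
  then obtain g where g: "shift s j t c g" "conn j (s - Suc j) t g h" by auto
  have "g \<in> cob (Suc (s - Suc j)) t j \<longleftrightarrow> h \<in> cob (s - Suc j) t (Suc j)"
    using conn_cob[OF _ g(2)] Suc.prems by auto
  then show ?case using Suc.IH[OF _ _ g(1)] Suc.prems by (simp add: Suc_diff_Suc del: cob.simps)
qed simp

lemma shift_add: "shift s j t c h \<Longrightarrow> shift s j t c' h' \<Longrightarrow> shift s j t (\<lambda>b. c b + c' b) (\<lambda>b. h b + h' b)"
proof (induction j arbitrary: h h')
  case (Suc j) then show ?case using conn_add by (auto simp del: split_paired_Ex) blast
qed (auto simp: coc_add)

lemma shift_mult: "shift s j t c h \<Longrightarrow> r \<in> hpart R d \<Longrightarrow> shift s j (t - d) (\<lambda>b. emb r * c b) (\<lambda>b. emb r * h b)"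
proof (induction j arbitrary: h)
  case (Suc j) then show ?case using conn_mult by (auto simp del: split_paired_Ex) blast
qed (auto simp: coc_mult)

end


section \<open>The quotient of the Laurent polynomials after all variables are inverted\<close>

lemma (in weighted_poly_ring) finite_weight_le:
  "finite {m. keys m \<subseteq> {1..n} \<and> weight w m \<le> k}" (is "finite ?S")
proof -
  have "lookup m i \<le> k" if m: "m \<in> ?S" for m i
  proof (cases "i \<in> keys m")
    case True
    then have "0 < w i" using w m by auto
    then have "lookup m i \<le> w i * lookup m i" by simp
    also have "\<dots> \<le> weight w m"
      unfolding weight_def using True by (intro member_le_sum[where f = "\<lambda>i. w i * lookup m i"]) auto
    finally show ?thesis using m by simp
  qed (simp add: in_keys_iff)
  then have "lookup ` ?S \<subseteq> {f. \<forall>i. (i \<in> {1..n} \<longrightarrow> f i \<in> {..k}) \<and> (i \<notin> {1..n} \<longrightarrow> f i = 0)}"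
    by (auto simp: in_keys_iff subset_iff)
  moreover have "finite {f::nat \<Rightarrow> nat. \<forall>i. (i \<in> {1..n} \<longrightarrow> f i \<in> {..k}) \<and> (i \<notin> {1..n} \<longrightarrow> f i = 0)}"
    by (rule finite_set_of_finite_funs) auto
  ultimately have "finite (lookup ` ?S)" by (rule finite_subset)
  then show ?thesis by (rule finite_imageD) (auto intro: inj_onI poly_mapping_eqI)
qed

context weighted_poly_ring
begin

lemma Zp_trans: "x - y \<in> Zp \<Longrightarrow> y - z \<in> Zp \<Longrightarrow> x - z \<in> Zp"
  using Zp_intros(1)[of "x - y" "y - z"] by simp

lemma Zp_commute: "x - y \<in> Zp \<Longrightarrow> y - x \<in> Zp"
  by (rule localized_ints_diff_commute[OF p])

lemma Zp_shift: "x - y \<in> Zp \<Longrightarrow> x \<in> Zp \<longleftrightarrow> y \<in> Zp"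
  using Zp_intros(1)[of "x - y" y] Zp_intros(4)[of x "x - y"] by auto

lemma Ints_Zp: "q \<in> \<int> \<Longrightarrow> q \<in> Zp"
  using Zp_simps(3) by (auto elim: Ints_cases)

text \<open>The sum of the degrees of the variables.\<close>

definition D :: int where "D = (\<Sum>i=1..n. int (w i))"

text \<open>The exponent \<open>(-1, \<dots>, -1)\<close>, the largest one that is negative in each variable.\<close>

definition socle :: "nat \<Rightarrow> int"
  where "socle = (\<lambda>i. if i \<in> {1..n} then - 1 else 0)"

text \<open>The coefficient at \<open>socle\<close>.\<close>

definition coef :: "laurent \<Rightarrow> rat"
  where "coef a = lookup a socle"

text \<open>The monomial with exponent \<open>m\<close>.\<close>

definition mon :: "(nat \<Rightarrow>\<^sub>0 nat) \<Rightarrow> rat_mpoly"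
  where "mon m = single m 1"

lemma coef_add: "coef (a + b) = coef a + coef b" by (simp add: coef_def lookup_add)
lemma coef_diff: "coef (a - b) = coef a - coef b" by (simp add: coef_def lookup_minus)

lemma deg_socle: "deg socle = - D"
  by (simp add: deg_def socle_def D_def sum_negf[symmetric])

lemma coef_homog: "a \<in> homog d \<Longrightarrow> d \<noteq> - D \<Longrightarrow> coef a = 0"
  using deg_socle unfolding homog_iff coef_def by (metis in_keys_iff)

lemma mon_hpart: "keys m \<subseteq> {1..n} \<Longrightarrow> mon m \<in> hpart R (int (weight w m))"
  unfolding R_hpart_weight R_carrier mon_def
  by (auto simp: lookup_single when_def Zp_simps split: if_splits)

lemma coef_single_mult:
  "coef (emb (single m r) * a) = r * lookup a (socle - int_exponent m)"
  by (simp add: coef_def emb_single lookup_single_mult)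

text \<open>A Laurent polynomial lies in \<open>laurent_in (N (Suc n))\<close> if and only if the terms with all
  exponents negative have coefficients in the localized integers.\<close>

lemma B_top_iff:
  assumes a: "a \<in> laurent_in (A (Suc n))"
  shows "a \<in> laurent_in (\<lambda>\<mu>. A (Suc n) \<mu> \<inter> N (Suc n) \<mu>) \<longleftrightarrow>
    (\<forall>m. keys m \<subseteq> {1..n} \<longrightarrow> coef (emb (mon m) * a) \<in> Zp)"
proof (intro iffI allI impI)
  fix m :: "nat \<Rightarrow>\<^sub>0 nat" assume a: "a \<in> laurent_in (\<lambda>\<mu>. A (Suc n) \<mu> \<inter> N (Suc n) \<mu>)"
    and m: "keys m \<subseteq> {1..n}"
  let ?\<mu> = "socle - int_exponent m"
  have "lookup a ?\<mu> \<in> N (Suc n) ?\<mu>" using a unfolding laurent_in_def by blast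
  moreover have "integral_at i ?\<mu> q \<longleftrightarrow> i = 0 \<and> q \<in> Zp" if "i < Suc n" for i q
    using that by (auto simp: integral_at_def socle_def int_exponent_def)
  ultimately have "lookup a ?\<mu> \<in> Zp" unfolding N_def using Zp_simps(1) by auto
  then show "coef (emb (mon m) * a) \<in> Zp" by (simp add: mon_def coef_single_mult)
next
  assume *: "\<forall>m. keys m \<subseteq> {1..n} \<longrightarrow> coef (emb (mon m) * a) \<in> Zp"
  have "lookup a \<mu> \<in> N (Suc n) \<mu>" for \<mu>
  proof (cases "lookup a \<mu> = 0 \<or> (\<exists>i\<in>{1..n}. 0 \<le> \<mu> i)")
    case True then show ?thesis
    proof
      assume "\<exists>i\<in>{1..n}. 0 \<le> \<mu> i"
      then obtain i where "i \<in> {1..n}" "0 \<le> \<mu> i" by blast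
      then have "i < Suc n" "integral_at i \<mu> (lookup a \<mu>)" by (auto simp: integral_at_def)
      then show ?thesis unfolding N_def by blast
    qed (simp add: N_0)
  next
    case False
    have "lookup a \<mu> \<in> A (Suc n) \<mu>" using a unfolding laurent_in_def by blast
    then have out: "\<mu> i = 0" if "i \<notin> {1..n}" for i using A_outside False that by blast
    let ?\<nu> = "socle - \<mu>"
    have sub: "{i. ?\<nu> i \<noteq> 0} \<subseteq> {1..n}" using out by (auto simp: socle_def)
    have nonneg: "0 \<le> ?\<nu> i" for i
      using False out by (cases "i \<in> {1..n}") (force simp: socle_def)+
    have "finite {i. ?\<nu> i \<noteq> 0}" by (rule finite_subset[OF sub]) simp
    then obtain m where m: "int_exponent m = ?\<nu>" "keys m = {i. ?\<nu> i \<noteq> 0}"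
      by (rule int_exponent_surj[OF nonneg])
    have "coef (emb (mon m) * a) \<in> Zp" using * m(2) sub by blast
    then have "integral_at 0 \<mu> (lookup a \<mu>)"
      by (simp add: mon_def coef_single_mult m(1) integral_at_def)
    then show ?thesis unfolding N_def by blast
  qed
  then show "a \<in> laurent_in (\<lambda>\<mu>. A (Suc n) \<mu> \<inter> N (Suc n) \<mu>)" using a unfolding laurent_in_def by blast
qed

lemma coef_B_top:
  assumes "a \<in> laurent_in (\<lambda>\<mu>. A (Suc n) \<mu> \<inter> N (Suc n) \<mu>)" shows "coef a \<in> Zp"
proof -
  have "a \<in> laurent_in (A (Suc n))" using assms unfolding laurent_in_Int by blast
  then have "coef (emb (mon 0) * a) \<in> Zp" using B_top_iff assms by simp
  then show ?thesis by (simp add: mon_def)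
qed

end

context locally_finite_gmodule
begin

lemma F_gpart_add: "y \<in> gpart (F s) i \<Longrightarrow> z \<in> gpart (F s) i \<Longrightarrow> (\<lambda>b. y b + z b) \<in> gpart (F s) i"
  using graded_module.gpart_add[OF std_free_graded[OF M_graded], of y s i z] by (simp add: F_simps)

lemma F_gpart_smult: "r \<in> hpart R d \<Longrightarrow> y \<in> gpart (F s) i \<Longrightarrow> (\<lambda>b. r * y b) \<in> gpart (F s) (d + i)"
  using graded_module.gpart_smult[OF std_free_graded[OF M_graded], of r d y s i] by (simp add: F_simps)

lemma F_gpart_diff: "y \<in> gpart (F s) i \<Longrightarrow> z \<in> gpart (F s) i \<Longrightarrow> (\<lambda>b. y b - z b) \<in> gpart (F s) i"
  using F_gpart_add[of y s i "\<lambda>b. - 1 * z b"] F_gpart_smult[of "- 1" 0 z s i] R_hpart_closed(2,5) by simp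

lemma F_gpart_zero: "(\<lambda>b. 0) \<in> gpart (F s) i"
  by (simp add: F_gpart R_hpart_closed)

lemma F_gpart_finite: "y \<in> gpart (F s) i \<Longrightarrow> finite {b. y b \<noteq> 0}"
  by (simp add: F_gpart)

text \<open>The map \<open>\<psi>\<close> induces a homomorphism of groups from the part of degree \<open>i\<close> of stage \<open>s\<close> to \<open>\<rat>\<close>
  modulo the localized integers.\<close>

definition additive_mod :: "nat \<Rightarrow> int \<Rightarrow> (((rat_mpoly, 'm) gen \<Rightarrow> rat_mpoly) \<Rightarrow> rat) \<Rightarrow> bool"
  where "additive_mod s i \<psi> \<longleftrightarrow>
    (\<forall>y\<in>gpart (F s) i. \<forall>z\<in>gpart (F s) i. \<psi> (\<lambda>b. y b + z b) - (\<psi> y + \<psi> z) \<in> Zp)"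

lemma additive_modD:
  "additive_mod s i \<psi> \<Longrightarrow> y \<in> gpart (F s) i \<Longrightarrow> z \<in> gpart (F s) i \<Longrightarrow>
    \<psi> (\<lambda>b. y b + z b) - (\<psi> y + \<psi> z) \<in> Zp"
  by (simp add: additive_mod_def)

lemma additive_mod_0: "additive_mod s i \<psi> \<Longrightarrow> \<psi> (\<lambda>b. 0) \<in> Zp"
  unfolding additive_mod_def using F_gpart_zero[of s i] Zp_intros(3)[of "- \<psi> (\<lambda>b. 0)"] by fastforce

lemma additive_mod_nat:
  assumes "additive_mod s i \<psi>" "y \<in> gpart (F s) i"
  shows "\<psi> (\<lambda>b. const (of_nat k) * y b) - of_nat k * \<psi> y \<in> Zp"
proof (induction k)
  case 0 then show ?case using additive_mod_0[OF assms(1)] by (simp add: const_def)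
next
  case (Suc k)
  let ?z = "\<lambda>b. const (of_nat k) * y b"
  have z: "?z \<in> gpart (F s) i"
    using F_gpart_smult[OF const_hpart[OF Ints_Zp] assms(2), of "of_nat k"] by simp
  have "\<psi> (\<lambda>b. y b + ?z b) - (\<psi> y + \<psi> ?z) \<in> Zp" by (rule additive_modD[OF assms z])
  from Zp_intros(1)[OF this Suc] have "\<psi> (\<lambda>b. y b + ?z b) - of_nat (Suc k) * \<psi> y \<in> Zp"
    by (simp add: algebra_simps)
  moreover have "(\<lambda>b. y b + ?z b) = (\<lambda>b. const (of_nat (Suc k)) * y b)"
    by (simp add: const_def single_add distrib_right)
  ultimately show ?case by simp
qed

text \<open>Such a map is compatible with scalars in the localized integers, since it is so with integers,
  and division by integers prime to \<open>p\<close> is unique in the quotient of \<open>\<rat>\<close>.\<close>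

lemma additive_mod_linear:
  assumes \<psi>: "additive_mod s i \<psi>" and y: "y \<in> gpart (F s) i" and r: "r \<in> Zp"
  shows "\<psi> (\<lambda>b. const r * y b) - r * \<psi> y \<in> Zp"
proof -
  obtain a b where ab: "r = of_int a / of_int b" "\<not> int p dvd b" "b \<noteq> 0" by (rule localized_intsE[OF r])
  \<comment> \<open>natural numbers \<open>k\<close>, \<open>l\<close> and \<open>c\<close> with \<open>r + k = l / c\<close>, where \<open>p\<close> does not divide \<open>c\<close>\<close>
  define c where "c = nat \<bar>b\<bar>"
  have c: "of_nat c = (\<bar>of_int b\<bar> :: rat)" "0 < c" using ab by (simp_all add: c_def)
  define a' where "a' = sgn b * a"
  have rc: "of_nat c * r = of_int a'"
    using ab unfolding c(1) a'_def by (simp add: abs_if sgn_if)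
  define k where "k = nat \<bar>a'\<bar>"
  have k: "0 \<le> a' + int c * int k"
  proof -
    have "int k \<le> int c * int k" using c(2) mult_right_mono[of 1 "int c" "int k"] by simp
    then show ?thesis unfolding k_def by linarith
  qed
  define l where "l = nat (a' + int c * int k)"
  have l: "of_nat l = of_nat c * (r + of_nat k)"
  proof -
    have "(of_nat l :: rat) = of_int (a' + int c * int k)" unfolding l_def using k by (simp add: of_nat_nat)
    then show ?thesis using rc by (simp add: distrib_left)
  qed
  have g: "(\<lambda>b. const q * y b) \<in> gpart (F s) i" if "q \<in> Zp" for q
    using F_gpart_smult[OF const_hpart[OF that] y] by simp
  have nZ: "of_nat k \<in> Zp" for k by (simp add: Ints_Zp)
  have rk: "r + of_nat k \<in> Zp" by (intro Zp_intros r nZ)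
  define u where "u = \<psi> (\<lambda>b. const (r + of_nat k) * y b)"
  have "\<psi> (\<lambda>b. const (of_nat c) * (const (r + of_nat k) * y b)) - of_nat c * u \<in> Zp"
    unfolding u_def by (rule additive_mod_nat[OF \<psi> g[OF rk]])
  then have "\<psi> (\<lambda>b. const (of_nat l) * y b) - of_nat c * u \<in> Zp"
    by (simp add: mult.assoc[symmetric] const_mult l)
  moreover have "\<psi> (\<lambda>b. const (of_nat l) * y b) - of_nat l * \<psi> y \<in> Zp" by (rule additive_mod_nat[OF \<psi> y])
  ultimately have "of_nat c * (u - (r + of_nat k) * \<psi> y) \<in> Zp"
    using Zp_trans[OF Zp_commute] unfolding l by (metis (no_types, lifting) mult.assoc right_diff_distrib)
  moreover have "1 / of_nat c \<in> Zp"
  proof -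
    have "\<not> int p dvd int c" using ab(2) unfolding c_def by simp
    from localized_ints_inverse[OF p this] show ?thesis by simp
  qed
  ultimately have "1 / of_nat c * (of_nat c * (u - (r + of_nat k) * \<psi> y)) \<in> Zp" using Zp_intros(2) by blast
  then have 1: "u - (r + of_nat k) * \<psi> y \<in> Zp" using c(2) by simp
  have "\<psi> (\<lambda>b. const r * y b + const (of_nat k) * y b) - (\<psi> (\<lambda>b. const r * y b) + \<psi> (\<lambda>b. const (of_nat k) * y b)) \<in> Zp"
    by (rule additive_modD[OF \<psi> g[OF r] g[OF nZ]])
  then have 2: "u - (\<psi> (\<lambda>b. const r * y b) + \<psi> (\<lambda>b. const (of_nat k) * y b)) \<in> Zp"
    by (simp add: u_def const_def single_add distrib_right)
  have 3: "\<psi> (\<lambda>b. const (of_nat k) * y b) - of_nat k * \<psi> y \<in> Zp" by (rule additive_mod_nat[OF \<psi> y])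
  have "u - (r + of_nat k) * \<psi> y - (u - (\<psi> (\<lambda>b. const r * y b) + \<psi> (\<lambda>b. const (of_nat k) * y b)))
     - (\<psi> (\<lambda>b. const (of_nat k) * y b) - of_nat k * \<psi> y) \<in> Zp"
    by (intro Zp_intros(4) 1 2 3)
  then show ?thesis by (simp add: algebra_simps)
qed

text \<open>The quotient \<open>Q\<^sub>n\<^sub>+\<^sub>1\<close> of \<open>laurent_in (A (Suc n))\<close> by \<open>laurent_in (B (Suc n))\<close> is, up to a shift
  by \<open>D\<close>, the graded dual of \<open>R\<close>: every homomorphism of groups from a graded part of a stage of the
  resolution is the coefficient at \<open>socle\<close> of a homomorphism of modules into \<open>Q\<^sub>n\<^sub>+\<^sub>1\<close>.\<close>

lemma represent:
  assumes \<psi>: "additive_mod s (t - D) \<psi>"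
  shows "\<exists>g\<in>coch s t (A (Suc n)). \<forall>y\<in>gpart (F s) (t - D). coef (ev y g) - \<psi> y \<in> Zp"
proof -
  let ?G = "gpart (F s) (t - D)"
  define W where "W b = {m. keys m \<subseteq> {1..n} \<and> int (weight w m) = t - D - gen_deg b}"
    for b :: "(rat_mpoly, 'm) gen"
  have W: "finite (W b)" for b
    by (rule finite_subset[OF _ finite_weight_le[of "nat (t - D - gen_deg b)"]]) (auto simp: W_def)
  \<comment> \<open>the coefficient of \<open>g b\<close> at the exponent \<open>socle - m\<close> is the coefficient of \<open>x\<^sup>m\<close> times \<open>g b\<close> at
    \<open>socle\<close>, so it has to be \<open>\<psi>\<close> of \<open>x\<^sup>m b\<close>\<close>
  define g where "g b = (\<Sum>m\<in>W b. single (socle - int_exponent m) (\<psi> (unit_vec (mon m) b)))" for b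
  have g: "g \<in> coch s t (A (Suc n))"
  proof (rule cochI)
    fix b
    have "socle i - int_exponent m i = 0" if "m \<in> W b" "i \<notin> {1..n}" for m i
      using that by (auto simp: W_def socle_def int_exponent_def in_keys_iff subset_iff)
    then show "g b \<in> laurent_in (A (Suc n))" unfolding g_def
      by (intro laurent_in_sum[OF A_coeffs] laurent_in_single[OF A_coeffs] A_memI) auto
    show "g b \<in> homog (gen_deg b - t)" unfolding g_def
    proof (rule homog_sum)
      fix m assume "m \<in> W b"
      then have "deg (socle - int_exponent m) = gen_deg b - t"
        by (simp add: W_def deg_diff deg_socle deg_int_exponent)
      then show "single (socle - int_exponent m) (\<psi> (unit_vec (mon m) b)) \<in> homog (gen_deg b - t)"
        using homog_single by metis
    qed
  qed
  have lg: "lookup (g b) (socle - int_exponent m) = \<psi> (unit_vec (mon m) b)" if "m \<in> W b" for b m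
  proof -
    have "lookup (g b) (socle - int_exponent m) = (\<Sum>k\<in>W b. if k = m then \<psi> (unit_vec (mon k) b) else 0)"
      unfolding g_def lookup_sum lookup_single by (intro sum.cong) (auto simp: when_def int_exponent_inject)
    then show ?thesis using W that by (simp add: sum.delta)
  qed
  define P where "P y \<longleftrightarrow> y \<in> ?G \<and> coef (ev y g) - \<psi> y \<in> Zp" for y
  have P0: "P (\<lambda>b. 0)"
    using F_gpart_zero Zp_intros(3)[OF additive_mod_0[OF \<psi>]] by (simp add: P_def coef_def)
  have Padd: "P (\<lambda>b. y b + z b)" if "P y" "P z" for y z
  proof -
    have y: "y \<in> ?G" "coef (ev y g) - \<psi> y \<in> Zp" and z: "z \<in> ?G" "coef (ev z g) - \<psi> z \<in> Zp"
      using that by (auto simp: P_def)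
    have "\<psi> (\<lambda>b. y b + z b) - (\<psi> y + \<psi> z) \<in> Zp" by (rule additive_modD[OF \<psi> y(1) z(1)])
    from Zp_intros(4)[OF Zp_intros(1)[OF y(2) z(2)] this]
    have "coef (ev (\<lambda>b. y b + z b) g) - \<psi> (\<lambda>b. y b + z b) \<in> Zp"
      using ev_add[OF F_gpart_finite[OF y(1)] F_gpart_finite[OF z(1)]] by (simp add: coef_add algebra_simps)
    then show ?thesis using F_gpart_add[OF y(1) z(1)] by (simp add: P_def)
  qed
  have Punit: "P (unit_vec f b)" if f: "f \<in> hpart R (t - D - gen_deg b)" and b: "b \<in> X s" for f b
  proof (rule poly_mapping_induct_add[of "\<lambda>f. P (unit_vec f b)"])
    show "P (unit_vec 0 b)" using P0 by (simp add: unit_vec_def)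
    fix f g assume "P (unit_vec f b)" "P (unit_vec g b)"
    then have "P (\<lambda>x. unit_vec f b x + unit_vec g b x)" by (rule Padd)
    moreover have "(\<lambda>x. unit_vec f b x + unit_vec g b x) = unit_vec (f + g) b" by (auto simp: unit_vec_def)
    ultimately show "P (unit_vec (f + g) b)" by simp
  next
    fix m assume "m \<in> keys f"
    then have m: "m \<in> W b" and r: "lookup f m \<in> Zp" using f unfolding R_hpart_weight R_carrier W_def by auto
    let ?r = "lookup f m"
    have um: "unit_vec (mon m) b \<in> ?G"
      using unit_vec_gpart[OF mon_hpart b, of m] m by (simp add: W_def)
    have eq: "unit_vec (single m ?r) b = (\<lambda>x. const ?r * unit_vec (mon m) b x)"
      by (auto simp: unit_vec_def const_def mon_def mult_single)
    have "coef (ev (unit_vec (single m ?r) b) g) = ?r * \<psi> (unit_vec (mon m) b)"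
      by (simp add: ev_unit_vec coef_single_mult lg[OF m])
    then have "coef (ev (unit_vec (single m ?r) b) g) - \<psi> (unit_vec (single m ?r) b) \<in> Zp"
      unfolding eq using Zp_commute[OF additive_mod_linear[OF \<psi> um r]] by simp
    then show "P (unit_vec (single m ?r) b)"
      unfolding P_def eq using F_gpart_smult[OF const_hpart[OF r] um] by simp
  qed
  have "P y" if y: "y \<in> ?G" for y
    by (rule unit_vec_induct[of y P, OF F_gpart_finite[OF y] P0 Padd Punit]) (use y in \<open>auto simp: F_gpart\<close>)
  then show ?thesis using g unfolding P_def by blast
qed

lemma emb_bd: "emb (bd y x) = ev y (\<lambda>b. emb (gen_cycle R b x))"
  by (simp add: bd_def ev_def emb_sum emb_mult)

lemma bd_diff:
  assumes "finite {b. y b \<noteq> 0}" "finite {b. z b \<noteq> 0}"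
  shows "bd (\<lambda>b. y b - z b) = (\<lambda>x. bd y x - bd z x)"
proof
  fix x
  have "emb (bd (\<lambda>b. y b - z b) x) = emb (bd y x - bd z x)"
    unfolding emb_diff emb_bd by (rule ev_diff[OF assms])
  then show "bd (\<lambda>b. y b - z b) x = bd y x - bd z x" by (simp add: emb_inject)
qed

text \<open>Whether a cochain vanishes modulo \<open>laurent_in (B (Suc n))\<close> can be tested on the coefficients at
  \<open>socle\<close> of its values on monomial multiples of basis elements, of the one degree where these
  coefficients can be nonzero.\<close>

lemma coch_B_top_iff:
  assumes c: "c \<in> coch s t (A (Suc n))"
  shows "c \<in> coch s t (B (Suc n)) \<longleftrightarrow>
    (\<forall>b\<in>X s. \<forall>m. keys m \<subseteq> {1..n} \<longrightarrow> int (weight w m) + gen_deg b = t - D \<longrightarrow>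
       coef (ev (unit_vec (mon m) b) c) \<in> Zp)"
proof
  assume "c \<in> coch s t (B (Suc n))"
  then show "\<forall>b\<in>X s. \<forall>m. keys m \<subseteq> {1..n} \<longrightarrow> int (weight w m) + gen_deg b = t - D \<longrightarrow>
       coef (ev (unit_vec (mon m) b) c) \<in> Zp"
    using B_top_iff[OF cochD(1)[OF c]] cochD(1) by (simp add: ev_unit_vec)
next
  assume *: "\<forall>b\<in>X s. \<forall>m. keys m \<subseteq> {1..n} \<longrightarrow> int (weight w m) + gen_deg b = t - D \<longrightarrow>
       coef (ev (unit_vec (mon m) b) c) \<in> Zp"
  show "c \<in> coch s t (B (Suc n))"
  proof (rule cochI)
    fix b assume b: "b \<in> X s"
    show "c b \<in> homog (gen_deg b - t)" by (rule cochD(2)[OF c b])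
    have "coef (emb (mon m) * c b) \<in> Zp" if m: "keys m \<subseteq> {1..n}" for m
    proof (cases "int (weight w m) + gen_deg b = t - D")
      case True then show ?thesis using * b m by (simp add: ev_unit_vec)
    next
      case False
      have "emb (mon m) * c b \<in> homog (int (weight w m) + (gen_deg b - t))"
        using mon_hpart[OF m] cochD(2)[OF c b] unfolding R_hpart by (intro homog_mult) auto
      then have "coef (emb (mon m) * c b) = 0" by (rule coef_homog) (use False in simp)
      then show ?thesis by (simp add: Zp_simps)
    qed
    then show "c b \<in> laurent_in (B (Suc n))" using B_top_iff[OF cochD(1)[OF c b]] by blast
  qed
qed

text \<open>Since \<open>\<rat>\<close> modulo the localized integers is divisible, \<open>Q\<^sub>n\<^sub>+\<^sub>1\<close> is injective: the coefficient at
  \<open>socle\<close> of a cocycle \<open>c\<close> is a homomorphism on the boundaries of one degree, and extends to all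
  chains.\<close>

lemma top_vanishing:
  assumes c: "c \<in> coc (Suc s) t (Suc n)"
  shows "c \<in> cob (Suc s) t (Suc n)"
proof -
  let ?i = "t - D"
  have cA: "c \<in> coch (Suc s) t (A (Suc n))" and dc: "\<delta> c \<in> coch (Suc (Suc s)) t (B (Suc n))"
    using c unfolding coc_def by auto
  \<comment> \<open>the graph of the homomorphism that sends the boundary of \<open>y\<close> to the coefficient of \<open>c\<close> on \<open>y\<close>\<close>
  define K0 where "K0 = {(bd y, q) |y q. y \<in> gpart (F (Suc s)) ?i \<and> q - coef (ev y c) \<in> Zp}"
  have ker: "coef (ev y c) \<in> Zp" if y: "y \<in> gpart (F (Suc s)) ?i" "bd y = (\<lambda>x. 0)" for y
  proof -
    obtain b where b: "b \<in> X (Suc (Suc s))" "gen_deg b = ?i" "gen_cycle R b = y"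
      by (rule cycle_is_gen_cycle[OF y])
    then show ?thesis using coef_B_top[OF cochD(1)[OF dc b(1)]] by (simp add: \<delta>_def)
  qed
  obtain K where K: "K0 \<subseteq> K" "\<And>a b. a \<in> K \<Longrightarrow> b \<in> K \<Longrightarrow> a - b \<in> K" "\<And>q. (0, q) \<in> K \<Longrightarrow> q \<in> Zp"
    "\<And>g. \<exists>q. (g, q) \<in> K"
  proof (rule divisible_extension[of K0 Zp])
    have "bd (\<lambda>x. 0) = 0" by (simp add: bd_def fun_eq_iff)
    moreover have "0 - coef (ev (\<lambda>x. 0) c) \<in> Zp" by (simp add: coef_def Zp_simps)
    ultimately show "(0, 0) \<in> K0" unfolding K0_def using F_gpart_zero[of "Suc s" ?i]
      by (intro CollectI exI[of _ "\<lambda>x. 0"] exI[of _ 0]) simp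
  next
    fix a b assume "a \<in> K0" "b \<in> K0"
    then obtain y q z r where *: "a = (bd y, q)" "b = (bd z, r)" "y \<in> gpart (F (Suc s)) ?i"
      "z \<in> gpart (F (Suc s)) ?i" "q - coef (ev y c) \<in> Zp" "r - coef (ev z c) \<in> Zp" unfolding K0_def by blast
    note fin = F_gpart_finite[OF *(3)] F_gpart_finite[OF *(4)]
    have "a - b = (bd (\<lambda>b. y b - z b), q - r)" using bd_diff[OF fin] by (simp add: * fun_eq_iff)
    moreover have "coef (ev (\<lambda>b. y b - z b) c) = coef (ev y c) - coef (ev z c)"
      by (simp add: ev_diff[OF fin] coef_diff)
    then have "q - r - coef (ev (\<lambda>b. y b - z b) c) = (q - coef (ev y c)) - (r - coef (ev z c))" by simp
    then have "q - r - coef (ev (\<lambda>b. y b - z b) c) \<in> Zp" using Zp_intros(4)[OF *(5,6)] by metis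
    ultimately show "a - b \<in> K0" unfolding K0_def using F_gpart_diff[OF *(3,4)] by blast
  next
    fix q assume "(0, q) \<in> K0"
    then obtain y where y: "y \<in> gpart (F (Suc s)) ?i" "q - coef (ev y c) \<in> Zp" "bd y = (\<lambda>x. 0)"
      unfolding K0_def by (auto simp: zero_fun_def)
    then show "q \<in> Zp" using ker Zp_shift by blast
  qed blast
  define \<psi> where "\<psi> z = (SOME q. (z, q) \<in> K)" for z
  have \<psi>K: "(z, \<psi> z) \<in> K" for z unfolding \<psi>_def by (rule someI_ex) (rule K(4))
  have \<psi>eq: "q - \<psi> z \<in> Zp" if "(z, q) \<in> K" for z q using K(3) K(2)[OF that \<psi>K[of z]] by simp
  have "\<psi> (\<lambda>b. y b + z b) - (\<psi> y + \<psi> z) \<in> Zp" for y z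
  proof -
    have "(\<lambda>b. y b + z b, \<psi> (\<lambda>b. y b + z b)) - (y, \<psi> y) - (z, \<psi> z) \<in> K" by (intro K(2) \<psi>K)
    moreover have "(\<lambda>b. y b + z b) - y - z = 0" by (simp add: fun_eq_iff)
    ultimately show ?thesis using K(3) by (simp add: diff_diff_eq)
  qed
  then have "additive_mod s ?i \<psi>" unfolding additive_mod_def by blast
  from represent[OF this] obtain g where g: "g \<in> coch s t (A (Suc n))"
    "\<And>y. y \<in> gpart (F s) ?i \<Longrightarrow> coef (ev y g) - \<psi> y \<in> Zp" by blast
  let ?f = "\<lambda>b. c b - \<delta> g b"
  have f: "?f \<in> coch (Suc s) t (A (Suc n))"
    by (rule coch_diff[OF A_coeffs cA \<delta>_coch[OF A_coeffs A_stable g(1)]])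
  have "?f \<in> coch (Suc s) t (B (Suc n))"
    unfolding coch_B_top_iff[OF f]
  proof (intro ballI allI impI)
    fix b m assume b: "b \<in> X (Suc s)" and m: "keys m \<subseteq> {1..n}" "int (weight w m) + gen_deg b = ?i"
    let ?y = "unit_vec (mon m) b"
    have y: "?y \<in> gpart (F (Suc s)) ?i" using unit_vec_gpart[OF mon_hpart[OF m(1)] b] m(2) by simp
    have "(bd ?y, coef (ev ?y c)) \<in> K0" unfolding K0_def using y Zp_simps(1) by fastforce
    then have "coef (ev ?y c) - \<psi> (bd ?y) \<in> Zp" using K(1) \<psi>eq by blast
    moreover have "coef (ev ?y (\<delta> g)) - \<psi> (bd ?y) \<in> Zp"
      using g(2)[OF bd_gpart[OF y]] ev_bd[OF F_gpart_carrier[OF y]] by simp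
    ultimately show "coef (ev ?y ?f) \<in> Zp"
      using Zp_intros(4) by (fastforce simp: ev_fun_diff coef_diff)
  qed
  then show ?thesis using g(1) by auto
qed

end


section \<open>Homomorphisms into the quotient of the rationals by the integers\<close>

text \<open>The coset of \<open>q\<close> in \<open>\<rat>/\<int>\<close>.\<close>

definition rat_class :: "rat \<Rightarrow> rat set"
  where "rat_class q = {x. x - q \<in> \<int>}"

lemma rat_class_self: "q \<in> rat_class q" by (simp add: rat_class_def)

lemma rat_class_0: "rat_class 0 = \<int>" by (simp add: rat_class_def)

lemma rat_class_eq: "rat_class q = rat_class r \<longleftrightarrow> q - r \<in> \<int>"
proof
  assume "rat_class q = rat_class r" then show "q - r \<in> \<int>" using rat_class_self[of q] by (simp add: rat_class_def)
next
  assume qr: "q - r \<in> \<int>"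
  have "x - q \<in> \<int> \<longleftrightarrow> x - r \<in> \<int>" for x
    using Ints_add[OF _ qr, of "x - q"] Ints_diff[OF _ qr, of "x - r"] by auto
  then show "rat_class q = rat_class r" by (simp add: rat_class_def)
qed

lemma rat_group_coset: "r_coset rat_group \<int> q = rat_class q"
proof (intro equalityI subsetI)
  fix x assume "x \<in> rat_class q"
  then show "x \<in> r_coset rat_group \<int> q"
    unfolding r_coset_def rat_group_def by (intro UN_I[of "x - q"]) (auto simp: rat_class_def)
qed (auto simp: rat_class_def r_coset_def rat_group_def)

lemma Q_mod_Z_carrier: "carrier Q_mod_Z = range rat_class"
  unfolding Q_mod_Z_def carrier_FactGroup rat_group_coset by (simp add: rat_group_def)

lemma Q_mod_Z_one: "\<one>\<^bsub>Q_mod_Z\<^esub> = rat_class 0"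
  by (simp add: Q_mod_Z_def rat_class_0)

lemma Q_mod_Z_mult: "rat_class q \<otimes>\<^bsub>Q_mod_Z\<^esub> rat_class r = rat_class (q + r)"
proof -
  have "\<exists>a. a - q \<in> \<int> \<and> (\<exists>b. b - r \<in> \<int> \<and> x = a + b)" if "x - (q + r) \<in> \<int>" for x
    using that by (intro exI[of _ "x - r"] conjI exI[of _ r]) (simp_all add: algebra_simps)
  moreover have "a + b - (q + r) \<in> \<int>" if "a - q \<in> \<int>" "b - r \<in> \<int>" for a b
    using Ints_add[OF that] by (simp add: algebra_simps)
  ultimately show ?thesis by (auto simp: Q_mod_Z_def set_mult_def rat_group_def rat_class_def)
qed

lemma Q_mod_Z_class: "U \<in> carrier Q_mod_Z \<Longrightarrow> q \<in> U \<Longrightarrow> U = rat_class q"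
  unfolding Q_mod_Z_carrier using rat_class_eq by (fastforce simp: rat_class_def)

lemma Q_mod_Z_comm_group: "comm_group Q_mod_Z"
proof (rule comm_groupI)
  fix x assume "x \<in> carrier Q_mod_Z"
  then obtain q where "x = rat_class q" by (auto simp: Q_mod_Z_carrier)
  then have "rat_class (- q) \<otimes>\<^bsub>Q_mod_Z\<^esub> x = \<one>\<^bsub>Q_mod_Z\<^esub>" by (simp add: Q_mod_Z_mult Q_mod_Z_one)
  then show "\<exists>y\<in>carrier Q_mod_Z. y \<otimes>\<^bsub>Q_mod_Z\<^esub> x = \<one>\<^bsub>Q_mod_Z\<^esub>" by (auto simp: Q_mod_Z_carrier)
qed (auto simp: Q_mod_Z_carrier Q_mod_Z_mult Q_mod_Z_one algebra_simps)

context locally_finite_gmodule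
begin

abbreviation "Dual \<equiv> part (pontryagin_dual M)"

lemma Dual_simps:
  "\<phi> \<in> carrier (Dual i) \<longleftrightarrow> \<phi> \<in> extensional (gpart M i) \<and> (\<forall>x\<in>gpart M i. \<phi> x \<in> carrier Q_mod_Z) \<and>
     (\<forall>x\<in>gpart M i. \<forall>y\<in>gpart M i. \<phi> (x \<oplus>\<^bsub>M\<^esub> y) = \<phi> x \<otimes>\<^bsub>Q_mod_Z\<^esub> \<phi> y)"
  "monoid.mult (Dual i) = (\<lambda>\<phi> \<psi>. \<lambda>x\<in>gpart M i. \<phi> x \<otimes>\<^bsub>Q_mod_Z\<^esub> \<psi> x)"
  "one (Dual i) = (\<lambda>x\<in>gpart M i. \<one>\<^bsub>Q_mod_Z\<^esub>)"
  by (auto simp: pontryagin_dual_def hom_def)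

lemma Dual_comm_group: "comm_group (Dual i)"
proof -
  interpret Q: comm_group Q_mod_Z by (rule Q_mod_Z_comm_group)
  show ?thesis
  proof (rule comm_groupI)
    fix \<phi> \<psi> assume "\<phi> \<in> carrier (Dual i)" "\<psi> \<in> carrier (Dual i)"
    then show "\<phi> \<otimes>\<^bsub>Dual i\<^esub> \<psi> \<in> carrier (Dual i)"
      unfolding Dual_simps by (auto simp: M.gpart_add Q.m_ac)
  next
    show "\<one>\<^bsub>Dual i\<^esub> \<in> carrier (Dual i)" unfolding Dual_simps by (auto simp: M.gpart_add)
  next
    fix \<phi> assume \<phi>: "\<phi> \<in> carrier (Dual i)"
    show "\<one>\<^bsub>Dual i\<^esub> \<otimes>\<^bsub>Dual i\<^esub> \<phi> = \<phi>"
      using \<phi> unfolding Dual_simps by (auto simp: extensional_def fun_eq_iff)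
    have "(\<lambda>x\<in>gpart M i. inv\<^bsub>Q_mod_Z\<^esub> \<phi> x) \<in> carrier (Dual i)"
      using \<phi> unfolding Dual_simps by (auto simp: M.gpart_add Q.inv_mult)
    moreover have "(\<lambda>x\<in>gpart M i. inv\<^bsub>Q_mod_Z\<^esub> \<phi> x) \<otimes>\<^bsub>Dual i\<^esub> \<phi> = \<one>\<^bsub>Dual i\<^esub>"
      using \<phi> unfolding Dual_simps by (auto simp: fun_eq_iff)
    ultimately show "\<exists>\<psi>\<in>carrier (Dual i). \<psi> \<otimes>\<^bsub>Dual i\<^esub> \<phi> = \<one>\<^bsub>Dual i\<^esub>" by blast
  qed (unfold Dual_simps, auto simp: fun_eq_iff Q.m_assoc, auto simp: Q.m_comm)
qed

lemma Dual_class: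
  assumes "\<phi> \<in> carrier (Dual i)" "m \<in> gpart M i"
  obtains q where "\<phi> m = rat_class q" "q \<in> \<phi> m"
proof -
  have "\<phi> m \<in> range rat_class" using assms unfolding Dual_simps Q_mod_Z_carrier by blast
  then show ?thesis using that rat_class_self by auto
qed

lemma Dual_eq_class:
  assumes "\<phi> \<in> carrier (Dual i)" "m \<in> gpart M i" "q \<in> \<phi> m" shows "\<phi> m = rat_class q"
  using assms Q_mod_Z_class unfolding Dual_simps by blast

lemma Dual_zero:
  assumes "\<phi> \<in> carrier (Dual i)" shows "\<phi> \<zero>\<^bsub>M\<^esub> = rat_class 0"
proof -
  obtain q where q: "\<phi> \<zero>\<^bsub>M\<^esub> = rat_class q" by (rule Dual_class[OF assms M.gpart_zero])
  have "\<phi> (\<zero>\<^bsub>M\<^esub> \<oplus>\<^bsub>M\<^esub> \<zero>\<^bsub>M\<^esub>) = \<phi> \<zero>\<^bsub>M\<^esub> \<otimes>\<^bsub>Q_mod_Z\<^esub> \<phi> \<zero>\<^bsub>M\<^esub>"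
    using assms M.gpart_zero unfolding Dual_simps by blast
  then have "rat_class q = rat_class (q + q)" by (simp add: q Q_mod_Z_mult)
  then show ?thesis unfolding q rat_class_eq by (simp add: rat_class_eq)
qed

lemma const_smult_gpart: "q \<in> Zp \<Longrightarrow> m \<in> gpart M i \<Longrightarrow> const q \<odot>\<^bsub>M\<^esub> m \<in> gpart M i"
  using M.gpart_smult[OF const_hpart, of q m i] by simp

lemma Dual_multiple:
  assumes \<phi>: "\<phi> \<in> carrier (Dual i)" and m: "m \<in> gpart M i" "q \<in> \<phi> m"
  shows "\<phi> (const (of_nat k) \<odot>\<^bsub>M\<^esub> m) = rat_class (of_nat k * q)"
proof (induction k)
  case 0
  have "const 0 \<odot>\<^bsub>M\<^esub> m = \<zero>\<^bsub>M\<^esub>" using M.smult_l_null[OF M.gpart_sub[OF m(1)]] by (simp add: const_def)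
  then show ?case using Dual_zero[OF \<phi>] by simp
next
  case (Suc k)
  have mc: "m \<in> carrier M" by (rule M.gpart_sub[OF m(1)])
  have kc: "const (of_nat k) \<in> carrier R" by (rule R_hpart_carrier[OF const_hpart]) (simp add: Ints_Zp)
  have "const (of_nat (Suc k)) = 1 \<oplus>\<^bsub>R\<^esub> const (of_nat k)"
    by (simp add: const_def single_add del: single_of_nat)
  then have "const (of_nat (Suc k)) \<odot>\<^bsub>M\<^esub> m = m \<oplus>\<^bsub>M\<^esub> const (of_nat k) \<odot>\<^bsub>M\<^esub> m"
    using M.smult_l_distr[OF R_closed(2) kc mc] M.smult_one[OF mc] by simp
  moreover have "const (of_nat k) \<odot>\<^bsub>M\<^esub> m \<in> gpart M i" by (rule const_smult_gpart) (simp_all add: Ints_Zp m)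
  ultimately have "\<phi> (const (of_nat (Suc k)) \<odot>\<^bsub>M\<^esub> m) = \<phi> m \<otimes>\<^bsub>Q_mod_Z\<^esub> rat_class (of_nat k * q)"
    using \<phi> m(1) Suc unfolding Dual_simps by metis
  then show ?case using Dual_eq_class[OF \<phi> m] by (simp add: Q_mod_Z_mult distrib_right)
qed

lemma p_power_annihilates:
  assumes "m \<in> gpart M i" obtains k where "const (of_nat (p ^ k)) \<odot>\<^bsub>M\<^esub> m = \<zero>\<^bsub>M\<^esub>"
  using nilpotent_p[OF assms] unfolding const_power by auto

lemma Dual_torsion:
  assumes "\<phi> \<in> carrier (Dual i)" "m \<in> gpart M i" "q \<in> \<phi> m"
  obtains k where "of_nat p ^ k * q \<in> \<int>"
proof -
  obtain k where "const (of_nat (p ^ k)) \<odot>\<^bsub>M\<^esub> m = \<zero>\<^bsub>M\<^esub>" by (rule p_power_annihilates[OF assms(2)])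
  then have "rat_class (of_nat (p ^ k) * q) = rat_class 0"
    using Dual_multiple[OF assms, of "p ^ k"] Dual_zero[OF assms(1)] by simp
  then show ?thesis using that[of k] by (simp add: rat_class_eq)
qed


section \<open>Cocycles of degree zero with values in the top quotient\<close>

text \<open>The cocycle \<open>h\<close> induces a homomorphism on the part of \<open>M\<close> in degree \<open>t - D\<close>, by taking
  the coefficient at \<open>socle\<close>. Its values lie in \<open>\<rat>\<close> modulo the localized integers, which is
  isomorphic to the \<open>p\<close>-primary part of \<open>\<rat>/\<int>\<close>. It agrees with \<open>\<phi>\<close> if the values of \<open>\<phi>\<close> are contained
  in those of \<open>h\<close> as cosets.\<close>

definition induces :: "int \<Rightarrow> ((rat_mpoly, 'm) gen \<Rightarrow> laurent) \<Rightarrow> ('m \<Rightarrow> rat set) \<Rightarrow> bool"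
  where "induces t h \<phi> \<longleftrightarrow> h \<in> coc 0 t (Suc n) \<and> \<phi> \<in> carrier (Dual (t - D)) \<and>
    (\<forall>m\<in>gpart M (t - D). \<forall>q\<in>\<phi> m. coef (h (Elt (t - D) m)) - q \<in> Zp)"

lemma coc_aug_cycle:
  assumes h: "h \<in> coc 0 t (Suc n)" and y: "y \<in> gpart (F 0) i" "aug y = \<zero>\<^bsub>M\<^esub>"
  shows "coef (ev y h) \<in> Zp"
proof -
  have dh: "\<delta> h \<in> coch (Suc 0) t (B (Suc n))" using h unfolding coc_def by auto
  obtain b where b: "b \<in> X (Suc 0)" "gen_cycle R b = y"
    by (rule aug_cycle_is_gen_cycle[OF y])
  then show ?thesis using coef_B_top[OF cochD(1)[OF dh b(1)]] by (simp add: \<delta>_def)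
qed

lemma Elt_basis: "m \<in> gpart M i \<Longrightarrow> Elt i m \<in> X 0" by simp

lemma Elt_vec:
  assumes m: "m \<in> gpart M i"
  shows "unit_vec 1 (Elt i m) \<in> gpart (F 0) i" "aug (unit_vec 1 (Elt i m)) = m"
  using unit_vec_gpart[OF R_hpart_closed(2) Elt_basis[OF m]] aug_unit_vec[OF R_closed(2) m]
    M.smult_one[OF M.gpart_sub[OF m]] by simp_all

text \<open>The coefficient at \<open>socle\<close> of \<open>h\<close> on a chain depends only on the image of the chain in \<open>M\<close>, modulo
  the localized integers.\<close>

lemma coc_aug:
  assumes h: "h \<in> coc 0 t (Suc n)" and y: "y \<in> gpart (F 0) i"
  shows "coef (ev y h) - coef (h (Elt i (aug y))) \<in> Zp"
proof -
  let ?b = "Elt i (aug y) :: (rat_mpoly, 'm) gen"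
  let ?z = "unit_vec 1 ?b"
  have m: "aug y \<in> gpart M i" by (rule aug_gpart[OF y])
  note z = Elt_vec(1)[OF m] and az = Elt_vec(2)[OF m]
  let ?z' = "\<lambda>b. - 1 * ?z b"
  have z': "?z' \<in> gpart (F 0) i" using F_gpart_smult[OF R_hpart_closed(5)[OF R_hpart_closed(2)] z] by simp
  have mc: "aug y \<in> carrier M" by (rule M.gpart_sub[OF m])
  have m1: "- 1 \<in> carrier R" using R_closed by simp
  have "\<one>\<^bsub>R\<^esub> \<odot>\<^bsub>M\<^esub> aug y \<oplus>\<^bsub>M\<^esub> (- 1) \<odot>\<^bsub>M\<^esub> aug y = (\<one>\<^bsub>R\<^esub> \<oplus>\<^bsub>R\<^esub> - 1) \<odot>\<^bsub>M\<^esub> aug y"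
    using M.smult_l_distr[OF _ m1 mc, of 1] R_closed(2) by simp
  also have "\<dots> = \<zero>\<^bsub>M\<^esub>" using M.smult_l_null[OF mc] by simp
  finally have "aug y \<oplus>\<^bsub>M\<^esub> (- 1) \<odot>\<^bsub>M\<^esub> aug y = \<zero>\<^bsub>M\<^esub>" using M.smult_one[OF mc] by simp
  then have "aug (\<lambda>b. y b + ?z' b) = \<zero>\<^bsub>M\<^esub>"
    using aug_add[OF F_gpart_carrier[OF y] F_gpart_carrier[OF z']] aug_smult[OF m1 F_gpart_carrier[OF z]] az by simp
  then have "coef (ev (\<lambda>b. y b + ?z' b) h) \<in> Zp" by (intro coc_aug_cycle[OF h F_gpart_add[OF y z']])
  moreover have "ev (\<lambda>b. y b + ?z' b) h = ev y h - h ?b"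
    using ev_diff[OF F_gpart_finite[OF y] F_gpart_finite[OF z], of h] by (simp add: ev_unit_vec)
  ultimately show ?thesis by (simp add: coef_diff)
qed

lemma coc_smult:
  assumes h: "h \<in> coc 0 t (Suc n)" and r: "r \<in> hpart R d" and m: "m \<in> gpart M i"
  shows "coef (emb r * h (Elt i m)) - coef (h (Elt (d + i) (r \<odot>\<^bsub>M\<^esub> m))) \<in> Zp"
  using coc_aug[OF h unit_vec_gpart[OF r Elt_basis[OF m]]] aug_unit_vec[OF R_hpart_carrier[OF r] m]
  by (simp add: ev_unit_vec)

lemma coc_add_elements:
  assumes h: "h \<in> coc 0 t (Suc n)" and m: "m \<in> gpart M i" "m' \<in> gpart M i"
  shows "coef (h (Elt i (m \<oplus>\<^bsub>M\<^esub> m'))) - (coef (h (Elt i m)) + coef (h (Elt i m'))) \<in> Zp"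
proof -
  let ?y = "unit_vec 1 (Elt i m :: (rat_mpoly, 'm) gen)" and ?z = "unit_vec 1 (Elt i m' :: (rat_mpoly, 'm) gen)"
  note y = Elt_vec(1)[OF m(1)] and z = Elt_vec(1)[OF m(2)]
  have "aug (\<lambda>b. ?y b + ?z b) = m \<oplus>\<^bsub>M\<^esub> m'"
    using aug_add[OF F_gpart_carrier[OF y] F_gpart_carrier[OF z]] m by (simp add: Elt_vec)
  moreover have "ev (\<lambda>b. ?y b + ?z b) h = h (Elt i m) + h (Elt i m')"
    using ev_add[OF F_gpart_finite[OF y] F_gpart_finite[OF z]] by (simp add: ev_unit_vec)
  ultimately have "coef (h (Elt i m)) + coef (h (Elt i m')) - coef (h (Elt i (m \<oplus>\<^bsub>M\<^esub> m'))) \<in> Zp"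
    using coc_aug[OF h F_gpart_add[OF y z]] by (simp add: coef_add)
  then show ?thesis by (rule Zp_commute)
qed

lemma induces_unique:
  assumes \<phi>: "induces t h \<phi>" and \<phi>': "induces t h' \<phi>'"
    and eq: "\<And>m. m \<in> gpart M (t - D) \<Longrightarrow> coef (h (Elt (t - D) m)) - coef (h' (Elt (t - D) m)) \<in> Zp"
  shows "\<phi> = \<phi>'"
proof (rule extensionalityI)
  have \<phi>c: "\<phi> \<in> carrier (Dual (t - D))" "\<phi>' \<in> carrier (Dual (t - D))"
    using \<phi> \<phi>' unfolding induces_def by auto
  then show "\<phi> \<in> extensional (gpart M (t - D))" "\<phi>' \<in> extensional (gpart M (t - D))"
    unfolding Dual_simps by auto
  fix m assume m: "m \<in> gpart M (t - D)"
  obtain q where q: "\<phi> m = rat_class q" "q \<in> \<phi> m" by (rule Dual_class[OF \<phi>c(1) m])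
  obtain r where r: "\<phi>' m = rat_class r" "r \<in> \<phi>' m" by (rule Dual_class[OF \<phi>c(2) m])
  have 1: "coef (h (Elt (t - D) m)) - q \<in> Zp" using \<phi> m q(2) unfolding induces_def by blast
  have 2: "coef (h' (Elt (t - D) m)) - r \<in> Zp" using \<phi>' m r(2) unfolding induces_def by blast
  have "q - r \<in> Zp" using Zp_trans[OF Zp_commute[OF 1] Zp_trans[OF eq[OF m] 2]] .
  moreover obtain k where k: "of_nat p ^ k * q \<in> \<int>" by (rule Dual_torsion[OF \<phi>c(1) m q(2)])
  moreover obtain l where l: "of_nat p ^ l * r \<in> \<int>" by (rule Dual_torsion[OF \<phi>c(2) m r(2)])
  \<comment> \<open>a \<open>p\<close>-power torsion element of \<open>\<rat>/\<int>\<close> that vanishes modulo the localized integers is zero\<close>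
  have "of_nat p ^ l * (of_nat p ^ k * q) - of_nat p ^ k * (of_nat p ^ l * r) \<in> \<int>"
    by (intro Ints_diff Ints_mult k l Ints_power Ints_of_nat)
  then have "of_nat p ^ (k + l) * (q - r) \<in> \<int>" by (simp add: power_add algebra_simps)
  ultimately have "q - r \<in> \<int>" using localized_ints_integral[OF p] by blast
  then show "\<phi> m = \<phi>' m" by (simp add: q r rat_class_eq)
qed

lemma coef_const_mult: "coef (emb (const q) * a) = q * coef a"
  using coef_single_mult[of 0 q a] by (simp only: const_def int_exponent_0 diff_zero coef_def[of a])

lemma induces_total:
  assumes h: "h \<in> coc 0 t (Suc n)"
  shows "\<exists>\<phi>. induces t h \<phi>"
proof -
  let ?i = "t - D"
  define \<psi> where "\<psi> m = coef (h (Elt ?i m))" for m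
  \<comment> \<open>\<open>\<psi>\<close> is lifted from values in the \<open>p\<close>-power torsion of \<open>\<rat>\<close> modulo the localized integers to
    values in that of \<open>\<rat>/\<int>\<close>\<close>
  have "\<exists>q k. of_nat p ^ k * q \<in> \<int> \<and> \<psi> m - q \<in> Zp" if m: "m \<in> gpart M ?i" for m
  proof -
    obtain k where k: "const (of_nat (p ^ k)) \<odot>\<^bsub>M\<^esub> m = \<zero>\<^bsub>M\<^esub>" by (rule p_power_annihilates[OF m])
    have c: "const (of_nat (p ^ k)) \<in> hpart R 0" by (rule const_hpart) (rule Ints_Zp, simp)
    have "coef (ev (unit_vec (const (of_nat (p ^ k))) (Elt ?i m)) h) \<in> Zp"
      by (rule coc_aug_cycle[OF h unit_vec_gpart[OF c Elt_basis[OF m]]])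
        (simp only: aug_unit_vec[OF R_hpart_carrier[OF c] m] k)
    then have "of_nat p ^ k * \<psi> m \<in> Zp"
      by (simp add: ev_unit_vec coef_const_mult \<psi>_def)
    from localized_ints_lift[OF p this] show ?thesis by blast
  qed
  then obtain \<theta> k where \<theta>: "\<And>m. m \<in> gpart M ?i \<Longrightarrow> of_nat p ^ k m * \<theta> m \<in> \<int> \<and> \<psi> m - \<theta> m \<in> Zp"
    by metis
  define \<phi> where "\<phi> = (\<lambda>m\<in>gpart M ?i. rat_class (\<theta> m))"
  have "rat_class (\<theta> (m \<oplus>\<^bsub>M\<^esub> m')) = rat_class (\<theta> m + \<theta> m')" if m: "m \<in> gpart M ?i" "m' \<in> gpart M ?i" for m m'
    unfolding rat_class_eq
  proof (rule localized_ints_integral[OF p])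
    let ?s = "m \<oplus>\<^bsub>M\<^esub> m'"
    have s: "?s \<in> gpart M ?i" by (rule M.gpart_add[OF m])
    have "\<psi> ?s - (\<psi> m + \<psi> m') \<in> Zp" unfolding \<psi>_def by (rule coc_add_elements[OF h m])
    then have "(\<psi> m - \<theta> m) + (\<psi> m' - \<theta> m') - (\<psi> ?s - \<theta> ?s) + (\<psi> ?s - (\<psi> m + \<psi> m')) \<in> Zp"
      using \<theta>[OF m(1)] \<theta>[OF m(2)] \<theta>[OF s] Zp_intros(1,4) by blast
    then show "\<theta> ?s - (\<theta> m + \<theta> m') \<in> Zp" by (simp add: algebra_simps)
    have i: "of_nat p ^ k m * \<theta> m \<in> \<int>" "of_nat p ^ k m' * \<theta> m' \<in> \<int>" "of_nat p ^ k ?s * \<theta> ?s \<in> \<int>"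
      using \<theta>[OF m(1)] \<theta>[OF m(2)] \<theta>[OF s] by auto
    have pp: "(of_nat p ^ a * of_nat p ^ b :: rat) \<in> \<int>" for a b by simp
    have "of_nat p ^ k m * of_nat p ^ k m' * (of_nat p ^ k ?s * \<theta> ?s)
      - (of_nat p ^ k m' * of_nat p ^ k ?s * (of_nat p ^ k m * \<theta> m) + of_nat p ^ k m * of_nat p ^ k ?s * (of_nat p ^ k m' * \<theta> m')) \<in> \<int>"
      by (rule Ints_diff[OF Ints_mult[OF pp i(3)] Ints_add[OF Ints_mult[OF pp i(1)] Ints_mult[OF pp i(2)]]])
    then show "of_nat p ^ (k m + k m' + k ?s) * (\<theta> ?s - (\<theta> m + \<theta> m')) \<in> \<int>"
      by (simp add: power_add algebra_simps)
  qed
  then have "\<phi> \<in> carrier (Dual ?i)"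
    unfolding Dual_simps \<phi>_def by (auto simp: Q_mod_Z_carrier Q_mod_Z_mult M.gpart_add)
  moreover have "\<psi> m - q \<in> Zp" if "m \<in> gpart M ?i" "q \<in> \<phi> m" for m q
  proof -
    have "q - \<theta> m \<in> Zp" using that by (simp add: \<phi>_def rat_class_def Ints_Zp)
    then show ?thesis using Zp_trans[OF conjunct2[OF \<theta>[OF that(1)]] Zp_commute] by blast
  qed
  ultimately show ?thesis using h unfolding induces_def \<psi>_def by blast
qed

lemma induces_surj:
  assumes \<phi>: "\<phi> \<in> carrier (Dual (t - D))"
  shows "\<exists>h. induces t h \<phi>"
proof -
  let ?i = "t - D"
  define \<theta> where "\<theta> m = (SOME q. q \<in> \<phi> m)" for m
  have \<theta>: "\<phi> m = rat_class (\<theta> m)" if "m \<in> gpart M ?i" for m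
  proof -
    have "\<theta> m \<in> \<phi> m" unfolding \<theta>_def using Dual_class[OF \<phi> that] someI by metis
    then show ?thesis by (rule Dual_eq_class[OF \<phi> that])
  qed
  have \<theta>0: "\<theta> \<zero>\<^bsub>M\<^esub> \<in> Zp"
  proof -
    have "rat_class (\<theta> \<zero>\<^bsub>M\<^esub>) = rat_class 0" using \<theta>[OF M.gpart_zero] Dual_zero[OF \<phi>] by simp
    then show ?thesis unfolding rat_class_eq by (simp add: Ints_Zp)
  qed
  have "additive_mod 0 ?i (\<lambda>y. \<theta> (aug y))"
    unfolding additive_mod_def
  proof (intro ballI)
    fix y z assume y: "y \<in> gpart (F 0) ?i" and z: "z \<in> gpart (F 0) ?i"
    have "aug (\<lambda>b. y b + z b) = aug y \<oplus>\<^bsub>M\<^esub> aug z" by (rule aug_add) (use y z F_gpart_carrier in blast)+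
    moreover have "\<phi> (aug y \<oplus>\<^bsub>M\<^esub> aug z) = \<phi> (aug y) \<otimes>\<^bsub>Q_mod_Z\<^esub> \<phi> (aug z)"
      using \<phi> aug_gpart[OF y] aug_gpart[OF z] unfolding Dual_simps by blast
    ultimately have "rat_class (\<theta> (aug (\<lambda>b. y b + z b))) = rat_class (\<theta> (aug y) + \<theta> (aug z))"
      using \<theta>[OF aug_gpart[OF F_gpart_add[OF y z]]] \<theta>[OF aug_gpart[OF y]] \<theta>[OF aug_gpart[OF z]]
      by (simp add: Q_mod_Z_mult)
    then show "\<theta> (aug (\<lambda>b. y b + z b)) - (\<theta> (aug y) + \<theta> (aug z)) \<in> Zp"
      unfolding rat_class_eq by (rule Ints_Zp)
  qed
  from represent[OF this] obtain h where h: "h \<in> coch 0 t (A (Suc n))"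
    "\<And>y. y \<in> gpart (F 0) ?i \<Longrightarrow> coef (ev y h) - \<theta> (aug y) \<in> Zp" by blast
  have "\<delta> h \<in> coch (Suc 0) t (B (Suc n))"
    unfolding coch_B_top_iff[OF \<delta>_coch[OF A_coeffs A_stable h(1)]]
  proof (intro ballI allI impI)
    fix b m assume b: "b \<in> X (Suc 0)" and m: "keys m \<subseteq> {1..n}" "int (weight w m) + gen_deg b = ?i"
    have fin: "finite {a. gen_cycle R b a \<noteq> 0}" by (rule gen_cycle_D(1)[OF b])
    let ?y = "\<lambda>a. mon m * gen_cycle R b a"
    have y: "?y \<in> gpart (F 0) ?i"
      using F_gpart_smult[OF mon_hpart[OF m(1)] gen_cycle_gpart[OF b]] m(2) by simp
    have mR: "mon m \<in> carrier R" by (rule R_hpart_carrier[OF mon_hpart[OF m(1)]])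
    have "aug ?y = \<zero>\<^bsub>M\<^esub>"
      using aug_smult[OF mR F_gpart_carrier[OF gen_cycle_gpart[OF b]]] gen_cycle_aug[OF b] M.smult_r_null[OF mR] by simp
    then have "coef (ev ?y h) \<in> Zp" using Zp_shift[OF h(2)[OF y]] \<theta>0 by simp
    then show "coef (ev (unit_vec (mon m) b) (\<delta> h)) \<in> Zp"
      by (simp add: ev_unit_vec \<delta>_def ev_mult[OF fin])
  qed
  then have hc: "h \<in> coc 0 t (Suc n)" using h(1) unfolding coc_def by blast
  have "coef (h (Elt ?i m)) - q \<in> Zp" if m: "m \<in> gpart M ?i" and q: "q \<in> \<phi> m" for m q
  proof -
    have 1: "coef (h (Elt ?i m)) - \<theta> m \<in> Zp"
      using h(2)[OF Elt_vec(1)[OF m]] m by (simp add: ev_unit_vec Elt_vec(2))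
    have "q - \<theta> m \<in> Zp" using q \<theta>[OF m] by (simp add: rat_class_def Ints_Zp)
    from Zp_trans[OF 1 Zp_commute[OF this]] show ?thesis .
  qed
  then show ?thesis using hc \<phi> unfolding induces_def by blast
qed

lemma induces_one_iff:
  assumes "induces t h \<phi>"
  shows "h \<in> cob 0 t (Suc n) \<longleftrightarrow> \<phi> = \<one>\<^bsub>Dual (t - D)\<^esub>"
proof -
  let ?i = "t - D"
  have h: "h \<in> coc 0 t (Suc n)" and hA: "h \<in> coch 0 t (A (Suc n))" and \<phi>: "\<phi> \<in> carrier (Dual ?i)"
    and h\<phi>: "\<And>m q. m \<in> gpart M ?i \<Longrightarrow> q \<in> \<phi> m \<Longrightarrow> coef (h (Elt ?i m)) - q \<in> Zp"
    using assms unfolding induces_def coc_def by auto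
  show ?thesis
  proof
    assume "h \<in> cob 0 t (Suc n)"
    then have hB: "h \<in> coch 0 t (B (Suc n))" by simp
    show "\<phi> = \<one>\<^bsub>Dual ?i\<^esub>"
    proof (rule extensionalityI)
      show "\<phi> \<in> extensional (gpart M ?i)" "\<one>\<^bsub>Dual ?i\<^esub> \<in> extensional (gpart M ?i)"
        using \<phi> unfolding Dual_simps by auto
      fix m assume m: "m \<in> gpart M ?i"
      obtain q where q: "\<phi> m = rat_class q" "q \<in> \<phi> m" by (rule Dual_class[OF \<phi> m])
      have "coef (h (Elt ?i m)) \<in> Zp" by (rule coef_B_top[OF cochD(1)[OF hB Elt_basis[OF m]]])
      then have "q \<in> Zp" using Zp_shift[OF h\<phi>[OF m q(2)]] by simp
      moreover obtain k where "of_nat p ^ k * q \<in> \<int>" by (rule Dual_torsion[OF \<phi> m q(2)])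
      ultimately have "q \<in> \<int>" by (rule localized_ints_integral[OF p])
      then show "\<phi> m = \<one>\<^bsub>Dual ?i\<^esub> m" using m unfolding Dual_simps by (simp add: q Q_mod_Z_one rat_class_eq)
    qed
  next
    assume \<phi>1: "\<phi> = \<one>\<^bsub>Dual ?i\<^esub>"
    have Z: "coef (h (Elt ?i m)) \<in> Zp" if m: "m \<in> gpart M ?i" for m
    proof -
      have "\<phi> m = rat_class 0" unfolding \<phi>1 Dual_simps using m by (simp add: Q_mod_Z_one)
      then show ?thesis using h\<phi>[OF m, of 0] rat_class_self[of 0] by simp
    qed
    have "h \<in> coch 0 t (B (Suc n))"
      unfolding coch_B_top_iff[OF hA]
    proof (intro ballI allI impI)
      fix b m assume b: "b \<in> X 0" and m: "keys m \<subseteq> {1..n}" "int (weight w m) + gen_deg b = ?i"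
      obtain i x where x: "b = Elt i x" "x \<in> gpart M i" using b by auto
      have r: "mon m \<in> hpart R (int (weight w m))" by (rule mon_hpart[OF m(1)])
      have i: "int (weight w m) + i = ?i" using m(2) x(1) by simp
      have "mon m \<odot>\<^bsub>M\<^esub> x \<in> gpart M ?i" using M.gpart_smult[OF r x(2)] i by simp
      then have "coef (emb (mon m) * h (Elt i x)) \<in> Zp"
        using Zp_shift[OF coc_smult[OF h r x(2)]] Z i by simp
      then show "coef (ev (unit_vec (mon m) b) h) \<in> Zp" by (simp add: ev_unit_vec x)
    qed
    then show "h \<in> cob 0 t (Suc n)" by simp
  qed
qed

lemma induces_add:
  assumes 1: "induces t h \<phi>" and 2: "induces t h' \<phi>'"
  shows "induces t (\<lambda>b. h b + h' b) (\<phi> \<otimes>\<^bsub>Dual (t - D)\<^esub> \<phi>')"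
proof -
  let ?i = "t - D"
  interpret comm_group "Dual ?i" by (rule Dual_comm_group)
  have c: "\<phi> \<in> carrier (Dual ?i)" "\<phi>' \<in> carrier (Dual ?i)" using 1 2 unfolding induces_def by auto
  have "coef (h (Elt ?i m) + h' (Elt ?i m)) - q \<in> Zp"
    if m: "m \<in> gpart M ?i" and q: "q \<in> (\<phi> \<otimes>\<^bsub>Dual ?i\<^esub> \<phi>') m" for m q
  proof -
    obtain a where a: "\<phi> m = rat_class a" "a \<in> \<phi> m" by (rule Dual_class[OF c(1) m])
    obtain b where b: "\<phi>' m = rat_class b" "b \<in> \<phi>' m" by (rule Dual_class[OF c(2) m])
    have "q \<in> rat_class (a + b)" using q m a b unfolding Dual_simps by (simp add: Q_mod_Z_mult)
    then have "q - (a + b) \<in> Zp" by (simp add: rat_class_def Ints_Zp)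
    moreover have "coef (h (Elt ?i m)) - a \<in> Zp" "coef (h' (Elt ?i m)) - b \<in> Zp"
      using 1 2 m a b unfolding induces_def by blast+
    ultimately have "(coef (h (Elt ?i m)) - a) + (coef (h' (Elt ?i m)) - b) - (q - (a + b)) \<in> Zp"
      using Zp_intros(1,4) by blast
    then show ?thesis by (simp add: coef_add algebra_simps)
  qed
  then show ?thesis using 1 2 coc_add m_closed[OF c] unfolding induces_def by blast
qed

lemma Dual_act:
  assumes \<phi>: "\<phi> \<in> carrier (Dual i)" and r: "r \<in> hpart R d"
  shows "act (pontryagin_dual M) d i r \<phi> \<in> carrier (Dual (i - d))"
    "x \<in> gpart M (i - d) \<Longrightarrow> act (pontryagin_dual M) d i r \<phi> x = \<phi> (r \<odot>\<^bsub>M\<^esub> x)"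
proof -
  have e: "act (pontryagin_dual M) d i r \<phi> = (\<lambda>x\<in>gpart M (i - d). \<phi> (r \<odot>\<^bsub>M\<^esub> x))"
    by (simp add: pontryagin_dual_def)
  show "x \<in> gpart M (i - d) \<Longrightarrow> act (pontryagin_dual M) d i r \<phi> x = \<phi> (r \<odot>\<^bsub>M\<^esub> x)" unfolding e by simp
  have g: "r \<odot>\<^bsub>M\<^esub> x \<in> gpart M i" if "x \<in> gpart M (i - d)" for x using M.gpart_smult[OF r that] by simp
  have "r \<odot>\<^bsub>M\<^esub> (x \<oplus>\<^bsub>M\<^esub> y) = r \<odot>\<^bsub>M\<^esub> x \<oplus>\<^bsub>M\<^esub> r \<odot>\<^bsub>M\<^esub> y"
    if "x \<in> gpart M (i - d)" "y \<in> gpart M (i - d)" for x y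
    by (rule M.smult_r_distr[OF R_hpart_carrier[OF r] M.gpart_sub[OF that(1)] M.gpart_sub[OF that(2)]])
  then show "act (pontryagin_dual M) d i r \<phi> \<in> carrier (Dual (i - d))"
    using \<phi> g unfolding e Dual_simps by (simp add: M.gpart_add)
qed

lemma induces_mult:
  assumes h: "induces t h \<phi>" and r: "r \<in> hpart R d"
  shows "induces (t - d) (\<lambda>b. emb r * h b) (act (pontryagin_dual M) d (t - D) r \<phi>)"
proof -
  have hc: "h \<in> coc 0 t (Suc n)" and \<phi>: "\<phi> \<in> carrier (Dual (t - D))" using h unfolding induces_def by auto
  have tD: "t - d - D = t - D - d" by simp
  have "coef (emb r * h (Elt (t - D - d) m)) - q \<in> Zp"
    if m: "m \<in> gpart M (t - D - d)" and q: "q \<in> act (pontryagin_dual M) d (t - D) r \<phi> m" for m q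
  proof -
    have g: "r \<odot>\<^bsub>M\<^esub> m \<in> gpart M (t - D)" using M.gpart_smult[OF r m] by simp
    have 1: "coef (emb r * h (Elt (t - D - d) m)) - coef (h (Elt (t - D) (r \<odot>\<^bsub>M\<^esub> m))) \<in> Zp"
      using coc_smult[OF hc r m] by simp
    have "q \<in> \<phi> (r \<odot>\<^bsub>M\<^esub> m)" using q Dual_act(2)[OF \<phi> r m] by simp
    then have 2: "coef (h (Elt (t - D) (r \<odot>\<^bsub>M\<^esub> m))) - q \<in> Zp" using h g unfolding induces_def by blast
    show ?thesis by (rule Zp_trans[OF 1 2])
  qed
  then show ?thesis using coc_mult[OF hc r] Dual_act(1)[OF \<phi> r] unfolding induces_def tD by blast
qed

end


section \<open>Comparison with the groups of graded homomorphisms\<close>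

context locally_finite_gmodule
begin

abbreviation "GH s t \<equiv> graded_Hom R (F s) (regular_gmodule R) t"
abbreviation "cobd \<equiv> coboundary_map F (std_boundary R M)"
abbreviation "Cocyc s t \<equiv> cocycles R F (std_boundary R M) (regular_gmodule R) s t"
abbreviation "Cobd s t \<equiv> coboundaries R F (std_boundary R M) (regular_gmodule R) s t"

lemma GH_iff: "f \<in> carrier (GH s t) \<longleftrightarrow>
    f \<in> extensional (carrier (F s)) \<and> (\<forall>y\<in>carrier (F s). f y \<in> carrier R) \<and>
    (\<forall>y\<in>carrier (F s). \<forall>z\<in>carrier (F s). f (\<lambda>b. y b + z b) = f y + f z) \<and>
    (\<forall>r\<in>carrier R. \<forall>y\<in>carrier (F s). f (\<lambda>b. r * y b) = r * f y) \<and>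
    (\<forall>i. \<forall>y\<in>gpart (F s) i. f y \<in> hpart R (i - t))"
  unfolding graded_Hom_def linear_maps_def hom_def
  by (simp add: F_simps Pi_iff image_subset_iff) blast

lemma GH_simps: "monoid.mult (GH s t) = (\<lambda>f g. \<lambda>x\<in>carrier (F s). f x + g x)"
  "one (GH s t) = (\<lambda>x\<in>carrier (F s). 0)"
  by (simp_all add: graded_Hom_def)

lemma F_add: "y \<in> carrier (F s) \<Longrightarrow> z \<in> carrier (F s) \<Longrightarrow> (\<lambda>b. y b + z b) \<in> carrier (F s)"
  using free_add_closed[of y "X s" gen_deg z] unfolding std_free_def by (simp add: free_simps)

lemma F_smult: "r \<in> carrier R \<Longrightarrow> y \<in> carrier (F s) \<Longrightarrow> (\<lambda>b. r * y b) \<in> carrier (F s)"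
  using free_smult_closed[of r y "X s" gen_deg] unfolding std_free_def by (simp add: free_simps)

lemma F_zero: "(\<lambda>b. 0) \<in> carrier (F s)"
  using F_gpart_zero F_gpart_carrier by blast

lemma F_finite: "y \<in> carrier (F s) \<Longrightarrow> finite {b. y b \<noteq> 0}"
  by (simp add: F_iff)

lemma GH_comm_group: "comm_group (GH s t)"
proof (rule comm_groupI)
  fix f g assume "f \<in> carrier (GH s t)" "g \<in> carrier (GH s t)"
  then show "f \<otimes>\<^bsub>GH s t\<^esub> g \<in> carrier (GH s t)"
    unfolding GH_iff GH_simps
    by (auto simp: F_add F_smult R_closed R_hpart_closed F_gpart_carrier algebra_simps)
next
  show "\<one>\<^bsub>GH s t\<^esub> \<in> carrier (GH s t)"
    unfolding GH_iff GH_simps by (auto simp: F_add F_smult R_closed R_hpart_closed F_gpart_carrier)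
next
  fix f assume f: "f \<in> carrier (GH s t)"
  show "\<one>\<^bsub>GH s t\<^esub> \<otimes>\<^bsub>GH s t\<^esub> f = f"
    using f unfolding GH_iff GH_simps by (auto simp: extensional_def fun_eq_iff)
  have "(\<lambda>y\<in>carrier (F s). - f y) \<in> carrier (GH s t)"
    using f unfolding GH_iff by (auto simp: F_add F_smult R_closed R_hpart_closed F_gpart_carrier)
  moreover have "(\<lambda>y\<in>carrier (F s). - f y) \<otimes>\<^bsub>GH s t\<^esub> f = \<one>\<^bsub>GH s t\<^esub>"
    unfolding GH_simps by (auto simp: fun_eq_iff)
  ultimately show "\<exists>g\<in>carrier (GH s t). g \<otimes>\<^bsub>GH s t\<^esub> f = \<one>\<^bsub>GH s t\<^esub>" by blast
qed (unfold GH_simps, auto simp: fun_eq_iff)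

lemma GH_group: "group (GH s t)"
  using GH_comm_group unfolding comm_group_def by blast

text \<open>The cochain \<open>c\<close> consists of the values of the homomorphism \<open>f\<close> on the basis.\<close>

definition represents :: "nat \<Rightarrow> ((rat_mpoly, 'm) gen \<Rightarrow> laurent) \<Rightarrow>
    (((rat_mpoly, 'm) gen \<Rightarrow> rat_mpoly) \<Rightarrow> rat_mpoly) \<Rightarrow> bool"
  where "represents s c f \<longleftrightarrow> (\<forall>y\<in>carrier (F s). emb (f y) = ev y c)"

lemma representsD: "represents s c f \<Longrightarrow> y \<in> carrier (F s) \<Longrightarrow> emb (f y) = ev y c"
  unfolding represents_def by blast

lemma represents_basis:
  "represents s c f \<Longrightarrow> b \<in> X s \<Longrightarrow> c b = emb (f (unit_vec 1 b))"
  using representsD[OF _ unit_vec_carrier[OF R_closed(2)]] by (simp add: ev_unit_vec)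

lemma represents_ex:
  assumes f: "f \<in> carrier (GH s t)"
  shows "\<exists>c. represents s c f"
proof -
  note f' = f[unfolded GH_iff]
  define c where "c b = emb (f (unit_vec 1 b))" for b
  have "y \<in> carrier (F s) \<and> emb (f y) = ev y c" if y: "y \<in> carrier (F s)" for y
  proof (rule unit_vec_induct[of y "\<lambda>y. y \<in> carrier (F s) \<and> emb (f y) = ev y c"])
    show "finite {b. y b \<noteq> 0}" by (rule F_finite[OF y])
    have "f (\<lambda>b. 0 * y b) = 0 * f y" using f' y R_closed(1) by blast
    then show "(\<lambda>b. 0) \<in> carrier (F s) \<and> emb (f (\<lambda>b. 0)) = ev (\<lambda>b. 0) c" using F_zero by simp
  next
    fix y z assume y: "y \<in> carrier (F s) \<and> emb (f y) = ev y c" and z: "z \<in> carrier (F s) \<and> emb (f z) = ev z c"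
    have "f (\<lambda>b. y b + z b) = f y + f z" using f' y z by blast
    then show "(\<lambda>b. y b + z b) \<in> carrier (F s) \<and> emb (f (\<lambda>b. y b + z b)) = ev (\<lambda>b. y b + z b) c"
      using y z F_add[of y s z] ev_add[OF F_finite F_finite, of y s z s c] by (simp add: emb_add)
  next
    fix b assume "y b \<noteq> 0"
    then have b: "b \<in> X s" and yR: "y b \<in> carrier R" using y unfolding F_iff by auto
    have u1: "unit_vec 1 b \<in> carrier (F s)" by (rule unit_vec_carrier[OF R_closed(2) b])
    have "f (\<lambda>x. y b * unit_vec 1 b x) = y b * f (unit_vec 1 b)" using f' yR u1 by blast
    moreover have "(\<lambda>x. y b * unit_vec 1 b x) = unit_vec (y b) b" by (auto simp: unit_vec_def)
    ultimately show "unit_vec (y b) b \<in> carrier (F s) \<and> emb (f (unit_vec (y b) b)) = ev (unit_vec (y b) b) c"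
      using unit_vec_carrier[OF yR b] by (simp add: emb_mult ev_unit_vec c_def)
  qed
  then show ?thesis unfolding represents_def by blast
qed

lemma represents_coch:
  assumes f: "f \<in> carrier (GH s t)" and c: "represents s c f"
  shows "c \<in> coch s t (A 0)"
proof (rule cochI)
  fix b assume b: "b \<in> X s"
  have "unit_vec 1 b \<in> gpart (F s) (gen_deg b)" using unit_vec_gpart[OF R_hpart_closed(2) b] by simp
  then have "f (unit_vec 1 b) \<in> hpart R (gen_deg b - t)" using f unfolding GH_iff by blast
  then show "c b \<in> laurent_in (A 0)" "c b \<in> homog (gen_deg b - t)"
    unfolding represents_basis[OF c b] R_hpart R_carrier_emb by auto
qed

lemma represents_surj:
  assumes c: "c \<in> coch s t (A 0)"
  shows "\<exists>f\<in>carrier (GH s t). represents s c f"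
proof -
  have "\<exists>r. r \<in> carrier R \<and> emb r = ev y c" if "y \<in> carrier (F s)" for y
    by (rule emb_surj[OF ev_in[OF A_coeffs A_stable c that]]) blast
  then obtain g where g: "\<And>y. y \<in> carrier (F s) \<Longrightarrow> g y \<in> carrier R \<and> emb (g y) = ev y c" by metis
  have "(\<lambda>y\<in>carrier (F s). g y) \<in> carrier (GH s t)"
    unfolding GH_iff
  proof (intro conjI ballI allI)
    fix y z assume y: "y \<in> carrier (F s)" and z: "z \<in> carrier (F s)"
    have "emb (g (\<lambda>b. y b + z b)) = emb (g y + g z)"
      using g[OF F_add[OF y z]] g[OF y] g[OF z] ev_add[OF F_finite[OF y] F_finite[OF z]] by (simp add: emb_add)
    then show "(\<lambda>y\<in>carrier (F s). g y) (\<lambda>b. y b + z b) = (\<lambda>y\<in>carrier (F s). g y) y + (\<lambda>y\<in>carrier (F s). g y) z"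
      using y z F_add[OF y z] by (simp add: emb_inject)
  next
    fix r y assume r: "r \<in> carrier R" and y: "y \<in> carrier (F s)"
    have "emb (g (\<lambda>b. r * y b)) = emb (r * g y)"
      using g[OF F_smult[OF r y]] g[OF y] ev_mult[OF F_finite[OF y]] by (simp add: emb_mult)
    then show "(\<lambda>y\<in>carrier (F s). g y) (\<lambda>b. r * y b) = r * (\<lambda>y\<in>carrier (F s). g y) y"
      using y F_smult[OF r y] by (simp add: emb_inject)
  next
    fix i y assume y: "y \<in> gpart (F s) i"
    show "(\<lambda>y\<in>carrier (F s). g y) y \<in> hpart R (i - t)"
      using g[OF F_gpart_carrier[OF y]] ev_homog[OF c y] F_gpart_carrier[OF y] by (simp add: R_hpart)
  qed (use g in auto)
  moreover have "represents s c (\<lambda>y\<in>carrier (F s). g y)" unfolding represents_def using g by simp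
  ultimately show ?thesis by blast
qed

lemma represents_unique:
  assumes "f \<in> extensional (carrier (F s))" "g \<in> extensional (carrier (F s))"
    and "represents s c f" "represents s c' g" "\<And>b. b \<in> X s \<Longrightarrow> c b = c' b"
  shows "f = g"
proof (rule extensionalityI[OF assms(1,2)])
  fix y assume y: "y \<in> carrier (F s)"
  have "ev y c = ev y c'" by (rule ev_cong) (use y assms(5) in \<open>auto simp: F_iff\<close>)
  then have "emb (f y) = emb (g y)" using representsD[OF assms(3) y] representsD[OF assms(4) y] by simp
  then show "f y = g y" unfolding emb_inject .
qed

lemma GH_extensional: "f \<in> carrier (GH s t) \<Longrightarrow> f \<in> extensional (carrier (F s))"
  unfolding GH_iff by blast

lemma represents_add:
  "represents s c f \<Longrightarrow> represents s c' g \<Longrightarrow> represents s (\<lambda>b. c b + c' b) (f \<otimes>\<^bsub>GH s t\<^esub> g)"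
  unfolding represents_def GH_simps by (simp add: emb_add ev_fun_add)

lemma represents_mult:
  assumes f: "f \<in> carrier (GH s t)" and c: "represents s c f" and r: "r \<in> carrier R"
  shows "represents s (\<lambda>b. emb r * c b) (\<lambda>y\<in>carrier (F s). f (r \<odot>\<^bsub>F s\<^esub> y))"
  unfolding represents_def
proof
  fix y assume y: "y \<in> carrier (F s)"
  have "f (\<lambda>b. r * y b) = r * f y" using f r y unfolding GH_iff by blast
  then show "emb ((\<lambda>y\<in>carrier (F s). f (r \<odot>\<^bsub>F s\<^esub> y)) y) = ev y (\<lambda>b. emb r * c b)"
    using y representsD[OF c y] by (simp add: F_simps emb_mult ev_fun_mult)
qed

lemma bd_carrier: "y \<in> carrier (F (Suc s)) \<Longrightarrow> bd y \<in> carrier (F s)"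
  using std_resolution(4)[OF M_graded, of s] std_boundary_bd[of y s] by (auto simp: linear_maps_def hom_def Pi_iff)

lemma represents_cobd:
  assumes c: "represents s c f"
  shows "represents (Suc s) (\<delta> c) (cobd s f)"
  unfolding represents_def coboundary_map_def
proof
  fix y assume y: "y \<in> carrier (F (Suc s))"
  then show "emb (compose (carrier (F (Suc s))) f (std_boundary R M s) y) = ev y (\<delta> c)"
    using representsD[OF c bd_carrier[OF y]] ev_bd[OF y] by (simp add: compose_def std_boundary_bd)
qed

lemma cobd_extensional: "cobd s f \<in> extensional (carrier (F (Suc s)))"
  by (simp add: coboundary_map_def compose_def)

lemma cobd_closed:
  assumes f: "f \<in> carrier (GH s t)" shows "cobd s f \<in> carrier (GH (Suc s) t)"
proof -
  obtain c where c: "represents s c f" using represents_ex[OF f] by blast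
  obtain g where g: "g \<in> carrier (GH (Suc s) t)" "represents (Suc s) (\<delta> c) g"
    using represents_surj[OF \<delta>_coch[OF A_coeffs A_stable represents_coch[OF f c]]] by blast
  have "cobd s f = g"
    by (rule represents_unique[OF cobd_extensional GH_extensional[OF g(1)] represents_cobd[OF c] g(2)]) simp
  then show ?thesis using g by simp
qed

lemma cobd_hom: "cobd s \<in> hom (GH s t) (GH (Suc s) t)"
proof (rule homI)
  fix f g assume f: "f \<in> carrier (GH s t)" and g: "g \<in> carrier (GH s t)"
  have "std_boundary R M s y \<in> carrier (F s)" if "y \<in> carrier (F (Suc s))" for y
    using bd_carrier[OF that] std_boundary_bd[OF that] by simp
  then show "cobd s (f \<otimes>\<^bsub>GH s t\<^esub> g) = cobd s f \<otimes>\<^bsub>GH (Suc s) t\<^esub> cobd s g"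
    unfolding GH_simps coboundary_map_def compose_def by (auto simp: fun_eq_iff)
qed (rule cobd_closed)

lemma cobd_group_hom: "group_hom (GH s t) (GH (Suc s) t) (cobd s)"
  using cobd_hom GH_comm_group unfolding group_hom_def group_hom_axioms_def comm_group_def by blast

lemma coch_B_0_iff: "c \<in> coch s t (B 0) \<longleftrightarrow> (\<forall>b\<in>X s. c b = 0)"
proof -
  have "laurent_in (B 0) = {0}"
    unfolding laurent_in_def N_def A_def by (auto intro: poly_mapping_eqI)
  then show ?thesis unfolding coch_def using homog_0 by auto
qed

lemma Cocyc_iff:
  assumes f: "f \<in> carrier (GH s t)" and c: "represents s c f"
  shows "f \<in> Cocyc s t \<longleftrightarrow> c \<in> coc s t 0"
proof -
  have r0: "represents (Suc s) (\<lambda>b. 0) \<one>\<^bsub>GH (Suc s) t\<^esub>" unfolding represents_def GH_simps by simp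
  have e0: "\<one>\<^bsub>GH (Suc s) t\<^esub> \<in> extensional (carrier (F (Suc s)))" unfolding GH_simps by simp
  have "cobd s f = \<one>\<^bsub>GH (Suc s) t\<^esub> \<longleftrightarrow> (\<forall>b\<in>X (Suc s). \<delta> c b = 0)"
  proof
    assume eq: "cobd s f = \<one>\<^bsub>GH (Suc s) t\<^esub>"
    show "\<forall>b\<in>X (Suc s). \<delta> c b = 0"
    proof
      fix b assume b: "b \<in> X (Suc s)"
      show "\<delta> c b = 0"
        using represents_basis[OF represents_cobd[OF c] b] represents_basis[OF r0 b] eq by simp
    qed
  next
    assume "\<forall>b\<in>X (Suc s). \<delta> c b = 0"
    then show "cobd s f = \<one>\<^bsub>GH (Suc s) t\<^esub>"
      by (intro represents_unique[OF cobd_extensional e0 represents_cobd[OF c] r0]) blast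
  qed
  then show ?thesis using f represents_coch[OF f c] unfolding cocycles_def kernel_def coc_def coch_B_0_iff by simp
qed

lemma Cobd_iff:
  assumes f: "f \<in> carrier (GH s t)" and c: "represents s c f"
  shows "f \<in> Cobd s t \<longleftrightarrow> c \<in> cob s t 0"
proof (cases s)
  case 0
  have r0: "represents s (\<lambda>b. 0) \<one>\<^bsub>GH s t\<^esub>" unfolding represents_def GH_simps by simp
  have e0: "\<one>\<^bsub>GH s t\<^esub> \<in> extensional (carrier (F s))" unfolding GH_simps by simp
  have "f = \<one>\<^bsub>GH s t\<^esub> \<longleftrightarrow> (\<forall>b\<in>X s. c b = 0)"
  proof
    assume "f = \<one>\<^bsub>GH s t\<^esub>"
    then show "\<forall>b\<in>X s. c b = 0" using represents_basis[OF c] represents_basis[OF r0] by simp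
  next
    assume "\<forall>b\<in>X s. c b = 0"
    then show "f = \<one>\<^bsub>GH s t\<^esub>"
      by (intro represents_unique[OF GH_extensional[OF f] e0 c r0]) blast
  qed
  then show ?thesis unfolding 0 coboundaries.simps cob.simps coch_B_0_iff by blast
next
  case (Suc k)
  show ?thesis
  proof
    assume "f \<in> Cobd s t"
    then obtain g where g: "g \<in> carrier (GH k t)" "f = cobd k g" unfolding Suc by auto
    obtain h where h: "represents k h g" using represents_ex[OF g(1)] by blast
    have "c b - \<delta> h b = 0" if b: "b \<in> X s" for b
      using represents_basis[OF c b] represents_basis[OF represents_cobd[OF h], of b] b g(2) Suc by simp
    then show "c \<in> cob s t 0"
      using represents_coch[OF g(1) h] coch_B_0_iff[of "\<lambda>b. c b - \<delta> h b" "Suc k" t] unfolding Suc by auto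
  next
    assume "c \<in> cob s t 0"
    then obtain h where h: "h \<in> coch k t (A 0)" "\<And>b. b \<in> X s \<Longrightarrow> c b = \<delta> h b"
      unfolding Suc cob.simps coch_B_0_iff by auto
    obtain g where g: "g \<in> carrier (GH k t)" "represents k h g" using represents_surj[OF h(1)] by blast
    have "f = cobd k g"
      using represents_unique[OF GH_extensional[OF f] _ c represents_cobd[OF g(2), folded Suc] h(2)]
        cobd_extensional[of k g] Suc by simp
    then show "f \<in> Cobd s t" using g(1) unfolding Suc by simp
  qed
qed

lemma Cobd_carrier: "Cobd s t \<subseteq> carrier (GH s t)"
proof (cases s)
  case 0
  then show ?thesis using GH_group[of 0 t] by (simp add: group.is_monoid monoid.one_closed)
qed (use cobd_closed in auto)

lemma Cobd_sub_Cocyc: "Cobd s t \<subseteq> Cocyc s t"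
proof
  fix f assume fB: "f \<in> Cobd s t"
  then have f: "f \<in> carrier (GH s t)" using Cobd_carrier by blast
  obtain c where c: "represents s c f" using represents_ex[OF f] by blast
  have "\<delta> c b = 0" if b: "b \<in> X (Suc s)" for b
  proof (cases s)
    case 0
    then have "\<And>b. b \<in> X s \<Longrightarrow> c b = 0" using fB Cobd_iff[OF f c] coch_B_0_iff by simp
    from \<delta>_cong[OF b this] show ?thesis by (simp add: \<delta>_def)
  next
    case (Suc k)
    then obtain h where h: "\<And>b. b \<in> X s \<Longrightarrow> c b = \<delta> h b"
      using fB Cobd_iff[OF f c] by (auto simp: coch_B_0_iff)
    from \<delta>_cong[OF b this] show ?thesis using \<delta>_\<delta> b Suc by simp
  qed
  then show "f \<in> Cocyc s t"
    using Cocyc_iff[OF f c] represents_coch[OF f c] unfolding coc_def coch_B_0_iff by blast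
qed

lemma Cocyc_carrier: "Cocyc s t \<subseteq> carrier (GH s t)"
  unfolding cocycles_def kernel_def by blast

lemma Cocyc_subgroup: "subgroup (Cocyc s t) (GH s t)"
  unfolding cocycles_def by (rule group_hom.subgroup_kernel[OF cobd_group_hom])

lemma Cobd_subgroup: "subgroup (Cobd s t) (GH s t)"
proof (cases s)
  case 0
  then show ?thesis using group.triv_subgroup[OF GH_group] by simp
next
  case (Suc k)
  then show ?thesis using group_hom.img_is_subgroup[OF cobd_group_hom] by simp
qed

abbreviation "CG s t \<equiv> (GH s t)\<lparr>carrier := Cocyc s t\<rparr>"

lemma CG_group: "group (CG s t)"
  by (rule subgroup.subgroup_is_group[OF Cocyc_subgroup GH_group])

lemma CG_normal: "Cobd s t \<lhd> CG s t"
proof -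
  interpret GH: comm_group "GH s t" by (rule GH_comm_group)
  have "comm_group (CG s t)"
  proof (rule group.group_comm_groupI[OF CG_group])
    fix f g assume "f \<in> carrier (CG s t)" "g \<in> carrier (CG s t)"
    then have "f \<in> carrier (GH s t)" "g \<in> carrier (GH s t)" using Cocyc_carrier[of s t] by auto
    then show "f \<otimes>\<^bsub>CG s t\<^esub> g = g \<otimes>\<^bsub>CG s t\<^esub> f" using GH.m_comm by simp
  qed
  then show ?thesis
    by (rule comm_group.subgroup_imp_normal) (rule GH.subgroup_incl[OF Cobd_subgroup Cocyc_subgroup Cobd_sub_Cocyc])
qed

lemma Ext_part: "part (graded_Ext R s M (regular_gmodule R)) t = CG s t Mod Cobd s t"
  by (simp add: graded_Ext_def Hom_cohomology_def)

lemma Ext_act: "act (graded_Ext R s M (regular_gmodule R)) e t r C =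
    Cobd s (t - e) <#>\<^bsub>GH s (t - e)\<^esub> (\<lambda>f. \<lambda>y\<in>carrier (F s). f (r \<odot>\<^bsub>F s\<^esub> y)) ` C"
  by (simp add: graded_Ext_def Hom_cohomology_def)


section \<open>The degrees in which Ext vanishes\<close>

text \<open>For \<open>s \<le> n\<close> the class of \<open>c\<close> is shifted to degree \<open>0\<close>, where \<open>Hom(M, Q\<^sub>s)\<close> embeds into
  \<open>Hom(M, Q\<^sub>s[1/x\<^sub>s]) = 0\<close>. For larger \<open>s\<close> it is shifted to a positive degree with values in the
  injective \<open>Q\<^sub>n\<^sub>+\<^sub>1\<close>.\<close>

lemma coc_sub_cob:
  assumes s: "s \<noteq> Suc n" and c: "c \<in> coc s t 0"
  shows "c \<in> cob s t 0"
proof (cases "s \<le> n")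
  case True
  obtain h where h: "shift s s t c h" using shift_total[OF _ _ c, of s] True by auto
  have hc: "h \<in> coc 0 t s" using shift_coc[OF _ h] by simp
  then have hA: "h \<in> coch 0 t (A s)" and dh: "\<delta> h \<in> coch (Suc 0) t (B s)" unfolding coc_def by auto
  obtain g where g: "g \<in> coch 0 t (B' s)" "\<And>b. b \<in> X 0 \<Longrightarrow> h b = g b"
    using relative_vanishing[OF True coch_A_mono[OF hA] coch_B_B'[OF dh]] by auto
  then have "h \<in> coch 0 t (B' s)" using coch_cong[of 0 h g] by blast
  then have "h \<in> cob 0 t s" using coch_A_B'[OF hA] by simp
  then show ?thesis using shift_cob[OF _ _ h] True by simp
next
  case False
  then obtain k where k: "s - Suc n = Suc k" using s by (metis Suc_diff_Suc Suc_lessI not_le)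
  have le: "Suc n \<le> s" using False by simp
  obtain h where h: "shift s (Suc n) t c h" using shift_total[OF le _ c] by auto
  have "h \<in> coc (Suc k) t (Suc n)" using shift_coc[OF le h] k by simp
  then have "h \<in> cob (s - Suc n) t (Suc n)" unfolding k by (rule top_vanishing)
  then show ?thesis using shift_cob[OF le _ h] by simp
qed

lemma Ext_zero:
  assumes "s \<noteq> Suc n"
  shows "degreewise_zero (graded_Ext R s M (regular_gmodule R))"
  unfolding degreewise_zero_def Ext_part
proof
  fix t
  interpret N: normal "Cobd s t" "CG s t" by (rule CG_normal)
  interpret Q: group "CG s t Mod Cobd s t" by (rule N.factorgroup_is_group)
  have "f \<in> Cobd s t" if f: "f \<in> Cocyc s t" for f
  proof -
    have fG: "f \<in> carrier (GH s t)" using f Cocyc_carrier by blast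
    obtain c where c: "represents s c f" using represents_ex[OF fG] by blast
    show ?thesis using coc_sub_cob[OF assms] f Cocyc_iff[OF fG c] Cobd_iff[OF fG c] by blast
  qed
  then have "carrier (CG s t Mod Cobd s t) \<subseteq> {Cobd s t}"
    unfolding carrier_FactGroup using N.rcos_const by auto
  then show "trivial_group (CG s t Mod Cobd s t)" using Q.trivial_group_alt by blast
qed


section \<open>The isomorphism with the dual\<close>

text \<open>The correspondence between cocycles of degree \<open>n + 1\<close> and elements of the dual, the composite
  of all the connecting isomorphisms with evaluation on \<open>M\<close>.\<close>

definition corresponds :: "int \<Rightarrow> (((rat_mpoly, 'm) gen \<Rightarrow> rat_mpoly) \<Rightarrow> rat_mpoly) \<Rightarrow> ('m \<Rightarrow> rat set) \<Rightarrow> bool"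
  where "corresponds t f \<phi> \<longleftrightarrow> f \<in> Cocyc (Suc n) t \<and>
    (\<exists>c h. represents (Suc n) c f \<and> shift (Suc n) (Suc n) t c h \<and> induces t h \<phi>)"

lemma corresponds_total:
  assumes f: "f \<in> Cocyc (Suc n) t" shows "\<exists>\<phi>. corresponds t f \<phi>"
proof -
  have fG: "f \<in> carrier (GH (Suc n) t)" using f Cocyc_carrier by blast
  obtain c where c: "represents (Suc n) c f" using represents_ex[OF fG] by blast
  have "c \<in> coc (Suc n) t 0" using f Cocyc_iff[OF fG c] by blast
  then obtain h where h: "shift (Suc n) (Suc n) t c h" using shift_total by blast
  have "h \<in> coc 0 t (Suc n)" using shift_coc[OF _ h] by simp
  then obtain \<phi> where "induces t h \<phi>" using induces_total by blast
  then show ?thesis using f c h unfolding corresponds_def by blast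
qed

lemma corresponds_surj:
  assumes "\<phi> \<in> carrier (Dual (t - D))" shows "\<exists>f. corresponds t f \<phi>"
proof -
  obtain h where h: "induces t h \<phi>" using induces_surj[OF assms] by blast
  then have "h \<in> coc (Suc n - Suc n) t (Suc n)" unfolding induces_def by simp
  then obtain c where c: "shift (Suc n) (Suc n) t c h" using shift_surj[OF order_refl order_refl] by blast
  then have cc: "c \<in> coc (Suc n) t 0" using shift_coc by blast
  then obtain f where f: "f \<in> carrier (GH (Suc n) t)" "represents (Suc n) c f"
    using represents_surj unfolding coc_def by blast
  then have "f \<in> Cocyc (Suc n) t" using Cocyc_iff cc by blast
  then show ?thesis using f c h unfolding corresponds_def by blast
qed

lemma corresponds_unique:
  assumes 1: "corresponds t f \<phi>" and 2: "corresponds t f \<phi>'"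
  shows "\<phi> = \<phi>'"
proof -
  obtain c h where c: "represents (Suc n) c f" "shift (Suc n) (Suc n) t c h" "induces t h \<phi>"
    using 1 unfolding corresponds_def by blast
  obtain c' h' where c': "represents (Suc n) c' f" "shift (Suc n) (Suc n) t c' h'" "induces t h' \<phi>'"
    using 2 unfolding corresponds_def by blast
  have "shift (Suc n) (Suc n) t (\<lambda>b. emb (- 1) * c' b) (\<lambda>b. emb (- 1) * h' b)"
    using shift_mult[OF c'(2) R_hpart_closed(5)[OF R_hpart_closed(2)]] by simp
  from shift_add[OF c(2) this]
  have s: "shift (Suc n) (Suc n) t (\<lambda>b. c b - c' b) (\<lambda>b. h b - h' b)" by (simp add: emb_uminus)
  have z: "\<forall>b\<in>X (Suc n). c b - c' b = 0"
    using represents_basis[OF c(1)] represents_basis[OF c'(1)] by simp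
  have "(\<lambda>b. (c b - c' b) - \<delta> (\<lambda>b. 0) b) \<in> coch (Suc n) t (B 0)"
    unfolding coch_B_0_iff using z by (simp add: \<delta>_def)
  then have "(\<lambda>b. c b - c' b) \<in> cob (Suc n) t 0"
    unfolding cob.simps using coch_zero[OF A_coeffs] by blast
  then have "(\<lambda>b. h b - h' b) \<in> cob (Suc n - Suc n) t (Suc n)" using shift_cob[OF _ _ s] by blast
  then have hB: "(\<lambda>b. h b - h' b) \<in> coch 0 t (B (Suc n))" by simp
  show ?thesis
  proof (rule induces_unique[OF c(3) c'(3)])
    fix m assume m: "m \<in> gpart M (t - D)"
    let ?b = "Elt (t - D) m :: (rat_mpoly, 'm) gen"
    have "coef (h ?b - h' ?b) \<in> Zp" by (rule coef_B_top[OF cochD(1)[OF hB Elt_basis[OF m]]])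
    then show "coef (h ?b) - coef (h' ?b) \<in> Zp" by (simp add: coef_diff)
  qed
qed

lemma corresponds_Dual: "corresponds t f \<phi> \<Longrightarrow> \<phi> \<in> carrier (Dual (t - D))"
  unfolding corresponds_def induces_def by blast

lemma corresponds_add:
  assumes "corresponds t f \<phi>" "corresponds t g \<psi>"
  shows "corresponds t (f \<otimes>\<^bsub>GH (Suc n) t\<^esub> g) (\<phi> \<otimes>\<^bsub>Dual (t - D)\<^esub> \<psi>)"
  using assms represents_add shift_add induces_add subgroup.m_closed[OF Cocyc_subgroup]
  unfolding corresponds_def by meson

lemma corresponds_one_iff:
  assumes "corresponds t f \<phi>"
  shows "f \<in> Cobd (Suc n) t \<longleftrightarrow> \<phi> = \<one>\<^bsub>Dual (t - D)\<^esub>"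
proof -
  obtain c h where c: "represents (Suc n) c f" "shift (Suc n) (Suc n) t c h" "induces t h \<phi>"
    using assms unfolding corresponds_def by blast
  have f: "f \<in> carrier (GH (Suc n) t)" using assms Cocyc_carrier unfolding corresponds_def by blast
  have "h \<in> cob (Suc n - Suc n) t (Suc n) \<longleftrightarrow> \<phi> = \<one>\<^bsub>Dual (t - D)\<^esub>" using induces_one_iff[OF c(3)] by simp
  then show ?thesis using Cobd_iff[OF f c(1)] shift_cob[OF order_refl order_refl c(2)] by blast
qed

lemma corresponds_mult:
  assumes f: "corresponds t f \<phi>" and r: "r \<in> hpart R d"
  shows "corresponds (t - d) (\<lambda>y\<in>carrier (F (Suc n)). f (r \<odot>\<^bsub>F (Suc n)\<^esub> y))
           (act (pontryagin_dual M) d (t - D) r \<phi>)"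
proof -
  let ?g = "\<lambda>y\<in>carrier (F (Suc n)). f (r \<odot>\<^bsub>F (Suc n)\<^esub> y)"
  obtain c h where c: "represents (Suc n) c f" "shift (Suc n) (Suc n) t c h" "induces t h \<phi>"
    using f unfolding corresponds_def by blast
  have fG: "f \<in> carrier (GH (Suc n) t)" using f Cocyc_carrier unfolding corresponds_def by blast
  have rc: "represents (Suc n) (\<lambda>b. emb r * c b) ?g" by (rule represents_mult[OF fG c(1) R_hpart_carrier[OF r]])
  have sh: "shift (Suc n) (Suc n) (t - d) (\<lambda>b. emb r * c b) (\<lambda>b. emb r * h b)" by (rule shift_mult[OF c(2) r])
  then have coc: "(\<lambda>b. emb r * c b) \<in> coc (Suc n) (t - d) 0" using shift_coc by blast
  then obtain g where g: "g \<in> carrier (GH (Suc n) (t - d))" "represents (Suc n) (\<lambda>b. emb r * c b) g"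
    using represents_surj unfolding coc_def by blast
  have "?g = g" by (rule represents_unique[OF _ GH_extensional[OF g(1)] rc g(2)]) auto
  then have "?g \<in> Cocyc (Suc n) (t - d)" using Cocyc_iff[OF g] coc by simp
  then show ?thesis using rc sh induces_mult[OF c(3) r] unfolding corresponds_def by blast
qed

text \<open>The correspondence as a map from cocycles to the dual.\<close>

definition to_dual :: "int \<Rightarrow> (((rat_mpoly, 'm) gen \<Rightarrow> rat_mpoly) \<Rightarrow> rat_mpoly) \<Rightarrow> 'm \<Rightarrow> rat set"
  where "to_dual t f = (THE \<phi>. corresponds t f \<phi>)"

lemma to_dual_eq: "corresponds t f \<phi> \<Longrightarrow> to_dual t f = \<phi>"
  unfolding to_dual_def using corresponds_unique by blast

lemma to_dual_corresponds: "f \<in> Cocyc (Suc n) t \<Longrightarrow> corresponds t f (to_dual t f)"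
  using corresponds_total to_dual_eq by metis

lemma to_dual_closed: "f \<in> Cocyc (Suc n) t \<Longrightarrow> to_dual t f \<in> carrier (Dual (t - D))"
  by (rule corresponds_Dual[OF to_dual_corresponds])

lemma to_dual_hom: "to_dual t \<in> hom (CG (Suc n) t) (Dual (t - D))"
proof (rule homI)
  fix f assume "f \<in> carrier (CG (Suc n) t)"
  then show "to_dual t f \<in> carrier (Dual (t - D))" using to_dual_closed by simp
next
  fix f g assume "f \<in> carrier (CG (Suc n) t)" "g \<in> carrier (CG (Suc n) t)"
  then show "to_dual t (f \<otimes>\<^bsub>CG (Suc n) t\<^esub> g) = to_dual t f \<otimes>\<^bsub>Dual (t - D)\<^esub> to_dual t g"
    using to_dual_eq[OF corresponds_add[OF to_dual_corresponds to_dual_corresponds]] by simp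
qed

lemma to_dual_group_hom: "group_hom (CG (Suc n) t) (Dual (t - D)) (to_dual t)"
  using to_dual_hom CG_group Dual_comm_group unfolding group_hom_def group_hom_axioms_def comm_group_def by blast

lemma to_dual_kernel: "kernel (CG (Suc n) t) (Dual (t - D)) (to_dual t) = Cobd (Suc n) t"
proof -
  have "f \<in> Cobd (Suc n) t \<longleftrightarrow> to_dual t f = \<one>\<^bsub>Dual (t - D)\<^esub>" if "f \<in> Cocyc (Suc n) t" for f
    by (rule corresponds_one_iff[OF to_dual_corresponds[OF that]])
  then show ?thesis unfolding kernel_def using Cobd_sub_Cocyc[of "Suc n" t] by auto
qed

lemma to_dual_image: "to_dual t ` carrier (CG (Suc n) t) = carrier (Dual (t - D))"
proof
  show "carrier (Dual (t - D)) \<subseteq> to_dual t ` carrier (CG (Suc n) t)"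
  proof
    fix \<phi> assume "\<phi> \<in> carrier (Dual (t - D))"
    then obtain f where f: "corresponds t f \<phi>" using corresponds_surj by blast
    then have "f \<in> Cocyc (Suc n) t" unfolding corresponds_def by blast
    then show "\<phi> \<in> to_dual t ` carrier (CG (Suc n) t)" using to_dual_eq[OF f] by force
  qed
qed (use to_dual_closed in auto)

lemma to_dual_coset:
  assumes "C \<in> carrier (CG (Suc n) t Mod Cobd (Suc n) t)"
  obtains f where "f \<in> Cocyc (Suc n) t" "f \<in> C" "C \<subseteq> Cocyc (Suc n) t" "\<forall>g\<in>C. to_dual t g = to_dual t f"
proof -
  interpret N: normal "Cobd (Suc n) t" "CG (Suc n) t" by (rule CG_normal)
  interpret h: group_hom "CG (Suc n) t" "Dual (t - D)" "to_dual t" by (rule to_dual_group_hom)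
  obtain f where f: "f \<in> carrier (CG (Suc n) t)" "C = Cobd (Suc n) t #>\<^bsub>CG (Suc n) t\<^esub> f"
    using assms unfolding carrier_FactGroup by auto
  have "to_dual t g = to_dual t f" if g: "g \<in> C" for g
  proof -
    obtain k where k: "k \<in> Cobd (Suc n) t" "g = k \<otimes>\<^bsub>CG (Suc n) t\<^esub> f" using g unfolding f(2) r_coset_def by auto
    have kc: "k \<in> carrier (CG (Suc n) t)" "to_dual t k = \<one>\<^bsub>Dual (t - D)\<^esub>"
      using k(1) to_dual_kernel[of t] unfolding kernel_def by auto
    show ?thesis unfolding k(2) using h.hom_mult[OF kc(1) f(1)] kc(2) h.hom_closed[OF f(1)] by simp
  qed
  then have eq: "\<forall>g\<in>C. to_dual t g = to_dual t f" by blast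
  have fC: "f \<in> C" unfolding f(2) by (rule N.rcos_self[OF f(1) N.is_subgroup])
  have "C \<subseteq> carrier (CG (Suc n) t)" unfolding f(2) by (rule N.r_coset_subset_G[OF N.subset f(1)])
  then have sub: "C \<subseteq> Cocyc (Suc n) t" by simp
  have "f \<in> Cocyc (Suc n) t" using f(1) by simp
  then show ?thesis by (rule that[OF _ fC sub eq])
qed

lemma Ext_iso: "degreewise_iso R (graded_Ext R (Suc n) M (regular_gmodule R)) (suspension D (pontryagin_dual M))"
  unfolding degreewise_iso_def
proof (intro exI[of _ "\<lambda>t C. the_elem (to_dual t ` C)"] conjI allI ballI)
  fix t
  have "(\<lambda>C. the_elem (to_dual t ` C)) \<in> iso (CG (Suc n) t Mod Cobd (Suc n) t) (Dual (t - D))"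
    using group_hom.FactGroup_iso_set[OF to_dual_group_hom to_dual_image] unfolding to_dual_kernel .
  then show "(\<lambda>C. the_elem (to_dual t ` C)) \<in>
      iso (part (graded_Ext R (Suc n) M (regular_gmodule R)) t) (part (suspension D (pontryagin_dual M)) t)"
    unfolding Ext_part by (simp add: suspension_def)
next
  fix d t r C assume r: "r \<in> hpart R d" and C: "C \<in> carrier (part (graded_Ext R (Suc n) M (regular_gmodule R)) t)"
  let ?\<rho> = "\<lambda>f. \<lambda>y\<in>carrier (F (Suc n)). f (r \<odot>\<^bsub>F (Suc n)\<^esub> y)"
  let ?C' = "Cobd (Suc n) (t - d) <#>\<^bsub>GH (Suc n) (t - d)\<^esub> ?\<rho> ` C"
  let ?\<phi> = "act (pontryagin_dual M) d (t - D) r"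
  interpret h: group_hom "CG (Suc n) (t - d)" "Dual (t - d - D)" "to_dual (t - d)" by (rule to_dual_group_hom)
  obtain f where f: "f \<in> Cocyc (Suc n) t" "f \<in> C" "C \<subseteq> Cocyc (Suc n) t" "\<forall>g\<in>C. to_dual t g = to_dual t f"
    by (rule to_dual_coset[OF C[unfolded Ext_part]])
  have \<rho>: "corresponds (t - d) (?\<rho> g) (?\<phi> (to_dual t f))" if "g \<in> C" for g
    using corresponds_mult[OF to_dual_corresponds r, of g t] f(3,4) that by auto
  have "to_dual (t - d) x = ?\<phi> (to_dual t f)" if xC: "x \<in> ?C'" for x
  proof -
    obtain k g where k: "k \<in> Cobd (Suc n) (t - d)" and g: "g \<in> C" and x: "x = k \<otimes>\<^bsub>GH (Suc n) (t - d)\<^esub> ?\<rho> g"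
      using xC unfolding set_mult_def by blast
    have kc: "k \<in> carrier (CG (Suc n) (t - d))" "to_dual (t - d) k = \<one>\<^bsub>Dual (t - d - D)\<^esub>"
      using k to_dual_kernel[of "t - d"] unfolding kernel_def by auto
    have gc: "?\<rho> g \<in> carrier (CG (Suc n) (t - d))" using \<rho>[OF g] unfolding corresponds_def by simp
    have "to_dual (t - d) x = to_dual (t - d) (?\<rho> g)"
      using h.hom_mult[OF kc(1) gc] kc(2) h.hom_closed[OF gc] x by simp
    then show ?thesis using to_dual_eq[OF \<rho>[OF g]] by simp
  qed
  moreover have "\<one>\<^bsub>GH (Suc n) (t - d)\<^esub> \<otimes>\<^bsub>GH (Suc n) (t - d)\<^esub> ?\<rho> f \<in> ?C'"
    unfolding set_mult_def
    by (intro UN_I[OF subgroup.one_closed[OF Cobd_subgroup]] UN_I[OF imageI[OF f(2)]] singletonI)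
  ultimately have "to_dual (t - d) ` ?C' = {?\<phi> (to_dual t f)}"
    by (intro equalityI subsetI) (auto intro: rev_image_eqI)
  moreover have "to_dual t ` C = {to_dual t f}" using f(2,4) by blast
  ultimately show "the_elem (to_dual (t - d) ` act (graded_Ext R (Suc n) M (regular_gmodule R)) d t r C) =
     act (suspension D (pontryagin_dual M)) d t r (the_elem (to_dual t ` C))"
    unfolding Ext_act by (simp add: suspension_def)
qed

end


theorem theorem1p2:
  fixes p n :: nat and w :: "nat \<Rightarrow> nat" and D :: int
    and R :: "rat_mpoly gring" and M :: "(rat_mpoly, 'm) gmodule"
  assumes "Factorial_Ring.prime p"
    and "\<And>i. i \<in> {1..n} \<Longrightarrow> 0 < w i"
    and "R = graded_poly_ring p n w"
    and "D = (\<Sum>i=1..n. int (w i))"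
    and "graded_module R M"
    and "locally_finite R M"
  shows "degreewise_iso R (graded_Ext R (n + 1) M (regular_gmodule R))
             (suspension D (pontryagin_dual M)) \<and>
         (\<forall>s. s \<noteq> n + 1 \<longrightarrow> degreewise_zero (graded_Ext R s M (regular_gmodule R)))"
proof -
  interpret weighted_poly_ring p n w
    using assms(1,2) by unfold_locales
  interpret locally_finite_gmodule p n w M
    using assms(3,5,6)
    by (intro locally_finite_gmodule.intro poly_gmodule.intro weighted_poly_ring_axioms
        locally_finite_gmodule_axioms.intro) simp_all
  have "D = weighted_poly_ring.D n w"
    by (simp add: assms(4) D_def)
  then show ?thesis
    using Ext_iso Ext_zero by (simp add: assms(3))
qed

end
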